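(* Let $\mathcal H$ be a class of graphs closed under taking subgraphs, and suppose that for every $\delta'>0$ there is an algorithm $Q_{\delta'}$ which, given any graph in $\mathcal H$, outputs the number of perfect matchings of that graph within multiplicative error $\delta'$ (i.e., a value in $[(1-\delta')N,(1+\delta')N]$, where $N$ is the true number). Given $\delta>0$ and $\lambda>0$, and a graph $G=(V,E)\in\mathcal H$ with $n=|V|$ and $m=|E|$, let \[ t:=\frac{n^2}{2}\left(m\log(1+\lambda)+\log\frac{3}{\delta}\right),\qquad \delta':=\frac{\log(1+\frac{\delta}{3})}{t}=\frac{\delta}{O\!\left(n^2\left(m\log\lambda+\log\frac1\delta\right)\right)}. \] Then there exists a randomized algorithm $A$ which, for every graph $G=(V,E)\in\mathcal H$, outputs a random matching of $G$ whose distribution is within total variation distance $\delta$ of $\mu_{E;\lambda,G}$, and which makes $O\!\left(n^2\left(m\log\lambda+\log\frac1\delta\right)\right)$ calls of $Q_{\delta'}$ and $m$ calls of $Q_{\delta/(3m)}$, all on subgraphs of $G$.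
   Context: For a graph $G=(V,E)$ and $\lambda>0$, $\mu_{E;\lambda,G}$ is the Gibbs distribution on matchings of $G$: $\mu_{E;\lambda,G}(M)=\lambda^{|M|}/Z$ for each matching $M\subseteq E$, where $Z=\sum_{M'}\lambda^{|M'|}$ over all matchings $M'$ of $G$. A perfect matching is a matching covering every vertex.
   Formalization: The order O(n²(m log λ + log(1/δ))), which is negative or too small for λ near or below 1 or δ near or above 1, is read as O(max(0,t)) for all λ, δ > 0 and claimed literally (calls and δ') only for λ ≥ 2, δ ≤ 1/2; a polynomial bound on the other work of A is added. *)

theory Defs
  imports "HOL-Probability.Probability"
begin

section \<open>Graphs, matchings and the Gibbs distribution\<close>

type_synonym graph = "nat set \<times> nat set set"

abbreviation verts :: "graph \<Rightarrow> nat set" where "verts G \<equiv> fst G"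
abbreviation edges :: "graph \<Rightarrow> nat set set" where "edges G \<equiv> snd G"

definition simple_graph :: "graph \<Rightarrow> bool" where
  "simple_graph G \<longleftrightarrow> finite (verts G) \<and> (\<forall>e\<in>edges G. e \<subseteq> verts G \<and> card e = 2)"

definition subgraph :: "graph \<Rightarrow> graph \<Rightarrow> bool" where
  "subgraph K G \<longleftrightarrow> simple_graph K \<and> verts K \<subseteq> verts G \<and> edges K \<subseteq> edges G"

definition subgraph_closed :: "graph set \<Rightarrow> bool" where
  "subgraph_closed \<H> \<longleftrightarrow> (\<forall>G\<in>\<H>. \<forall>K. subgraph K G \<longrightarrow> K \<in> \<H>)"

definition matching :: "graph \<Rightarrow> nat set set \<Rightarrow> bool" where
  "matching G M \<longleftrightarrow> M \<subseteq> edges G \<and> disjoint M"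

definition perfect_matching :: "graph \<Rightarrow> nat set set \<Rightarrow> bool" where
  "perfect_matching G M \<longleftrightarrow> matching G M \<and> \<Union>M = verts G"

definition num_perfect_matchings :: "graph \<Rightarrow> nat" where
  "num_perfect_matchings G = card {M. perfect_matching G M}"

definition partition_function :: "real \<Rightarrow> graph \<Rightarrow> real" where
  "partition_function lam G = (\<Sum>M | matching G M. lam ^ card M)"

definition gibbs :: "real \<Rightarrow> graph \<Rightarrow> nat set set pmf" where
  "gibbs lam G =
     embed_pmf (\<lambda>M. if matching G M then lam ^ card M / partition_function lam G else 0)"

lemma finite_edges:
  assumes "simple_graph G"
  shows "finite (edges G)"
proof (rule finite_subset)
  show "edges G \<subseteq> Pow (verts G)" using assms by (auto simp: simple_graph_def)
  show "finite (Pow (verts G))" using assms by (simp add: simple_graph_def)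
qed

lemma finite_matchings:
  assumes "simple_graph G"
  shows "finite {M. matching G M}"
  by (rule finite_subset[of _ "Pow (edges G)"])
    (auto simp: matching_def finite_edges[OF assms])

lemma partition_function_pos:
  assumes "simple_graph G" "lam > 0"
  shows "partition_function lam G > 0"
  unfolding partition_function_def
proof (rule sum_pos)
  show "finite {M. matching G M}" using assms(1) by (rule finite_matchings)
  have "matching G {}" by (simp add: matching_def)
  then show "{M. matching G M} \<noteq> {}" by blast
qed (use assms in simp)

lemma pmf_gibbs:
  assumes "simple_graph G" "lam > 0"
  shows "pmf (gibbs lam G) M =
           (if matching G M then lam ^ card M / partition_function lam G else 0)"
  unfolding gibbs_def
proof (rule pmf_embed_pmf)
  let ?f = "\<lambda>M. if matching G M then lam ^ card M / partition_function lam G else 0"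
  let ?S = "{M. matching G M}"
  have Z: "partition_function lam G > 0" using assms by (rule partition_function_pos)
  show nonneg: "0 \<le> ?f M" for M using assms Z by simp
  have "(\<integral>\<^sup>+ M. ennreal (?f M) \<partial>count_space UNIV) = (\<Sum>M\<in>?S. ennreal (?f M))"
    by (rule nn_integral_count_space'[OF finite_matchings[OF assms(1)]]) auto
  also have "\<dots> = ennreal (\<Sum>M\<in>?S. ?f M)"
    using nonneg by (intro sum_ennreal) blast
  also have "(\<Sum>M\<in>?S. ?f M) = (\<Sum>M\<in>?S. lam ^ card M) / partition_function lam G"
    by (simp add: sum_divide_distrib)
  also have "\<dots> = 1" using Z by (simp add: partition_function_def)
  finally show "(\<integral>\<^sup>+ M. ennreal (?f M) \<partial>count_space UNIV) = 1" by simp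
qed

definition tv_distance :: "'a pmf \<Rightarrow> 'a pmf \<Rightarrow> real" where
  "tv_distance p q = (SUP X. \<bar>measure_pmf.prob p X - measure_pmf.prob q X\<bar>)"

definition approx_pm_counter :: "graph set \<Rightarrow> real \<Rightarrow> (graph \<Rightarrow> real) \<Rightarrow> bool" where
  "approx_pm_counter \<H> \<epsilon> q \<longleftrightarrow>
     (\<forall>G\<in>\<H>. (1 - \<epsilon>) * real (num_perfect_matchings G) \<le> q G \<and>
            q G \<le> (1 + \<epsilon>) * real (num_perfect_matchings G))"


section \<open>Randomized oracle algorithms\<close>

text \<open>
  An algorithm is a program for a randomized random access machine with exact real
  arithmetic. The machine has countably many arrays of natural numbers and countably many
  arrays of reals; program texts contain no constants other than natural numbers. Apart from
  the usual instructions it can toss a coin of prescribed bias and query one of two oracles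
  (selected by the Boolean argument of \<open>Query\<close>). The value of a real expression can
  influence control flow only through comparisons and as an iteration count, and every
  iteration is charged.
\<close>

datatype nexp =
    Num nat
  | NGet nat nexp
  | NAdd nexp nexp
  | NSub nexp nexp

datatype rexp =
    OfNat nexp
  | RGet nat nexp
  | RAdd rexp rexp
  | RSub rexp rexp
  | RMul rexp rexp
  | RDiv rexp rexp
  | RLn rexp

datatype bexp =
    NLe nexp nexp
  | RLe rexp rexp
  | BNot bexp
  | BAnd bexp bexp

datatype program =
    Skip
  | NSet nat nexp nexp
  | RSet nat nexp rexp
  | Seq program program
  | Cond bexp program program
  | Repeat rexp program
  | Flip nat nexp rexp
  | Query bool nat nexp

record state =
  nmem :: "nat \<Rightarrow> nat \<Rightarrow> nat"
  rmem :: "nat \<Rightarrow> nat \<Rightarrow> real"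
  queries :: "(bool \<times> graph) list"
  steps :: nat

primrec nval :: "nexp \<Rightarrow> state \<Rightarrow> nat" where
  "nval (Num k) s = k"
| "nval (NGet a i) s = nmem s a (nval i s)"
| "nval (NAdd x y) s = nval x s + nval y s"
| "nval (NSub x y) s = nval x s - nval y s"

primrec rval :: "rexp \<Rightarrow> state \<Rightarrow> real" where
  "rval (OfNat x) s = real (nval x s)"
| "rval (RGet a i) s = rmem s a (nval i s)"
| "rval (RAdd x y) s = rval x s + rval y s"
| "rval (RSub x y) s = rval x s - rval y s"
| "rval (RMul x y) s = rval x s * rval y s"
| "rval (RDiv x y) s = rval x s / rval y s"
| "rval (RLn x) s = ln (rval x s)"

primrec bval :: "bexp \<Rightarrow> state \<Rightarrow> bool" where
  "bval (NLe x y) s \<longleftrightarrow> nval x s \<le> nval y s"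
| "bval (RLe x y) s \<longleftrightarrow> rval x s \<le> rval y s"
| "bval (BNot b) s \<longleftrightarrow> \<not> bval b s"
| "bval (BAnd b c) s \<longleftrightarrow> bval b s \<and> bval c s"

definition tick :: "state \<Rightarrow> state" where
  "tick s = s\<lparr>steps := Suc (steps s)\<rparr>"

definition nupd :: "nat \<Rightarrow> nat \<Rightarrow> nat \<Rightarrow> state \<Rightarrow> state" where
  "nupd a i x s = s\<lparr>nmem := (nmem s)(a := (nmem s a)(i := x))\<rparr>"

definition rupd :: "nat \<Rightarrow> nat \<Rightarrow> real \<Rightarrow> state \<Rightarrow> state" where
  "rupd a i x s = s\<lparr>rmem := (rmem s)(a := (rmem s a)(i := x))\<rparr>"

text \<open>
  The input graph is presented by a list \<open>vs\<close> of its vertices and a list \<open>es\<close> of its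
  edges, the latter as pairs of positions in \<open>vs\<close>, both in arbitrary order.
\<close>

type_synonym presentation = "nat list \<times> (nat \<times> nat) list"

definition nth_edge :: "presentation \<Rightarrow> nat \<Rightarrow> nat set" where
  "nth_edge P k = (case snd P ! k of (i, j) \<Rightarrow> {fst P ! i, fst P ! j})"

definition presents :: "presentation \<Rightarrow> graph \<Rightarrow> bool" where
  "presents P G \<longleftrightarrow>
     distinct (fst P) \<and> set (fst P) = verts G \<and>
     (\<forall>(i, j) \<in> set (snd P). i < length (fst P) \<and> j < length (fst P)) \<and>
     inj_on (nth_edge P) {..<length (snd P)} \<and>
     nth_edge P ` {..<length (snd P)} = edges G"

text \<open>
  Memory layout. Initially array 0 of naturals holds \<open>n\<close> and \<open>m\<close>, arrays 1 and 2 hold the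
  end points of the edges, and array 0 of reals holds \<open>lam\<close> and \<open>\<delta>\<close>; every other cell is 0.
  A query concerns the subgraph whose vertices and edges are flagged by nonzero entries of
  arrays 3 and 4 (flagged edges lacking a flagged end point are dropped). The output is the
  set of edges flagged in array 5.
\<close>

definition init_state :: "presentation \<Rightarrow> real \<Rightarrow> real \<Rightarrow> state" where
  "init_state P lam \<delta> = \<lparr>
     nmem = (\<lambda>a i.
       if a = 0 \<and> i = 0 then length (fst P)
       else if a = 0 \<and> i = 1 then length (snd P)
       else if a = 1 \<and> i < length (snd P) then fst (snd P ! i)
       else if a = 2 \<and> i < length (snd P) then snd (snd P ! i)
       else 0),
     rmem = (\<lambda>a i. if a = 0 \<and> i = 0 then lam else if a = 0 \<and> i = 1 then \<delta> else 0),
     queries = [],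
     steps = 0\<rparr>"

definition flagged_graph :: "presentation \<Rightarrow> state \<Rightarrow> graph" where
  "flagged_graph P s =
     (let W = {fst P ! i | i. i < length (fst P) \<and> nmem s 3 i \<noteq> 0}
      in (W, {nth_edge P k | k. k < length (snd P) \<and> nmem s 4 k \<noteq> 0 \<and> nth_edge P k \<subseteq> W}))"

definition output_edges :: "presentation \<Rightarrow> state \<Rightarrow> nat set set" where
  "output_edges P s = {nth_edge P k | k. k < length (snd P) \<and> nmem s 5 k \<noteq> 0}"

text \<open>
  In \<open>Flip\<close>, note that \<open>bernoulli_pmf\<close> truncates its argument to the unit interval; in
  \<open>Repeat\<close>, a negative bound gives no iterations.
\<close>

primrec exec ::
  "presentation \<Rightarrow> (bool \<Rightarrow> graph \<Rightarrow> real) \<Rightarrow> program \<Rightarrow> state \<Rightarrow> state pmf" where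
  "exec P orc Skip s = return_pmf (tick s)"
| "exec P orc (NSet a i x) s = return_pmf (tick (nupd a (nval i s) (nval x s) s))"
| "exec P orc (RSet a i x) s = return_pmf (tick (rupd a (nval i s) (rval x s) s))"
| "exec P orc (Seq c d) s = bind_pmf (exec P orc c s) (exec P orc d)"
| "exec P orc (Cond b c d) s = (if bval b s then exec P orc c (tick s) else exec P orc d (tick s))"
| "exec P orc (Repeat x c) s =
     ((\<lambda>p. bind_pmf p (\<lambda>s'. exec P orc c (tick s'))) ^^ nat \<lceil>rval x s\<rceil>) (return_pmf (tick s))"
| "exec P orc (Flip a i x) s =
     map_pmf (\<lambda>b. tick (nupd a (nval i s) (of_bool b) s)) (bernoulli_pmf (rval x s))"
| "exec P orc (Query b a i) s =
     (let K = flagged_graph P s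
      in return_pmf (tick (rupd a (nval i s) (orc b K) (s\<lparr>queries := queries s @ [(b, K)]\<rparr>))))"

definition calls :: "bool \<Rightarrow> state \<Rightarrow> nat" where
  "calls b s = length (filter (\<lambda>q. fst q = b) (queries s))"


section \<open>Parameters\<close>

definition walk_length :: "nat \<Rightarrow> nat \<Rightarrow> real \<Rightarrow> real \<Rightarrow> real" where
  "walk_length n m lam \<delta> = (real n)\<^sup>2 / 2 * (real m * ln (1 + lam) + ln (3 / \<delta>))"

definition walk_accuracy :: "nat \<Rightarrow> nat \<Rightarrow> real \<Rightarrow> real \<Rightarrow> real" where
  "walk_accuracy n m lam \<delta> = ln (1 + \<delta> / 3) / walk_length n m lam \<delta>"

end

theory Submission
  imports Defs
begin

text \<open>
  The set \<open>S\<close> of vertices covered by a Gibbs matching has weight \<open>lam ^ (|S| / 2)\<close> times the number of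
  perfect matchings of \<open>G[S]\<close>. The algorithm runs heat-bath dynamics on \<open>S\<close>: pick vertices \<open>u, v\<close>
  uniformly and resample between \<open>S\<close> and its symmetric difference with \<open>{u, v}\<close>, the weights being
  supplied by the oracle. Afterwards it draws a perfect matching of \<open>G[S]\<close> edge by edge.

  Rapid mixing rests on an exchange argument. If \<open>M\<close> covers \<open>x\<close> and \<open>M'\<close> does not, swapping the component
  of \<open>x\<close> in the union of \<open>M\<close> and \<open>M'\<close> preserves the product of the weights and changes the set
  covered by \<open>M\<close> in \<open>x\<close> and exactly one further vertex. This couples the measure conditioned on \<open>x\<close>
  being covered with the one conditioned on \<open>x\<close> being uncovered through single moves of the dynamics, and
  fixing the vertices one after another yields a Poincare inequality with constant 1, that is, a
  spectral gap of order \<open>1 / n\<^sup>2\<close> for every \<open>lam\<close>.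

  Since the oracle is a function, the dynamics with approximate weights is reversible for a measure
  that is itself pointwise close to the ideal one, so oracle errors do not accumulate along the walk.
\<close>

section \<open>Swapping a component of two matchings\<close>

text \<open>Covered sets have even size, so a single toggle would always leave the support; this is
  why moves toggle two vertices. Resampling within a pair is a projection and loses exactly the pair
  energy, so a Poincare inequality alone yields contraction by \<open>1 - 1 / n\<^sup>2\<close>,
  without a separate bound on negative eigenvalues. Starting at \<open>{}\<close> costs at most the
  factor \<open>2 * (1 + lam) ^ m\<close>, and this is what \<open>m * ln (1 + lam)\<close> in
  \<open>t\<close> pays for.

  The error \<open>\<delta>\<close> is split into three equal shares: mixing, the bias of the
  measure defined by the oracle, and the \<open>m\<close> edge decisions, each off by at most
  \<open>\<delta> / (3 * m)\<close>. The call budget shapes the last stage: each edge needs two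
  counts but only one call of the coarser oracle is available, so the other count comes from the
  oracle of the walk. That one is at least as accurate, because
  \<open>m \<le> n\<^sup>2 / 2 \<le> t\<close> for \<open>\<delta> < 1\<close>. To reach exactly
  \<open>m\<close> coarse calls, an edge that cannot be used still triggers a call whose answer is
  discarded.\<close>

definition adjacent_edges :: "'a set set \<Rightarrow> ('a set \<times> 'a set) set" where
  "adjacent_edges F = {(e, e'). e \<in> F \<and> e' \<in> F \<and> e \<inter> e' \<noteq> {}}"

text \<open>The component is kept as a set of edges, since edges are what the swap
  exchanges.\<close>

definition component_edges :: "'a set set \<Rightarrow> 'a \<Rightarrow> 'a set set" where
  "component_edges F x = {e. \<exists>d\<in>F. x \<in> d \<and> (d, e) \<in> (adjacent_edges F)\<^sup>*}"

lemma component_edges_subset: "component_edges F x \<subseteq> F"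
proof
  fix e assume "e \<in> component_edges F x"
  then obtain d where "d \<in> F" "(d, e) \<in> (adjacent_edges F)\<^sup>*"
    by (auto simp: component_edges_def)
  from this(2,1) show "e \<in> F"
    by (induction) (auto simp: adjacent_edges_def)
qed

lemma component_edges_closed:
  assumes "e \<in> component_edges F x" "e' \<in> F" "e \<inter> e' \<noteq> {}"
  shows "e' \<in> component_edges F x"
proof -
  have "e \<in> F" by (rule subsetD[OF component_edges_subset assms(1)])
  then have "(e, e') \<in> adjacent_edges F"
    using assms by (simp add: adjacent_edges_def)
  then show ?thesis using assms(1)
    by (auto simp: component_edges_def intro: rtrancl_into_rtrancl)
qed

lemma component_edges_induct [consumes 1, case_names incident adjacent]:
  assumes "e \<in> component_edges F x"
    and "\<And>d. d \<in> F \<Longrightarrow> x \<in> d \<Longrightarrow> Q d"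
    and "\<And>d e. d \<in> component_edges F x \<Longrightarrow> Q d \<Longrightarrow> e \<in> F \<Longrightarrow> d \<inter> e \<noteq> {} \<Longrightarrow> Q e"
  shows "Q e"
proof -
  obtain d where d: "d \<in> F" "x \<in> d" "(d, e) \<in> (adjacent_edges F)\<^sup>*"
    using assms(1) by (auto simp: component_edges_def)
  from d(3) have "Q e \<and> e \<in> component_edges F x"
  proof induction
    case base
    then show ?case using d assms(2) by (auto simp: component_edges_def)
  next
    case (step y z)
    then show ?case
      using assms(3)[of y z] component_edges_closed[of y F x z] by (auto simp: adjacent_edges_def)
  qed
  then show ?thesis by simp
qed

lemma component_edges_incident:
  assumes "e \<in> F" "x \<in> e" shows "e \<in> component_edges F x"
  using assms by (auto simp: component_edges_def)

text \<open>Growing a connected graph edge by edge adds at most one vertex per edge. In place of a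
  growth process, a largest subset \<open>D\<close> of the component is taken that contains
  \<open>d\<close> and obeys the bound. An edge outside \<open>D\<close> that meets
  \<open>\<Union>D\<close> could still be added, so there is none, and connectedness forces
  \<open>D\<close> to be the whole component.\<close>

lemma card_Union_component_edges_le:
  assumes fin: "finite F" and two: "\<And>e. e \<in> F \<Longrightarrow> card e = 2"
    and d: "d \<in> F" "x \<in> d"
  shows "card (\<Union>(component_edges F x)) \<le> Suc (card (component_edges F x))"
proof -
  let ?C = "component_edges F x"
  have finC: "finite ?C" by (rule finite_subset[OF component_edges_subset]) (use fin in simp)
  define \<D> where "\<D> = {D. D \<subseteq> ?C \<and> d \<in> D \<and> card (\<Union>D) \<le> Suc (card D)}"
  have "finite \<D>" by (rule finite_subset[of _ "Pow ?C"]) (use finC in \<open>auto simp: \<D>_def\<close>)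
  moreover have "{d} \<in> \<D>"
    using component_edges_incident[OF d] two[OF d(1)] by (simp add: \<D>_def)
  ultimately have "Max (card ` \<D>) \<in> card ` \<D>" by (intro Max_in) auto
  then obtain D where D: "D \<in> \<D>" "card D = Max (card ` \<D>)" by (metis imageE)
  have mx: "card D' \<le> card D" if "D' \<in> \<D>" for D'
    unfolding D(2) by (rule Max_ge) (use that \<open>finite \<D>\<close> in auto)
  have DC: "D \<subseteq> ?C" and dD: "d \<in> D" and cD: "card (\<Union>D) \<le> Suc (card D)"
    using D(1) by (auto simp: \<D>_def)
  have finD: "finite D" by (rule finite_subset[OF DC finC])
  have twoC: "card e = 2" if "e \<in> ?C" for e
    using two[OF subsetD[OF component_edges_subset that]] .
  have no: "e \<inter> \<Union>D = {}" if e: "e \<in> ?C" "e \<notin> D" for e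
  proof (rule ccontr)
    assume ne: "e \<inter> \<Union>D \<noteq> {}"
    have fe: "finite e" using twoC[OF e(1)] by (intro card_ge_0_finite) simp
    have fU: "finite (\<Union>D)"
    proof (rule finite_Union[OF finD])
      fix a assume "a \<in> D"
      then have "card a = 2" using DC twoC by blast
      then show "finite a" by (intro card_ge_0_finite) simp
    qed
    have "card (e \<inter> \<Union>D) \<ge> 1" using ne fe by (simp add: Suc_leI card_gt_0_iff)
    moreover have "card (e \<union> \<Union>D) + card (e \<inter> \<Union>D) = card e + card (\<Union>D)"
      using card_Un_Int[OF fe fU] by simp
    ultimately have "card (\<Union>(insert e D)) \<le> Suc (card (insert e D))"
      using cD finD e twoC[OF e(1)] by simp
    then have "insert e D \<in> \<D>" using DC e dD by (auto simp: \<D>_def)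
    from mx[OF this] show False using finD e by simp
  qed
  have "e \<in> D" if "e \<in> ?C" for e
    using that
  proof (induction rule: component_edges_induct)
    case (incident a)
    then show ?case using no[OF component_edges_incident[OF incident]] d dD by blast
  next
    case (adjacent a b)
    then show ?case using no[of b] component_edges_closed[OF adjacent(1-3)] by blast
  qed
  then have "D = ?C" using DC by blast
  then show ?thesis using cD by simp
qed

section \<open>Exchanging one component between two matchings\<close>

definition toggle :: "'a \<Rightarrow> 'a set \<Rightarrow> 'a set" where
  "toggle v S = (if v \<in> S then S - {v} else insert v S)"

lemma toggle_iff: "y \<in> toggle v S \<longleftrightarrow> (y \<in> S) \<noteq> (y = v)"
  by (auto simp: toggle_def)

definition swap_at :: "'a \<Rightarrow> 'a set set \<Rightarrow> 'a set set \<Rightarrow> 'a set set" where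
  "swap_at x M M' = (M - component_edges (M \<union> M') x) \<union> (M' \<inter> component_edges (M \<union> M') x)"

lemma swap_at_Un: "swap_at x M M' \<union> swap_at x M' M = M \<union> M'"
  by (auto simp: swap_at_def Un_commute)

text \<open>The swap leaves the union of the two matchings unchanged, so the component of
  \<open>x\<close> is the same afterwards and a second swap undoes the first.\<close>

lemma swap_at_swap_at: "swap_at x (swap_at x M' M) (swap_at x M M') = M'"
  unfolding swap_at_def[of x "swap_at x M' M"] Un_commute[of "swap_at x M' M"] swap_at_Un
  by (auto simp: swap_at_def Un_commute)

text \<open>Edges are only redistributed between the two matchings. In terms of weights:
  \<open>lam ^ card M * lam ^ card M'\<close> is invariant, which makes the swap measure preserving
  on pairs.\<close>

lemma card_swap_at:
  assumes "finite M" "finite M'"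
  shows "card (swap_at x M M') + card (swap_at x M' M) = card M + card M'"
proof -
  let ?C = "component_edges (M \<union> M') x"
  have "card (swap_at x M M') = card (M - ?C) + card (M' \<inter> ?C)"
    unfolding swap_at_def using assms by (intro card_Un_disjoint) auto
  moreover have "card (swap_at x M' M) = card (M' - ?C) + card (M \<inter> ?C)"
    unfolding swap_at_def Un_commute[of M' M] using assms by (intro card_Un_disjoint) auto
  moreover have "card M = card (M \<inter> ?C) + card (M - ?C)" "card M' = card (M' \<inter> ?C) + card (M' - ?C)"
    by (rule card_Int_Diff, fact)+
  ultimately show ?thesis by simp
qed

text \<open>Two edges on the same side of the component come from the same matching, and two edges
  on opposite sides cannot meet because the component is closed under adjacency.\<close>

lemma disjoint_swap_at:
  assumes "disjoint M" "disjoint M'"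
  shows "disjoint (swap_at x M M')"
proof -
  let ?C = "component_edges (M \<union> M') x"
  show ?thesis
    unfolding disjoint_def
  proof (intro ballI impI)
    fix a b assume a: "a \<in> swap_at x M M'" and b: "b \<in> swap_at x M M'" and ne: "a \<noteq> b"
    show "a \<inter> b = {}"
    proof (cases "a \<in> ?C \<longleftrightarrow> b \<in> ?C")
      case True
      then have "(a \<in> M \<and> b \<in> M) \<or> (a \<in> M' \<and> b \<in> M')" using a b by (auto simp: swap_at_def)
      then show ?thesis using assms ne unfolding disjoint_def by blast
    next
      case False
      then show ?thesis
        using a b component_edges_closed[of a "M \<union> M'" x b] component_edges_closed[of b "M \<union> M'" x a]
        by (auto simp: swap_at_def Int_commute)
    qed
  qed
qed

lemma card_Union_matching:
  assumes "finite M" "disjoint M" "\<And>e. e \<in> M \<Longrightarrow> card e = 2"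
  shows "card (\<Union>M) = 2 * card M"
proof -
  have "card (\<Union>M) = (\<Sum>e\<in>M. card e)"
    using assms by (intro card_Union_disjoint) (auto simp: disjoint_def pairwise_def disjnt_def intro: card_ge_0_finite)
  also have "\<dots> = 2 * card M" using assms by simp
  finally show ?thesis .
qed

text \<open>
  The component of \<open>x\<close> in the union of the two matchings is connected with all degrees at most
  two, so the handshake count leaves room for exactly one further vertex covered only once.
\<close>

lemma Union_swap_at:
  assumes fin: "finite M" "finite M'" and dj: "disjoint M" "disjoint M'"
    and two: "\<And>e. e \<in> M \<union> M' \<Longrightarrow> card e = 2"
    and x: "x \<in> \<Union>M" "x \<notin> \<Union>M'"
  obtains v where "v \<noteq> x" "(v \<in> \<Union>M) \<noteq> (v \<in> \<Union>M')"
    "\<Union>(swap_at x M M') = toggle v (toggle x (\<Union>M))"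
    "\<Union>(swap_at x M' M) = toggle v (toggle x (\<Union>M'))"
proof -
  let ?C = "component_edges (M \<union> M') x"
  define a b where "a = \<Union>(M \<inter> ?C)" and "b = \<Union>(M' \<inter> ?C)"
  have finC: "finite ?C" by (rule finite_subset[OF component_edges_subset]) (use fin in simp)
  obtain d where d: "d \<in> M" "x \<in> d" using x by auto
  \<comment> \<open>An edge common to both matchings meets no other edge, so it would be a component
    of its own, and it cannot contain \<open>x\<close>, which \<open>M'\<close> leaves
    uncovered.\<close>
  have no: "e \<notin> M \<inter> M'" if "e \<in> ?C" for e
    using that
  proof (induction rule: component_edges_induct)
    case (incident a)
    then show ?case using x by auto
  next
    case (adjacent y z)
    have "y \<in> M \<union> M'" by (rule subsetD[OF component_edges_subset adjacent(1)])
    moreover have "y = z \<or> y \<inter> z = {}" if "z \<in> M \<inter> M'"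
      using that \<open>y \<in> M \<union> M'\<close> dj unfolding disjoint_def by blast
    ultimately show ?case using adjacent(3,4) by blast
  qed
  have ab: "a \<union> b = \<Union>?C"
    using component_edges_subset[of "M \<union> M'" x] by (auto simp: a_def b_def)
  have fe: "finite e" if "e \<in> M \<union> M'" for e using two[OF that] by (intro card_ge_0_finite) simp
  have fab: "finite a" "finite b" using fin fe by (auto simp: a_def b_def)
  have "card a = 2 * card (M \<inter> ?C)" "card b = 2 * card (M' \<inter> ?C)"
    unfolding a_def b_def
    by (rule card_Union_matching; use fin dj two in \<open>auto simp: disjoint_def\<close>)+
  moreover have "card (M \<inter> ?C) + card (M' \<inter> ?C) = card ?C"
  proof -
    have "card ((M \<inter> ?C) \<union> (M' \<inter> ?C)) = card (M \<inter> ?C) + card (M' \<inter> ?C)"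
      using fin no by (intro card_Un_disjoint) auto
    moreover have "(M \<inter> ?C) \<union> (M' \<inter> ?C) = ?C" using component_edges_subset[of "M \<union> M'" x] by auto
    ultimately show ?thesis by simp
  qed
  ultimately have s: "card a + card b = 2 * card ?C" by simp
  have le: "card (a \<union> b) \<le> Suc (card ?C)"
    unfolding ab using card_Union_component_edges_le[of "M \<union> M'" d x] fin two d by auto
  have c1: "card a = card (a - b) + card (a \<inter> b)" "card b = card (b - a) + card (a \<inter> b)"
    using card_Int_Diff[OF fab(1), of b] card_Int_Diff[OF fab(2), of a] by (simp_all add: Int_commute)
  have c2: "card (a \<union> b) = card (a - b) + card b"
    using card_Un_disjoint[of "a - b" b] fab by auto
  have c3: "card ((a - b) \<union> (b - a)) = card (a - b) + card (b - a)"
    using fab by (intro card_Un_disjoint) auto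
  have "d \<in> ?C" using d by (auto intro: component_edges_incident)
  then have xab: "x \<in> a - b" using d x by (auto simp: a_def b_def)
  then have "card (a - b) > 0" using fab by (auto simp: card_gt_0_iff)
  \<comment> \<open>The symmetric difference has
    \<open>2 * card (a \<union> b) - (card a + card b)\<close> elements. This is even by
    \<open>s\<close>, at most 2 by \<open>le\<close>, and positive because \<open>x\<close> is in
    it.\<close>
  have "card ((a - b) \<union> (b - a)) = 2"
    using s le c1 c2 c3 \<open>card (a - b) > 0\<close> by presburger
  then obtain y z where yz: "(a - b) \<union> (b - a) = {y, z}" "y \<noteq> z" by (auto simp: card_2_iff)
  have "x \<in> {y, z}" using xab yz(1) by blast
  then have "\<exists>v. v \<noteq> x \<and> (a - b) \<union> (b - a) = {x, v}"
    using yz by (auto simp: insert_commute)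
  then obtain v where v: "v \<noteq> x" "(a - b) \<union> (b - a) = {x, v}" by blast
  \<comment> \<open>Edges outside the component avoid its vertices, so off
    \<open>a \<union> b\<close> nothing changes.\<close>
  have out: "\<Union>(N - ?C) \<inter> (a \<union> b) = {}" if "N \<subseteq> M \<union> M'" for N
    unfolding ab using that component_edges_closed[of _ "M \<union> M'" x] by blast
  have UM: "\<Union>M = \<Union>(M - ?C) \<union> a" by (auto simp: a_def)
  have UM': "\<Union>M' = \<Union>(M' - ?C) \<union> b" by (auto simp: b_def)
  have US: "\<Union>(swap_at x M M') = \<Union>(M - ?C) \<union> b" by (auto simp: swap_at_def b_def)
  have o1: "\<Union>(M - ?C) \<inter> (a \<union> b) = {}" and o2: "\<Union>(M' - ?C) \<inter> (a \<union> b) = {}"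
    by (rule out, blast)+
  have vx: "(y \<in> a) \<noteq> (y \<in> b) \<longleftrightarrow> y = x \<or> y = v" for y using v(2) by blast
  have US': "\<Union>(swap_at x M' M) = \<Union>(M' - ?C) \<union> a"
    by (auto simp: swap_at_def a_def Un_commute)
  have tog: "r \<union> q = toggle v (toggle x (r \<union> p))"
    if "\<And>y. (y \<in> p) \<noteq> (y \<in> q) \<longleftrightarrow> y = x \<or> y = v" "v \<noteq> x" "r \<inter> (p \<union> q) = {}" for r p q
  proof (rule set_eqI)
    fix y
    have "y \<notin> r \<or> (y \<notin> p \<and> y \<notin> q)" using that(3) by blast
    then show "y \<in> r \<union> q \<longleftrightarrow> y \<in> toggle v (toggle x (r \<union> p))"
      unfolding toggle_iff Un_iff using that(1)[of y] that(2) by metis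
  qed
  show ?thesis
  proof (rule that[of v])
    show "v \<noteq> x" by (fact v)
    show "(v \<in> \<Union>M) \<noteq> (v \<in> \<Union>M')"
    proof -
      have "v \<in> a \<union> b" using vx[of v] by blast
      then have "v \<notin> \<Union>(M - ?C)" "v \<notin> \<Union>(M' - ?C)" using o1 o2 by blast+
      then show ?thesis unfolding UM UM' using vx[of v] by blast
    qed
    show "\<Union>(swap_at x M M') = toggle v (toggle x (\<Union>M))"
      unfolding US UM using vx v(1) o1 by (rule tog)
    show "\<Union>(swap_at x M' M) = toggle v (toggle x (\<Union>M'))"
      unfolding US' UM' by (rule tog) (use vx v(1) o2 in blast)+
  qed
qed

section \<open>Poincare inequality for the set of covered vertices\<close>

lemma toggle_toggle: "toggle v (toggle v S) = S"
  by (auto simp: toggle_def)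

lemma toggle_commute: "toggle u (toggle v S) = toggle v (toggle u S)"
  by (rule set_eqI) (auto simp: toggle_iff)

lemma toggle_pair_involution: "toggle v (toggle u (toggle v (toggle u S))) = S"
  by (metis toggle_commute toggle_toggle)

lemma toggle_subset: "v \<in> A \<Longrightarrow> T \<subseteq> A \<Longrightarrow> toggle v T \<subseteq> A"
  by (auto simp: toggle_def)

lemma toggle_Un: "v \<notin> B \<Longrightarrow> toggle v (B \<union> T) = B \<union> toggle v T"
  by (auto simp: toggle_def)

lemma sum_toggle:
  assumes "v \<in> A"
  shows "(\<Sum>T\<in>Pow A. g (toggle v T)) = (\<Sum>T\<in>Pow A. g T)"
  by (rule sum.reindex_bij_witness[of _ "toggle v" "toggle v"])
    (use assms in \<open>auto simp: toggle_toggle dest: toggle_subset\<close>)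

section \<open>Matchings grouped by the set of vertices that they cover\<close>

definition cover_matchings :: "'a set set \<Rightarrow> 'a set \<Rightarrow> 'a set set set" where
  "cover_matchings E S = {M. M \<subseteq> E \<and> disjoint M \<and> \<Union>M = S}"

text \<open>Unnormalised probability that a Gibbs matching covers exactly \<open>S\<close>. The sum
  runs over the perfect matchings of the graph induced on \<open>S\<close>.\<close>

definition cover_weight :: "real \<Rightarrow> 'a set set \<Rightarrow> 'a set \<Rightarrow> real" where
  "cover_weight lam E S = (\<Sum>M\<in>cover_matchings E S. lam ^ card M)"

lemma finite_cover_matchings: "finite E \<Longrightarrow> finite (cover_matchings E S)"
  by (rule finite_subset[of _ "Pow E"]) (auto simp: cover_matchings_def)

lemma cover_weight_nonneg: "lam \<ge> 0 \<Longrightarrow> cover_weight lam E S \<ge> 0"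
  unfolding cover_weight_def by (intro sum_nonneg) simp

text \<open>A boundary condition: vertices of \<open>B\<close> are forced to be covered, those of
  \<open>A\<close> are free, and all others are forced to be uncovered.\<close>

definition pinned_matchings :: "'a set set \<Rightarrow> 'a set \<Rightarrow> 'a set \<Rightarrow> 'a set set set" where
  "pinned_matchings E A B = {M. M \<subseteq> E \<and> disjoint M \<and> B \<subseteq> \<Union>M \<and> \<Union>M \<subseteq> B \<union> A}"

lemma finite_pinned_matchings: "finite E \<Longrightarrow> finite (pinned_matchings E A B)"
  by (rule finite_subset[of _ "Pow E"]) (auto simp: pinned_matchings_def)

text \<open>The swap acts on matchings while the dynamics acts on covered sets; this is the
  translation between the two.\<close>

lemma sum_cover_weight:
  assumes fin: "finite E" "finite A" and AB: "A \<inter> B = {}"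
  shows "(\<Sum>T\<in>Pow A. cover_weight lam E (B \<union> T) * g (B \<union> T)) =
    (\<Sum>M\<in>pinned_matchings E A B. lam ^ card M * g (\<Union>M))"
proof -
  have "(\<Sum>M\<in>pinned_matchings E A B. lam ^ card M * g (\<Union>M)) =
      (\<Sum>T\<in>Pow A. \<Sum>M\<in>{M \<in> pinned_matchings E A B. \<Union>M - B = T}. lam ^ card M * g (\<Union>M))"
    by (rule sum.group[symmetric])
      (use fin finite_pinned_matchings[of E A B] in \<open>auto simp: pinned_matchings_def\<close>)
  also have "\<dots> = (\<Sum>T\<in>Pow A. cover_weight lam E (B \<union> T) * g (B \<union> T))"
  proof (rule sum.cong[OF refl])
    fix T assume T: "T \<in> Pow A"
    have "B \<subseteq> U \<and> U \<subseteq> B \<union> A \<and> U - B = T \<longleftrightarrow> U = B \<union> T" for U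
      using T AB by blast
    then have "{M \<in> pinned_matchings E A B. \<Union>M - B = T} = cover_matchings E (B \<union> T)"
      unfolding pinned_matchings_def cover_matchings_def mem_Collect_eq conj_assoc by metis
    then show "(\<Sum>M\<in>{M \<in> pinned_matchings E A B. \<Union>M - B = T}. lam ^ card M * g (\<Union>M)) =
        cover_weight lam E (B \<union> T) * g (B \<union> T)"
      by (simp only: cover_weight_def sum_distrib_right) (rule sum.cong, auto simp: cover_matchings_def)
  qed
  finally show ?thesis ..
qed

lemma weighted_cauchy_schwarz:
  fixes wt d :: "'b \<Rightarrow> real"
  assumes "\<And>p. p \<in> P \<Longrightarrow> wt p \<ge> 0"
  shows "(\<Sum>p\<in>P. wt p * d p)\<^sup>2 \<le> (\<Sum>p\<in>P. wt p) * (\<Sum>p\<in>P. wt p * (d p)\<^sup>2)"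
proof -
  have "(\<Sum>p\<in>P. sqrt (wt p) * (sqrt (wt p) * d p))\<^sup>2 \<le>
      (\<Sum>p\<in>P. (sqrt (wt p))\<^sup>2) * (\<Sum>p\<in>P. (sqrt (wt p) * d p)\<^sup>2)"
    by (rule Cauchy_Schwarz_ineq_sum)
  moreover have "(\<Sum>p\<in>P. sqrt (wt p) * (sqrt (wt p) * d p)) = (\<Sum>p\<in>P. wt p * d p)"
    by (rule sum.cong) (use assms in \<open>auto simp: mult.assoc[symmetric]\<close>)
  moreover have "(\<Sum>p\<in>P. (sqrt (wt p))\<^sup>2) = (\<Sum>p\<in>P. wt p)"
    by (rule sum.cong) (use assms in auto)
  moreover have "(\<Sum>p\<in>P. (sqrt (wt p) * d p)\<^sup>2) = (\<Sum>p\<in>P. wt p * (d p)\<^sup>2)"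
    by (rule sum.cong) (use assms in \<open>auto simp: power_mult_distrib\<close>)
  ultimately show ?thesis by simp
qed

text \<open>The second vertex \<open>v\<close> of the exchange is covered by exactly one of
  \<open>M\<close> and \<open>M'\<close>. Apart from \<open>x\<close>, the two boundary conditions
  disagree nowhere outside \<open>A\<close>, so \<open>v\<close> is a free vertex and both
  conditions survive the swap.\<close>

lemma swap_at_pinned:
  assumes fin: "finite E" and two: "\<And>e. e \<in> E \<Longrightarrow> card e = 2"
    and x: "x \<notin> A" "x \<notin> B" and AB: "A \<inter> B = {}"
    and M: "M \<in> pinned_matchings E A (insert x B)" and M': "M' \<in> pinned_matchings E A B"
  shows "swap_at x M M' \<in> pinned_matchings E A B"
    and "swap_at x M' M \<in> pinned_matchings E A (insert x B)"
    and "\<exists>v\<in>A. \<Union>(swap_at x M M') = toggle v (\<Union>M - {x})"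
proof -
  have fM: "finite M" "finite M'" "M \<subseteq> E" "M' \<subseteq> E" "disjoint M" "disjoint M'"
    using M M' fin by (auto simp: pinned_matchings_def intro: finite_subset)
  have xM: "x \<in> \<Union>M" "x \<notin> \<Union>M'" using M M' x by (auto simp: pinned_matchings_def)
  obtain v where v: "v \<noteq> x" "(v \<in> \<Union>M) \<noteq> (v \<in> \<Union>M')"
    "\<Union>(swap_at x M M') = toggle v (toggle x (\<Union>M))"
    "\<Union>(swap_at x M' M) = toggle v (toggle x (\<Union>M'))"
    by (rule Union_swap_at[of M M' x]) (use fM two xM in \<open>auto\<close>)
  have B: "B \<subseteq> \<Union>M" "B \<subseteq> \<Union>M'" "\<Union>M \<subseteq> insert x B \<union> A" "\<Union>M' \<subseteq> B \<union> A"
    using M M' by (auto simp: pinned_matchings_def)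
  have vA: "v \<in> A" and vB: "v \<notin> B"
    using v(1,2) B by blast+
  have sub: "swap_at x M M' \<subseteq> E" "swap_at x M' M \<subseteq> E"
    using fM by (auto simp: swap_at_def)
  have dj: "disjoint (swap_at x M M')" "disjoint (swap_at x M' M)"
    by (rule disjoint_swap_at; fact)+
  have t: "toggle x (\<Union>M) = \<Union>M - {x}" "toggle x (\<Union>M') = insert x (\<Union>M')"
    using xM by (simp_all add: toggle_def)
  have "B \<subseteq> toggle v (\<Union>M - {x})" "toggle v (\<Union>M - {x}) \<subseteq> B \<union> A"
    "insert x B \<subseteq> toggle v (insert x (\<Union>M'))" "toggle v (insert x (\<Union>M')) \<subseteq> insert x B \<union> A"
    using v(1) vA vB B x unfolding toggle_def by auto
  then show "swap_at x M M' \<in> pinned_matchings E A B"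
    and "swap_at x M' M \<in> pinned_matchings E A (insert x B)"
    unfolding pinned_matchings_def mem_Collect_eq v(3,4) t using sub dj by blast+
  show "\<exists>v\<in>A. \<Union>(swap_at x M M') = toggle v (\<Union>M - {x})" using vA v(3) t by auto
qed

text \<open>Take a pair of matchings with product weight, the first covering \<open>x\<close> and
  the second not, and swap. The first matching and the one derived from it form a coupling of the
  two conditional measures, of total mass \<open>Z0 * Z1\<close>, in which the covered sets differ
  by toggling \<open>x\<close> and one \<open>v\<close> in \<open>A\<close>. The two upper bounds on
  \<open>\<kappa>\<close> say that it stays below each marginal; the last claim is the
  Cauchy-Schwarz inequality for the difference of the conditional means.\<close>

lemma exchange_coupling:
  fixes f :: "'a set \<Rightarrow> real"
  assumes fin: "finite E" "finite A" and two: "\<And>e. e \<in> E \<Longrightarrow> card e = 2" and lam: "lam \<ge> 0"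
    and x: "x \<notin> A" "x \<notin> B" and AB: "A \<inter> B = {}"
  defines "w \<equiv> cover_weight lam E"
  defines "Z0 \<equiv> \<Sum>T\<in>Pow A. w (B \<union> T)" and "Z1 \<equiv> \<Sum>T\<in>Pow A. w (insert x B \<union> T)"
  defines "s0 \<equiv> \<Sum>T\<in>Pow A. w (B \<union> T) * f (B \<union> T)"
    and "s1 \<equiv> \<Sum>T\<in>Pow A. w (insert x B \<union> T) * f (insert x B \<union> T)"
  obtains \<kappa> where
    "\<And>T v. T \<subseteq> A \<Longrightarrow> v \<in> A \<Longrightarrow> 0 \<le> \<kappa> T v"
    "\<And>T v. T \<subseteq> A \<Longrightarrow> v \<in> A \<Longrightarrow> \<kappa> T v \<le> w (insert x B \<union> T) * Z0"
    "\<And>T v. T \<subseteq> A \<Longrightarrow> v \<in> A \<Longrightarrow> \<kappa> T v \<le> w (B \<union> toggle v T) * Z1"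
    "(Z0 * s1 - Z1 * s0)\<^sup>2 \<le>
      Z0 * Z1 * (\<Sum>T\<in>Pow A. \<Sum>v\<in>A. \<kappa> T v * (f (insert x B \<union> T) - f (B \<union> toggle v T))\<^sup>2)"
proof -
  let ?d = "\<lambda>T v. f (insert x B \<union> T) - f (B \<union> toggle v T)"
  let ?M0 = "pinned_matchings E A B" and ?M1 = "pinned_matchings E A (insert x B)"
  define P where "P = ?M1 \<times> ?M0"
  define wt where "wt = (\<lambda>p::'a set set \<times> 'a set set. lam ^ card (fst p) * lam ^ card (snd p))"
  define N where "N = (\<lambda>p::'a set set \<times> 'a set set. swap_at x (fst p) (snd p))"
  \<comment> \<open>The components are listed in reverse order, so that the first one covers
    \<open>x\<close> again and \<open>swp\<close> is an involution of \<open>P\<close>.\<close>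
  define swp where "swp = (\<lambda>p::'a set set \<times> 'a set set. (swap_at x (snd p) (fst p), swap_at x (fst p) (snd p)))"
  have AB1: "A \<inter> insert x B = {}" using x AB by auto
  have finP: "finite P" using fin by (simp add: P_def finite_pinned_matchings)
  have wt0: "wt p \<ge> 0" for p using lam by (simp add: wt_def)
  have swpP: "swp p \<in> P" if "p \<in> P" for p
    using that swap_at_pinned(1,2)[OF fin(1) two x AB] by (auto simp: P_def swp_def)
  have swpswp: "swp (swp p) = p" for p by (cases p) (simp add: swp_def swap_at_swap_at)
  have finm: "finite (fst p)" "finite (snd p)" if "p \<in> P" for p
    by (rule finite_subset[OF _ fin(1)], use that in \<open>auto simp: P_def pinned_matchings_def\<close>)+
  have wtswp: "wt (swp p) = wt p" if "p \<in> P" for p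
    using card_swap_at[OF finm[OF that], of x]
    by (simp add: wt_def swp_def power_add[symmetric] add.commute)
  \<comment> \<open>\<open>N p\<close> is the second component of \<open>swp p\<close> and
    \<open>swp\<close> preserves weight, so \<open>N p\<close> has the same law as an independent
    matching that leaves \<open>x\<close> uncovered.\<close>
  have reindex: "(\<Sum>p\<in>P. wt p * g (\<Union>(snd p))) = (\<Sum>p\<in>P. wt p * g (\<Union>(N p)))" for g :: "'a set \<Rightarrow> real"
    by (rule sum.reindex_bij_witness[of _ swp swp])
      (use swpP swpswp wtswp in \<open>auto simp: N_def swp_def swap_at_swap_at\<close>)
  have prod: "(\<Sum>p\<in>P. wt p * (g (\<Union>(fst p)) * h (\<Union>(snd p)))) =
      (\<Sum>T\<in>Pow A. w (insert x B \<union> T) * g (insert x B \<union> T)) * (\<Sum>T\<in>Pow A. w (B \<union> T) * h (B \<union> T))"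
    for g h :: "'a set \<Rightarrow> real"
    unfolding w_def sum_cover_weight[OF fin AB] sum_cover_weight[OF fin AB1]
    unfolding P_def wt_def sum_product sum.cartesian_product
    by (rule sum.cong) (auto simp: mult_ac)
  have "\<forall>p\<in>P. \<exists>v. v \<in> A \<and> \<Union>(N p) = toggle v (\<Union>(fst p) - {x})"
    using swap_at_pinned(3)[OF fin(1) two x AB] by (fastforce simp: P_def N_def)
  then obtain vv where vv: "\<And>p. p \<in> P \<Longrightarrow> vv p \<in> A \<and> \<Union>(N p) = toggle (vv p) (\<Union>(fst p) - {x})"
    by metis
  define Q where "Q = (\<lambda>(T, v). {p \<in> P. (\<Union>(fst p) - insert x B, vv p) = (T, v)})"
  \<comment> \<open>The coupling mass carried by the move from \<open>insert x B \<union> T\<close>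
    to \<open>B \<union> toggle v T\<close>.\<close>
  define \<kappa> where "\<kappa> = (\<lambda>T v. \<Sum>p\<in>Q (T, v). wt p)"
  have QT: "\<Union>(fst p) = insert x B \<union> T \<and> \<Union>(N p) = B \<union> toggle v T"
    if p: "p \<in> Q (T, v)" and T: "T \<subseteq> A" for p T v
  proof -
    have pP: "p \<in> P" and T2: "\<Union>(fst p) - insert x B = T" and v: "vv p = v"
      using p by (auto simp: Q_def)
    have 1: "\<Union>(fst p) = insert x B \<union> T"
    proof -
      have "insert x B \<subseteq> \<Union>(fst p)" using pP by (auto simp only: P_def pinned_matchings_def mem_Times_iff mem_Collect_eq)
      then show ?thesis using T2 by blast
    qed
    moreover have "insert x B \<union> T - {x} = B \<union> T" using x T by auto
    moreover have "v \<notin> B" using vv[OF pP] v AB by auto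
    ultimately show ?thesis using vv[OF pP] v by (simp add: toggle_Un)
  qed
  have Z0: "(\<Sum>T\<in>Pow A. w (B \<union> T) * 1) = Z0" and Z1: "(\<Sum>T\<in>Pow A. w (insert x B \<union> T) * 1) = Z1"
    by (simp_all add: Z0_def Z1_def)
  have single: "(\<Sum>T\<in>Pow A. w (D \<union> T) * of_bool (D \<union> T = D \<union> T0)) = w (D \<union> T0)"
    if "T0 \<subseteq> A" "A \<inter> D = {}" for D T0
  proof -
    have "D \<union> T = D \<union> T0 \<longleftrightarrow> T = T0" if "T \<subseteq> A" for T
      using that \<open>T0 \<subseteq> A\<close> \<open>A \<inter> D = {}\<close> by blast
    then have "(\<Sum>T\<in>Pow A. w (D \<union> T) * of_bool (D \<union> T = D \<union> T0)) =
        (\<Sum>T\<in>Pow A. if T = T0 then w (D \<union> T) else 0)"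
      by (intro sum.cong) auto
    also have "\<dots> = w (D \<union> T0)" using that fin by (simp add: sum.delta)
    finally show ?thesis .
  qed
  show ?thesis
  proof (rule that[of \<kappa>])
    fix T v assume T: "T \<subseteq> A" and v: "v \<in> A"
    show "0 \<le> \<kappa> T v" unfolding \<kappa>_def by (intro sum_nonneg) (simp add: wt0)
    have QP: "Q (T, v) \<subseteq> P" by (auto simp: Q_def)
    have "\<kappa> T v = (\<Sum>p\<in>Q (T, v). wt p * (of_bool (\<Union>(fst p) = insert x B \<union> T) * 1))"
      unfolding \<kappa>_def by (rule sum.cong) (use QT[OF _ T] in auto)
    also have "\<dots> \<le> (\<Sum>p\<in>P. wt p * (of_bool (\<Union>(fst p) = insert x B \<union> T) * 1))"
      by (rule sum_mono2[OF finP QP]) (simp add: wt0)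
    also have "\<dots> = w (insert x B \<union> T) * Z0"
      using prod[of "\<lambda>S. of_bool (S = insert x B \<union> T)" "\<lambda>_. 1"] single[OF T AB1] Z0 by simp
    finally show "\<kappa> T v \<le> w (insert x B \<union> T) * Z0" .
    have "\<kappa> T v = (\<Sum>p\<in>Q (T, v). wt p * of_bool (\<Union>(N p) = B \<union> toggle v T))"
      unfolding \<kappa>_def by (rule sum.cong) (use QT[OF _ T] in auto)
    also have "\<dots> \<le> (\<Sum>p\<in>P. wt p * of_bool (\<Union>(N p) = B \<union> toggle v T))"
      by (rule sum_mono2[OF finP QP]) (simp add: wt0)
    also have "\<dots> = (\<Sum>p\<in>P. wt p * (1 * of_bool (\<Union>(snd p) = B \<union> toggle v T)))"
      using reindex[of "\<lambda>S. of_bool (S = B \<union> toggle v T)"] by simp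
    also have "\<dots> = w (B \<union> toggle v T) * Z1"
      using prod[of "\<lambda>_. 1" "\<lambda>S. of_bool (S = B \<union> toggle v T)"] single[OF toggle_subset[OF v T] AB] Z1
      by simp
    finally show "\<kappa> T v \<le> w (B \<union> toggle v T) * Z1" .
  next
    have "Z0 * s1 = (\<Sum>p\<in>P. wt p * f (\<Union>(fst p)))"
      using prod[of f "\<lambda>_. 1"] Z0 by (simp add: s1_def mult.commute)
    moreover have "Z1 * s0 = (\<Sum>p\<in>P. wt p * f (\<Union>(N p)))"
      using prod[of "\<lambda>_. 1" f] Z1 reindex[of f] by (simp add: s0_def)
    ultimately have "Z0 * s1 - Z1 * s0 = (\<Sum>p\<in>P. wt p * (f (\<Union>(fst p)) - f (\<Union>(N p))))"
      by (simp add: sum_subtractf right_diff_distrib)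
    then have "(Z0 * s1 - Z1 * s0)\<^sup>2 \<le> (\<Sum>p\<in>P. wt p) * (\<Sum>p\<in>P. wt p * (f (\<Union>(fst p)) - f (\<Union>(N p)))\<^sup>2)"
      using weighted_cauchy_schwarz[of P wt "\<lambda>p. f (\<Union>(fst p)) - f (\<Union>(N p))"] wt0 by simp
    also have "(\<Sum>p\<in>P. wt p) = Z0 * Z1"
      using prod[of "\<lambda>_. 1" "\<lambda>_. 1"] Z0 Z1 by (simp add: mult.commute)
    also have "(\<Sum>p\<in>P. wt p * (f (\<Union>(fst p)) - f (\<Union>(N p)))\<^sup>2) =
        (\<Sum>q\<in>Pow A \<times> A. \<Sum>p\<in>{p \<in> P. (\<Union>(fst p) - insert x B, vv p) = q}. wt p * (f (\<Union>(fst p)) - f (\<Union>(N p)))\<^sup>2)"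
    proof (rule sum.group[symmetric, OF finP])
      show "finite (Pow A \<times> A)" using fin by simp
      have "\<Union>(fst p) - insert x B \<subseteq> A" if "p \<in> P" for p
      proof -
        have "\<Union>(fst p) \<subseteq> insert x B \<union> A" using that
          by (simp only: P_def pinned_matchings_def mem_Times_iff mem_Collect_eq)
        then show ?thesis by blast
      qed
      then show "(\<lambda>p. (\<Union>(fst p) - insert x B, vv p)) ` P \<subseteq> Pow A \<times> A" using vv by blast
    qed
    also have "\<dots> = (\<Sum>(T, v)\<in>Pow A \<times> A. \<kappa> T v * (?d T v)\<^sup>2)"
    proof (rule sum.cong[OF refl], clarify)
      fix T v assume T: "T \<subseteq> A" and v: "v \<in> A"
      have "(\<Sum>p\<in>Q (T, v). wt p * (f (\<Union>(fst p)) - f (\<Union>(N p)))\<^sup>2) =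
          (\<Sum>p\<in>Q (T, v). wt p * (?d T v)\<^sup>2)"
        by (rule sum.cong[OF refl]) (use QT[OF _ T] in simp)
      then show "(\<Sum>p\<in>{p \<in> P. (\<Union>(fst p) - insert x B, vv p) = (T, v)}. wt p * (f (\<Union>(fst p)) - f (\<Union>(N p)))\<^sup>2) =
          \<kappa> T v * (?d T v)\<^sup>2"
        by (simp add: Q_def \<kappa>_def sum_distrib_right)
    qed
    finally show "(Z0 * s1 - Z1 * s0)\<^sup>2 \<le>
        Z0 * Z1 * (\<Sum>T\<in>Pow A. \<Sum>v\<in>A. \<kappa> T v * (?d T v)\<^sup>2)"
      by (simp add: sum.cartesian_product)
  qed
qed

section \<open>Variance and Dirichlet form under a boundary condition\<close>

definition pinned_variance :: "('a set \<Rightarrow> real) \<Rightarrow> 'a set \<Rightarrow> 'a set \<Rightarrow> ('a set \<Rightarrow> real) \<Rightarrow> real" where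
  "pinned_variance w A B f = (\<Sum>T\<in>Pow A. w (B \<union> T) * (f (B \<union> T))\<^sup>2) -
     (\<Sum>T\<in>Pow A. w (B \<union> T) * f (B \<union> T))\<^sup>2 / (\<Sum>T\<in>Pow A. w (B \<union> T))"

text \<open>With \<open>S'\<close> the toggled set, \<open>w S * w S' / (w S + w S')\<close> is the
  heat-bath flow between the two: the weight of \<open>S\<close> times the probability of moving to
  \<open>S'\<close>.\<close>

definition pair_energy :: "('a set \<Rightarrow> real) \<Rightarrow> ('a set \<Rightarrow> real) \<Rightarrow> 'a set \<Rightarrow> 'a \<Rightarrow> 'a \<Rightarrow> real" where
  "pair_energy w f S u v = w S * w (toggle v (toggle u S)) / (w S + w (toggle v (toggle u S))) *
     (f S - f (toggle v (toggle u S)))\<^sup>2"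

text \<open>Every move occurs four times in the sum: from either of its two end states, and with
  \<open>u, v\<close> in either order. Hence the division by 4.\<close>

definition dirichlet_form :: "('a set \<Rightarrow> real) \<Rightarrow> 'a set \<Rightarrow> 'a set \<Rightarrow> ('a set \<Rightarrow> real) \<Rightarrow> real" where
  "dirichlet_form w A B f = (\<Sum>T\<in>Pow A. \<Sum>u\<in>A. \<Sum>v\<in>A. pair_energy w f (B \<union> T) u v) / 4"

lemma pair_energy_self: "pair_energy w f S u u = 0"
  by (simp add: pair_energy_def toggle_toggle)

lemma pair_energy_commute: "pair_energy w f S u v = pair_energy w f S v u"
  by (simp only: pair_energy_def toggle_commute[of v u])

lemma pair_energy_toggle: "pair_energy w f (toggle v (toggle u S)) u v = pair_energy w f S u v"
  unfolding pair_energy_def toggle_pair_involution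
  by (simp add: power2_commute add.commute mult.commute)

lemma sum_Pow_insert:
  assumes "finite A" "x \<notin> A"
  shows "(\<Sum>T\<in>Pow (insert x A). g (B \<union> T)) = (\<Sum>T\<in>Pow A. g (B \<union> T)) + (\<Sum>T\<in>Pow A. g (insert x B \<union> T))"
proof -
  have "(\<Sum>T\<in>Pow (insert x A). g (B \<union> T)) = (\<Sum>T\<in>Pow A. g (B \<union> T)) + (\<Sum>T\<in>insert x ` Pow A. g (B \<union> T))"
    unfolding Pow_insert using assms by (intro sum.union_disjoint) auto
  also have "(\<Sum>T\<in>insert x ` Pow A. g (B \<union> T)) = (\<Sum>T\<in>Pow A. g (B \<union> insert x T))"
    using assms by (subst sum.reindex) (auto simp: inj_on_def o_def)
  also have "\<dots> = (\<Sum>T\<in>Pow A. g (insert x B \<union> T))" by simp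
  finally show ?thesis .
qed

text \<open>Moves that avoid \<open>x\<close> belong to one of the two conditional forms. A move
  toggling \<open>x\<close> and some \<open>v\<close> is counted four times, which cancels the
  division by 4 and leaves one copy, written from the end state that contains
  \<open>x\<close>.\<close>

lemma dirichlet_form_insert:
  assumes fin: "finite A" and x: "x \<notin> A" "x \<notin> B" and AB: "A \<inter> B = {}"
  shows "dirichlet_form w (insert x A) B f =
    dirichlet_form w A B f + dirichlet_form w A (insert x B) f +
    (\<Sum>T\<in>Pow A. \<Sum>v\<in>A. pair_energy w f (insert x B \<union> T) x v)"
proof -
  let ?g = "pair_energy w f"
  have inner: "(\<Sum>u\<in>insert x A. \<Sum>v\<in>insert x A. ?g S u v) =
      (\<Sum>u\<in>A. \<Sum>v\<in>A. ?g S u v) + 2 * (\<Sum>v\<in>A. ?g S x v)" for S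
  proof -
    have "(\<Sum>u\<in>insert x A. \<Sum>v\<in>insert x A. ?g S u v) =
        (\<Sum>v\<in>A. ?g S x v) + ((\<Sum>u\<in>A. ?g S u x) + (\<Sum>u\<in>A. \<Sum>v\<in>A. ?g S u v))"
      using fin x by (simp add: pair_energy_self sum.distrib)
    also have "(\<Sum>u\<in>A. ?g S u x) = (\<Sum>v\<in>A. ?g S x v)"
      by (rule sum.cong) (auto simp: pair_energy_commute)
    finally show ?thesis by simp
  qed
  \<comment> \<open>A move toggling \<open>x\<close> and \<open>v\<close> has the same energy from
    both end states; \<open>toggle v\<close> matches up the free parts.\<close>
  have sw: "(\<Sum>T\<in>Pow A. \<Sum>v\<in>A. ?g (B \<union> T) x v) = (\<Sum>T\<in>Pow A. \<Sum>v\<in>A. ?g (insert x B \<union> T) x v)"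
  proof -
    have "(\<Sum>T\<in>Pow A. \<Sum>v\<in>A. ?g (insert x B \<union> T) x v) = (\<Sum>v\<in>A. \<Sum>T\<in>Pow A. ?g (insert x B \<union> T) x v)"
      by (rule sum.swap)
    also have "\<dots> = (\<Sum>v\<in>A. \<Sum>T\<in>Pow A. ?g (insert x B \<union> toggle v T) x v)"
      by (rule sum.cong[OF refl], rule sum_toggle[symmetric])
    also have "\<dots> = (\<Sum>v\<in>A. \<Sum>T\<in>Pow A. ?g (B \<union> T) x v)"
    proof (intro sum.cong refl)
      fix v T assume v: "v \<in> A" and T: "T \<in> Pow A"
      have "toggle x (B \<union> T) = insert x B \<union> T" using x T by (auto simp: toggle_def)
      moreover have "v \<notin> insert x B" using v AB x by auto
      ultimately have "insert x B \<union> toggle v T = toggle v (toggle x (B \<union> T))"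
        using toggle_Un[of v "insert x B" T] by simp
      then show "?g (insert x B \<union> toggle v T) x v = ?g (B \<union> T) x v"
        by (simp only: pair_energy_toggle)
    qed
    also have "\<dots> = (\<Sum>T\<in>Pow A. \<Sum>v\<in>A. ?g (B \<union> T) x v)" by (rule sum.swap)
    finally show ?thesis ..
  qed
  define a b where "a = (\<lambda>S. \<Sum>u\<in>A. \<Sum>v\<in>A. ?g S u v)" and "b = (\<lambda>S. \<Sum>v\<in>A. ?g S x v)"
  have "(\<Sum>T\<in>Pow (insert x A). a (B \<union> T) + 2 * b (B \<union> T)) =
      (\<Sum>T\<in>Pow A. a (B \<union> T)) + 2 * (\<Sum>T\<in>Pow A. b (B \<union> T)) +
      ((\<Sum>T\<in>Pow A. a (insert x B \<union> T)) + 2 * (\<Sum>T\<in>Pow A. b (insert x B \<union> T)))"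
    by (subst sum_Pow_insert[OF fin x(1), of "\<lambda>S. a S + 2 * b S"]) (simp only: sum.distrib sum_distrib_left)
  moreover have "(\<Sum>T\<in>Pow A. b (B \<union> T)) = (\<Sum>T\<in>Pow A. b (insert x B \<union> T))"
    using sw by (simp only: b_def)
  ultimately show ?thesis
    unfolding dirichlet_form_def inner unfolding a_def b_def by linarith
qed

text \<open>Multiply the first bound on \<open>k\<close> by \<open>b\<close>, the second by
  \<open>a\<close>, and add. This turns the two marginal bounds of a coupling into a bound by the
  heat-bath flow.\<close>

lemma le_parallel_sum:
  fixes a b z0 z1 k :: real
  assumes "a \<ge> 0" "b \<ge> 0" "z0 > 0" "z1 > 0" "k \<ge> 0" "k \<le> a * z0" "k \<le> b * z1"
  shows "k / (z0 + z1) \<le> a * b / (a + b)"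
proof (cases "a + b = 0")
  case True
  then have "a = 0" "b = 0" using assms by linarith+
  then show ?thesis using assms by simp
next
  case False
  then have ab: "a + b > 0" using assms by linarith
  have "k * b \<le> (a * z0) * b" "k * a \<le> (b * z1) * a" by (rule mult_right_mono, fact, fact)+
  then have "k * (a + b) \<le> a * b * (z0 + z1)" by (simp add: algebra_simps)
  then show ?thesis using ab assms by (simp add: divide_le_eq le_divide_eq)
qed

text \<open>
  Splitting at one vertex \<open>x\<close>, the variance of the conditional means is paid for by the moves that
  toggle \<open>x\<close>, which are exactly those absent from the two conditional Dirichlet forms. Hence the
  constant 1 is preserved by the induction.
\<close>

theorem poincare_cover_weight:
  fixes f :: "'a set \<Rightarrow> real"
  assumes "finite A" and fin: "finite E" and two: "\<And>e. e \<in> E \<Longrightarrow> card e = 2" and lam: "lam \<ge> 0"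
    and "A \<inter> B = {}"
  shows "pinned_variance (cover_weight lam E) A B f \<le> dirichlet_form (cover_weight lam E) A B f"
  using assms(1,5)
proof (induction A arbitrary: B rule: finite_induct)
  case empty
  then show ?case by (simp add: pinned_variance_def dirichlet_form_def power2_eq_square)
next
  case (insert x A)
  let ?w = "cover_weight lam E" and ?d = "\<lambda>T v. f (insert x B \<union> T) - f (B \<union> toggle v T)"
  have x: "x \<notin> A" "x \<notin> B" and AB: "A \<inter> B = {}" and AB1: "A \<inter> insert x B = {}"
    using insert by auto
  have IH0: "pinned_variance ?w A B f \<le> dirichlet_form ?w A B f"
    and IH1: "pinned_variance ?w A (insert x B) f \<le> dirichlet_form ?w A (insert x B) f"
    using insert.IH[OF AB] insert.IH[OF AB1] by auto
  define Z0 Z1 s0 s1 q0 q1 where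
    "Z0 = (\<Sum>T\<in>Pow A. ?w (B \<union> T))" and "Z1 = (\<Sum>T\<in>Pow A. ?w (insert x B \<union> T))"
    and "s0 = (\<Sum>T\<in>Pow A. ?w (B \<union> T) * f (B \<union> T))"
    and "s1 = (\<Sum>T\<in>Pow A. ?w (insert x B \<union> T) * f (insert x B \<union> T))"
    and "q0 = (\<Sum>T\<in>Pow A. ?w (B \<union> T) * (f (B \<union> T))\<^sup>2)"
    and "q1 = (\<Sum>T\<in>Pow A. ?w (insert x B \<union> T) * (f (insert x B \<union> T))\<^sup>2)"
  note defs = this
  have w0: "?w S \<ge> 0" for S by (rule cover_weight_nonneg[OF lam])
  define D where "D = (\<Sum>T\<in>Pow A. \<Sum>v\<in>A. pair_energy ?w f (insert x B \<union> T) x v)"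
  have v: "pinned_variance ?w (insert x A) B f = q0 + q1 - (s0 + s1)\<^sup>2 / (Z0 + Z1)"
    "pinned_variance ?w A B f = q0 - s0\<^sup>2 / Z0"
    "pinned_variance ?w A (insert x B) f = q1 - s1\<^sup>2 / Z1"
    unfolding pinned_variance_def defs
      sum_Pow_insert[OF insert(1) x(1), of "\<lambda>S. ?w S * (f S)\<^sup>2" B]
      sum_Pow_insert[OF insert(1) x(1), of "\<lambda>S. ?w S * f S" B]
      sum_Pow_insert[OF insert(1) x(1), of ?w B] by simp_all
  have "Z0 \<ge> 0" "Z1 \<ge> 0" unfolding defs by (auto intro!: sum_nonneg w0)
  have D0: "D \<ge> 0" unfolding D_def pair_energy_def
    by (intro sum_nonneg mult_nonneg_nonneg divide_nonneg_nonneg add_nonneg_nonneg w0) auto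
  have "q0 + q1 - (s0 + s1)\<^sup>2 / (Z0 + Z1) \<le> (q0 - s0\<^sup>2 / Z0) + (q1 - s1\<^sup>2 / Z1) + D"
  proof (cases "Z0 = 0 \<or> Z1 = 0")
    case True
    \<comment> \<open>A conditional measure of mass zero has zero moments, and
      \<open>x / 0 = 0\<close> makes its terms disappear on both sides.\<close>
    have "s0 = 0" if "Z0 = 0"
      using that unfolding defs by (intro sum.neutral) (auto simp: sum_nonneg_eq_0_iff insert w0)
    moreover have "s1 = 0" if "Z1 = 0"
      using that unfolding defs by (intro sum.neutral) (auto simp: sum_nonneg_eq_0_iff insert w0)
    ultimately show ?thesis using True D0 by auto
  next
    case False
    then have Z: "Z0 > 0" "Z1 > 0" using \<open>Z0 \<ge> 0\<close> \<open>Z1 \<ge> 0\<close> by auto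
    obtain \<kappa> where \<kappa>:
      "\<And>T v. T \<subseteq> A \<Longrightarrow> v \<in> A \<Longrightarrow> 0 \<le> \<kappa> T v"
      "\<And>T v. T \<subseteq> A \<Longrightarrow> v \<in> A \<Longrightarrow> \<kappa> T v \<le> ?w (insert x B \<union> T) * Z0"
      "\<And>T v. T \<subseteq> A \<Longrightarrow> v \<in> A \<Longrightarrow> \<kappa> T v \<le> ?w (B \<union> toggle v T) * Z1"
      "(Z0 * s1 - Z1 * s0)\<^sup>2 \<le>
        Z0 * Z1 * (\<Sum>T\<in>Pow A. \<Sum>v\<in>A. \<kappa> T v * (?d T v)\<^sup>2)"
      using exchange_coupling[OF fin insert(1) two lam x AB, of f] unfolding defs by blast
    let ?K = "\<Sum>T\<in>Pow A. \<Sum>v\<in>A. \<kappa> T v * (?d T v)\<^sup>2"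
    have "?K / (Z0 + Z1) = (\<Sum>T\<in>Pow A. \<Sum>v\<in>A. \<kappa> T v / (Z0 + Z1) * (?d T v)\<^sup>2)"
      by (simp add: sum_divide_distrib)
    also have "\<dots> \<le> D"
      unfolding D_def
    proof (intro sum_mono)
      fix T v assume T: "T \<in> Pow A" and v: "v \<in> A"
      have "toggle x (insert x B \<union> T) = B \<union> T" using x T by (auto simp: toggle_def)
      moreover have "toggle v (B \<union> T) = B \<union> toggle v T" using v AB by (intro toggle_Un) auto
      ultimately have e: "toggle v (toggle x (insert x B \<union> T)) = B \<union> toggle v T" by simp
      have "\<kappa> T v / (Z0 + Z1) \<le> ?w (insert x B \<union> T) * ?w (B \<union> toggle v T) /
          (?w (insert x B \<union> T) + ?w (B \<union> toggle v T))"
        by (rule le_parallel_sum) (use T v \<kappa> Z w0 in auto)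
      then show "\<kappa> T v / (Z0 + Z1) * (?d T v)\<^sup>2 \<le>
          pair_energy ?w f (insert x B \<union> T) x v"
        unfolding pair_energy_def e by (intro mult_right_mono) auto
    qed
    finally have KD: "?K / (Z0 + Z1) \<le> D" .
    \<comment> \<open>The law of total variance times the total mass. The last term is
      \<open>Z0 * Z1 / (Z0 + Z1) * (s1 / Z1 - s0 / Z0)\<^sup>2\<close>, the variance between the two
      conditional means.\<close>
    have "q0 + q1 - (s0 + s1)\<^sup>2 / (Z0 + Z1) =
        (q0 - s0\<^sup>2 / Z0) + (q1 - s1\<^sup>2 / Z1) + (Z0 * s1 - Z1 * s0)\<^sup>2 / (Z0 * Z1) / (Z0 + Z1)"
      using Z by (simp add: divide_simps) (simp add: algebra_simps power2_eq_square)
    moreover have "(Z0 * s1 - Z1 * s0)\<^sup>2 / (Z0 * Z1) \<le> ?K"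
      using \<kappa>(4) Z by (simp add: divide_le_eq mult.commute)
    then have "(Z0 * s1 - Z1 * s0)\<^sup>2 / (Z0 * Z1) / (Z0 + Z1) \<le> ?K / (Z0 + Z1)"
      using Z by (intro divide_right_mono) auto
    ultimately show ?thesis using KD by linarith
  qed
  then show ?case
    unfolding dirichlet_form_insert[OF insert(1) x AB] D_def[symmetric] v(1)
    using IH0 IH1 unfolding v by linarith
qed

section \<open>Mixing of the pair dynamics\<close>

lemma pmf_bind_finite:
  assumes "finite A" "set_pmf p \<subseteq> A"
  shows "pmf (bind_pmf p f) y = (\<Sum>x\<in>A. pmf p x * pmf (f x) y)"
  unfolding pmf_bind
  by (subst integral_measure_pmf_real[where A = A]) (use assms in \<open>auto simp: mult.commute\<close>)

lemma prob_finite_support: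
  assumes "finite A" "set_pmf p \<subseteq> A"
  shows "measure_pmf.prob p X = (\<Sum>x\<in>A. pmf p x * indicator X x)"
proof -
  have "measure_pmf.prob p X = measure_pmf.prob p (X \<inter> A)"
    by (rule measure_pmf.finite_measure_eq_AE) (use assms in \<open>auto simp: AE_measure_pmf_iff\<close>)
  also have "\<dots> = (\<Sum>x\<in>A \<inter> X. pmf p x)"
    using assms by (subst measure_measure_pmf_finite) (auto simp: Int_commute)
  also have "\<dots> = (\<Sum>x\<in>A. pmf p x * indicator X x)"
    using assms by (simp add: sum.inter_restrict indicator_def if_distrib cong: if_cong)
  finally show ?thesis .
qed

lemma prob_bind_finite:
  assumes "finite A" "set_pmf p \<subseteq> A"
  shows "measure_pmf.prob (bind_pmf p f) X = (\<Sum>x\<in>A. pmf p x * measure_pmf.prob (f x) X)"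
proof -
  have "ennreal (measure_pmf.prob (bind_pmf p f) X) = (\<integral>\<^sup>+x. ennreal (measure_pmf.prob (f x) X) \<partial>p)"
    by (simp flip: measure_pmf.emeasure_eq_measure)
  also have "\<dots> = ennreal (\<integral>x. measure_pmf.prob (f x) X \<partial>p)"
    by (rule nn_integral_eq_integral) (auto intro!: measure_pmf.integrable_const_bound[where B = 1])
  finally have "measure_pmf.prob (bind_pmf p f) X = (\<integral>x. measure_pmf.prob (f x) X \<partial>p)"
    by (subst (asm) ennreal_inj) auto
  also have "\<dots> = (\<Sum>x\<in>A. pmf p x * measure_pmf.prob (f x) X)"
    by (subst integral_measure_pmf_real[where A = A]) (use assms in \<open>auto simp: mult.commute\<close>)
  finally show ?thesis .
qed

text \<open>The cross difference is at most \<open>2 * \<epsilon> * (a * b)\<close>, where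
  \<open>4 * (a * b) \<le> (a + b)\<^sup>2\<close> gains a factor of 4 and the denominator
  \<open>a' + b' \<ge> (a + b) / 2\<close> loses a factor of 2. The result is
  \<open>\<epsilon>\<close> itself rather than a multiple of it, as the shares of
  \<open>\<delta> / 3\<close> require.\<close>

lemma two_point_perturbation:
  fixes a b a' b' \<epsilon> :: real
  assumes "a \<ge> 0" "b \<ge> 0" "a + b > 0" "0 \<le> \<epsilon>" "\<epsilon> \<le> 1 / 2"
    and "(1 - \<epsilon>) * a \<le> a'" "a' \<le> (1 + \<epsilon>) * a" "(1 - \<epsilon>) * b \<le> b'" "b' \<le> (1 + \<epsilon>) * b"
  shows "\<bar>a' / (a' + b') - a / (a + b)\<bar> \<le> \<epsilon>"
proof -
  have ge: "(1 - \<epsilon>) * (a + b) \<le> a' + b'" using assms by (simp add: algebra_simps)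
  moreover have "(1 - \<epsilon>) * (a + b) > 0" using assms by (intro mult_pos_pos) auto
  ultimately have pos: "a' + b' > 0" by linarith
  have "a' * b \<le> (1 + \<epsilon>) * a * b" "(1 - \<epsilon>) * a * b \<le> a' * b"
    using assms by (auto intro: mult_right_mono)
  moreover have "a * b' \<le> (1 + \<epsilon>) * a * b" "(1 - \<epsilon>) * a * b \<le> a * b'"
    using mult_left_mono[OF assms(9,1)] mult_left_mono[OF assms(8,1)] by (simp_all add: mult_ac)
  ultimately have 1: "\<bar>a' * b - a * b'\<bar> \<le> 2 * \<epsilon> * (a * b)" by (simp add: algebra_simps)
  have "4 * (a * b) \<le> (a + b)\<^sup>2" using sum_squares_bound[of a b] by (simp add: power2_sum)
  then have "\<epsilon> * (4 * (a * b)) \<le> \<epsilon> * (a + b)\<^sup>2" using assms by (intro mult_left_mono)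
  moreover have "\<epsilon> * (a + b)\<^sup>2 / 2 \<le> \<epsilon> * ((a' + b') * (a + b))"
  proof -
    have "1 / 2 * (a + b) \<le> (1 - \<epsilon>) * (a + b)" using assms by (intro mult_right_mono) auto
    then have "1 / 2 * (a + b) \<le> a' + b'" using ge by linarith
    then have "1 / 2 * (a + b) * (a + b) \<le> (a' + b') * (a + b)"
      using assms by (intro mult_right_mono) auto
    from mult_left_mono[OF this assms(4)] show ?thesis by (simp add: power2_eq_square mult.assoc)
  qed
  ultimately have "\<bar>a' * b - a * b'\<bar> \<le> \<epsilon> * ((a' + b') * (a + b))" using 1 by linarith
  moreover have "a' / (a' + b') - a / (a + b) = (a' * b - a * b') / ((a' + b') * (a + b))"
    using pos assms(3) by (simp add: divide_simps) (simp add: algebra_simps)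
  ultimately show ?thesis
    using pos assms(3) by (simp add: abs_divide abs_mult divide_le_eq)
qed

text \<open>\<open>pinned_variance\<close> is the total mass times the variance, that is, the least
  weighted second moment over all centres, attained at the mean. This form allows the weights to be
  changed while the centre is held fixed.\<close>

lemma pinned_variance_le:
  assumes "finite A" "\<And>S. g S \<ge> 0"
  shows "pinned_variance g A B f \<le> (\<Sum>T\<in>Pow A. g (B \<union> T) * (f (B \<union> T) - c)\<^sup>2)"
    and "pinned_variance g A B f = (\<Sum>T\<in>Pow A. g (B \<union> T) *
      (f (B \<union> T) - (\<Sum>T\<in>Pow A. g (B \<union> T) * f (B \<union> T)) / (\<Sum>T\<in>Pow A. g (B \<union> T)))\<^sup>2)"
proof -
  define Z s q where "Z = (\<Sum>T\<in>Pow A. g (B \<union> T))" and "s = (\<Sum>T\<in>Pow A. g (B \<union> T) * f (B \<union> T))"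
    and "q = (\<Sum>T\<in>Pow A. g (B \<union> T) * (f (B \<union> T))\<^sup>2)"
  have expand: "(\<Sum>T\<in>Pow A. g (B \<union> T) * (f (B \<union> T) - c)\<^sup>2) = q - 2 * c * s + c\<^sup>2 * Z" for c
  proof -
    have "(\<Sum>T\<in>Pow A. g (B \<union> T) * (f (B \<union> T) - c)\<^sup>2) =
        (\<Sum>T\<in>Pow A. g (B \<union> T) * (f (B \<union> T))\<^sup>2 - 2 * c * (g (B \<union> T) * f (B \<union> T)) + c\<^sup>2 * g (B \<union> T))"
      by (intro sum.cong refl) (simp add: power2_eq_square algebra_simps)
    also have "\<dots> = q - 2 * c * s + c\<^sup>2 * Z"
      by (simp only: sum.distrib sum_subtractf q_def s_def Z_def sum_distrib_left)
    finally show ?thesis .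
  qed
  have Z0: "Z \<ge> 0" unfolding Z_def by (intro sum_nonneg assms)
  have s0: "s = 0" if "Z = 0"
    using that assms unfolding Z_def s_def by (intro sum.neutral) (auto simp: sum_nonneg_eq_0_iff)
  have pv: "pinned_variance g A B f = q - s\<^sup>2 / Z" by (simp add: pinned_variance_def q_def s_def Z_def)
  show "pinned_variance g A B f = (\<Sum>T\<in>Pow A. g (B \<union> T) *
      (f (B \<union> T) - (\<Sum>T\<in>Pow A. g (B \<union> T) * f (B \<union> T)) / (\<Sum>T\<in>Pow A. g (B \<union> T)))\<^sup>2)"
    unfolding s_def[symmetric] Z_def[symmetric] expand pv using s0
    by (cases "Z = 0") (auto simp: field_simps power2_eq_square)
  show "pinned_variance g A B f \<le> (\<Sum>T\<in>Pow A. g (B \<union> T) * (f (B \<union> T) - c)\<^sup>2)"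
  proof (cases "Z = 0")
    case True
    then show ?thesis using s0 by (simp add: pv expand)
  next
    case False
    then have "Z > 0" using Z0 by simp
    have "0 \<le> (s - c * Z)\<^sup>2 / Z" using Z0 by simp
    also have "\<dots> = s\<^sup>2 / Z - 2 * c * s + c\<^sup>2 * Z"
      using False by (simp add: field_simps power2_eq_square)
    finally show ?thesis by (simp add: pv expand)
  qed
qed

section \<open>Stability of the Poincare inequality under pointwise perturbation of the
  weights\<close>

lemma parallel_sum_mono:
  fixes a b a' b' c :: real
  assumes "a \<ge> 0" "b \<ge> 0" "a' \<ge> 0" "b' \<ge> 0" "c > 0" "a \<le> c * a'" "b \<le> c * b'"
  shows "a * b / (a + b) \<le> c * (a' * b' / (a' + b'))"
proof (cases "a' + b' = 0")
  case True
  then have "a' = 0" "b' = 0" using assms by linarith+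
  then show ?thesis using assms by simp
next
  case False
  then have p: "a' + b' > 0" using assms by linarith
  show ?thesis
  proof (cases "a + b = 0")
    case True
    then show ?thesis using assms p by simp
  next
    case False
    then have q: "a + b > 0" using assms by linarith
    have "(a * a') * b \<le> (a * a') * (c * b')" "(b * b') * a \<le> (b * b') * (c * a')"
      using assms by (auto intro!: mult_left_mono)
    then have "a * b * (a' + b') \<le> c * (a' * b') * (a + b)" by (simp add: algebra_simps)
    then show ?thesis using p q by (simp add: divide_simps mult_ac)
  qed
qed

text \<open>The variance is centred at the mean of the ideal measure, so replacing \<open>g\<close>
  by the ideal weight costs 4/3. The flow between two sets is monotone and homogeneous in the
  weights, so going back to \<open>g\<close> costs 3/2. The product is 2.\<close>

lemma poincare_perturbed:
  fixes f g :: "'a set \<Rightarrow> real"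
  assumes fin: "finite V" "finite E" and two: "\<And>e. e \<in> E \<Longrightarrow> card e = 2" and lam: "lam \<ge> 0"
    and g0: "\<And>S. g S \<ge> 0"
    and lo: "\<And>S. S \<subseteq> V \<Longrightarrow> 2 / 3 * cover_weight lam E S \<le> g S"
    and hi: "\<And>S. S \<subseteq> V \<Longrightarrow> g S \<le> 4 / 3 * cover_weight lam E S"
  shows "pinned_variance g V {} f \<le> 2 * dirichlet_form g V {} f"
proof -
  let ?w = "cover_weight lam E"
  define c where "c = (\<Sum>T\<in>Pow V. ?w ({} \<union> T) * f ({} \<union> T)) / (\<Sum>T\<in>Pow V. ?w ({} \<union> T))"
  have w0: "?w S \<ge> 0" for S by (rule cover_weight_nonneg[OF lam])
  have "pinned_variance g V {} f \<le> (\<Sum>T\<in>Pow V. g ({} \<union> T) * (f ({} \<union> T) - c)\<^sup>2)"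
    by (rule pinned_variance_le(1)[OF fin(1) g0])
  also have "\<dots> \<le> (\<Sum>T\<in>Pow V. 4 / 3 * (?w ({} \<union> T) * (f ({} \<union> T) - c)\<^sup>2))"
    unfolding mult.assoc[symmetric] using hi by (intro sum_mono mult_right_mono) auto
  also have "\<dots> = 4 / 3 * pinned_variance ?w V {} f"
    unfolding pinned_variance_le(2)[OF fin(1) w0] c_def sum_distrib_left ..
  also have "\<dots> \<le> 4 / 3 * dirichlet_form ?w V {} f"
    using poincare_cover_weight[OF fin two lam, of "{}" f] by simp
  also have "\<dots> \<le> 4 / 3 * (3 / 2 * dirichlet_form g V {} f)"
  proof -
    have "dirichlet_form ?w V {} f \<le> (\<Sum>T\<in>Pow V. \<Sum>u\<in>V. \<Sum>v\<in>V. 3 / 2 * pair_energy g f ({} \<union> T) u v) / 4"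
      unfolding dirichlet_form_def
    proof (intro divide_right_mono sum_mono)
      fix T u v assume T: "T \<in> Pow V" and u: "u \<in> V" and v: "v \<in> V"
      let ?T = "toggle v (toggle u ({} \<union> T))"
      have "?T \<subseteq> V" using T u v by (simp add: toggle_subset)
      moreover have "{} \<union> T \<subseteq> V" using T by simp
      ultimately have "?w ({} \<union> T) * ?w ?T / (?w ({} \<union> T) + ?w ?T) \<le> 3 / 2 * (g ({} \<union> T) * g ?T / (g ({} \<union> T) + g ?T))"
        using lo[of "{} \<union> T"] lo[of ?T] by (intro parallel_sum_mono w0 g0) auto
      then show "pair_energy ?w f ({} \<union> T) u v \<le> 3 / 2 * pair_energy g f ({} \<union> T) u v"
        unfolding pair_energy_def mult.assoc[symmetric] by (intro mult_right_mono) (auto simp: mult_ac)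
    qed simp
    also have "\<dots> = 3 / 2 * dirichlet_form g V {} f"
      by (simp only: dirichlet_form_def sum_distrib_left[symmetric] times_divide_eq_right)
    finally show ?thesis by simp
  qed
  finally show ?thesis by simp
qed

text \<open>If both weights vanish, the acceptance probability is \<open>0 / 0 = 0\<close>.\<close>

definition walk_move :: "('a set \<Rightarrow> real) \<Rightarrow> 'a \<Rightarrow> 'a \<Rightarrow> 'a set \<Rightarrow> 'a set pmf" where
  "walk_move g u v S = map_pmf (\<lambda>b. if b then toggle v (toggle u S) else S)
     (bernoulli_pmf (g (toggle v (toggle u S)) / (g S + g (toggle v (toggle u S)))))"

text \<open>The choice \<open>u = v\<close> is allowed and leaves \<open>S\<close> in place; drawing
  both independently keeps the average over ordered pairs uniform.\<close>

definition walk_step :: "('a set \<Rightarrow> real) \<Rightarrow> 'a set \<Rightarrow> 'a set \<Rightarrow> 'a set pmf" where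
  "walk_step g V S = bind_pmf (pmf_of_set V) (\<lambda>u. bind_pmf (pmf_of_set V) (\<lambda>v. walk_move g u v S))"

lemma pmf_map_bernoulli:
  assumes "0 \<le> a" "a \<le> 1"
  shows "pmf (map_pmf (\<lambda>b. if b then x else y) (bernoulli_pmf a)) z =
    a * of_bool (z = x) + (1 - a) * of_bool (z = y)"
  unfolding map_pmf_def pmf_bind integral_bernoulli_pmf[OF assms] by (simp add: indicator_def)

lemma sum_toggle_pair:
  assumes "u \<in> V" "v \<in> V"
  shows "(\<Sum>S\<in>Pow V. h (toggle v (toggle u S))) = (\<Sum>S\<in>Pow V. h S)"
  using sum_toggle[OF assms(1), of "\<lambda>S. h (toggle v S)"] sum_toggle[OF assms(2), of h] by simp

text \<open>The start \<open>{}\<close> has ideal weight 1, from the empty matching, so its share of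
  the total mass has a lower bound that does not need the structure of the graph.\<close>

primrec walk :: "'a set \<Rightarrow> ('a set \<Rightarrow> real) \<Rightarrow> nat \<Rightarrow> 'a set pmf" where
  "walk V g 0 = return_pmf {}"
| "walk V g (Suc N) = bind_pmf (walk V g N) (walk_step g V)"

context
  fixes V :: "'a set" and g :: "'a set \<Rightarrow> real"
  assumes fin: "finite V" and ne: "V \<noteq> {}" and g0: "\<And>S. g S \<ge> 0"
begin

text \<open>A proposal of weight zero is accepted with probability zero. The walk thus stays where
  \<open>g\<close> is positive, and its law has a density with respect to \<open>g\<close>.\<close>

lemma set_pmf_walk_step:
  assumes "S \<subseteq> V" "g S > 0" "S' \<in> set_pmf (walk_step g V S)"
  shows "S' \<subseteq> V \<and> g S' > 0"
proof -
  obtain u v where uv: "u \<in> V" "v \<in> V" and S': "S' \<in> set_pmf (walk_move g u v S)"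
    using assms(3) fin ne by (auto simp: walk_step_def)
  let ?T = "toggle v (toggle u S)"
  have T: "?T \<subseteq> V" using uv assms by (simp add: toggle_subset)
  show ?thesis
  proof (cases "g ?T = 0")
    case True
    have "pmf (bernoulli_pmf (0::real)) True = 0" by simp
    then have "True \<notin> set_pmf (bernoulli_pmf (0::real))" unfolding set_pmf_iff by simp
    moreover obtain b where "b \<in> set_pmf (bernoulli_pmf (0::real))" "S' = (if b then ?T else S)"
      using S' True by (auto simp: walk_move_def)
    ultimately have "S' = S" by (cases b) auto
    then show ?thesis using assms by simp
  next
    case False
    then have "g ?T > 0" using g0[of ?T] by linarith
    then show ?thesis using S' T assms by (auto simp: walk_move_def split: if_splits)
  qed
qed

lemma set_pmf_bind_walk_step:
  assumes "set_pmf p \<subseteq> {S. S \<subseteq> V \<and> g S > 0}"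
  shows "set_pmf (bind_pmf p (walk_step g V)) \<subseteq> {S. S \<subseteq> V \<and> g S > 0}"
proof
  fix R assume "R \<in> set_pmf (bind_pmf p (walk_step g V))"
  then obtain S where "S \<in> set_pmf p" "R \<in> set_pmf (walk_step g V S)" by auto
  then show "R \<in> {S. S \<subseteq> V \<and> g S > 0}" using set_pmf_walk_step[of S R] assms by auto
qed

text \<open>For fixed \<open>u, v\<close> the move pools the mass of \<open>S\<close> and of its
  toggled partner and divides it again in proportion to \<open>g\<close>.\<close>

lemma pmf_walk_step:
  assumes p: "set_pmf p \<subseteq> {S. S \<subseteq> V \<and> g S > 0}" and S: "S \<subseteq> V" "g S > 0"
  shows "pmf (bind_pmf p (walk_step g V)) S =
    (\<Sum>u\<in>V. \<Sum>v\<in>V. (pmf p S + pmf p (toggle v (toggle u S))) *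
      (g S / (g S + g (toggle v (toggle u S))))) / (real (card V))\<^sup>2"
proof -
  have finP: "finite (Pow V)" using fin by simp
  have sub: "set_pmf p \<subseteq> Pow V" using p by auto
  have inner: "(\<Sum>R\<in>Pow V. pmf p R * pmf (walk_move g u v R) S) =
      (pmf p S + pmf p (toggle v (toggle u S))) * (g S / (g S + g (toggle v (toggle u S))))"
    if uv: "u \<in> V" "v \<in> V" for u v
  proof -
    define \<tau> where "\<tau> = (\<lambda>S. toggle v (toggle u S))"
    define a where "a = (\<lambda>R. g (\<tau> R) / (g R + g (\<tau> R)))"
    have \<tau>\<tau>: "\<tau> (\<tau> R) = R" for R by (simp add: \<tau>_def toggle_pair_involution)
    have a01: "0 \<le> a R" "a R \<le> 1" for R
      using g0[of R] g0[of "\<tau> R"] by (auto simp: a_def divide_le_eq)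
    have mv: "pmf (walk_move g u v R) S = a R * of_bool (S = \<tau> R) + (1 - a R) * of_bool (S = R)" for R
      using pmf_map_bernoulli[OF a01(1)[of R] a01(2)[of R], of "\<tau> R" R S]
      by (simp only: walk_move_def a_def \<tau>_def)
    have "(\<Sum>R\<in>Pow V. pmf p R * pmf (walk_move g u v R) S) =
        (\<Sum>R\<in>Pow V. pmf p R * (a R * of_bool (S = \<tau> R) + (1 - a R) * of_bool (S = R)))"
      by (simp only: mv)
    also have "\<dots> = (\<Sum>R\<in>Pow V. if R = \<tau> S then pmf p R * a R else 0) +
        (\<Sum>R\<in>Pow V. if R = S then pmf p R * (1 - a R) else 0)"
      unfolding sum.distrib[symmetric] by (intro sum.cong) (auto simp: \<tau>\<tau> algebra_simps)
    also have "\<dots> = pmf p (\<tau> S) * a (\<tau> S) + pmf p S * (1 - a S)"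
      using finP S uv by (simp add: \<tau>_def toggle_subset)
    also have "a (\<tau> S) = g S / (g S + g (\<tau> S))" by (simp add: a_def \<tau>\<tau> add.commute)
    also have "1 - a S = g S / (g S + g (\<tau> S))"
      using S g0[of "\<tau> S"] by (simp add: a_def field_simps)
    finally show ?thesis by (simp only: \<tau>_def distrib_right add.commute)
  qed
  have "pmf (bind_pmf p (walk_step g V)) S = (\<Sum>R\<in>Pow V. pmf p R * pmf (walk_step g V R) S)"
    by (rule pmf_bind_finite[OF finP sub])
  also have "\<dots> = (\<Sum>R\<in>Pow V. (\<Sum>u\<in>V. \<Sum>v\<in>V. pmf p R * pmf (walk_move g u v R) S)) / (real (card V))\<^sup>2"
    unfolding walk_step_def pmf_bind_pmf_of_set[OF ne fin]
    by (simp add: sum_divide_distrib sum_distrib_left power2_eq_square)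
  also have "(\<Sum>R\<in>Pow V. (\<Sum>u\<in>V. \<Sum>v\<in>V. pmf p R * pmf (walk_move g u v R) S)) =
      (\<Sum>u\<in>V. \<Sum>v\<in>V. \<Sum>R\<in>Pow V. pmf p R * pmf (walk_move g u v R) S)"
    by (subst sum.swap, rule sum.cong[OF refl], rule sum.swap)
  also have "\<dots> = (\<Sum>u\<in>V. \<Sum>v\<in>V. (pmf p S + pmf p (toggle v (toggle u S))) *
      (g S / (g S + g (toggle v (toggle u S)))))"
    by (intro sum.cong refl inner)
  finally show ?thesis .
qed

section \<open>Decay of the chi-square distance along the walk\<close>

definition chi_square :: "'a set pmf \<Rightarrow> real" where
  "chi_square p = (\<Sum>S\<in>Pow V. (pmf p S)\<^sup>2 / g S)"

text \<open>With \<open>Z\<close> the total mass of \<open>g\<close>, \<open>chi_square p\<close> is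
  \<open>1 / Z\<close> times one plus the usual chi-square distance of \<open>p\<close> from
  \<open>g / Z\<close>. Its excess over the minimum \<open>1 / Z\<close> is therefore the variance
  of the density \<open>p / g\<close>, to which the Poincare inequality applies.\<close>

lemma chi_square_eq_variance:
  assumes p: "set_pmf p \<subseteq> {S. S \<subseteq> V \<and> g S > 0}"
  shows "pinned_variance g V {} (\<lambda>S. pmf p S / g S) = chi_square p - 1 / (\<Sum>S\<in>Pow V. g S)"
proof -
  have z: "pmf p S = 0" if "g S = 0" for S
    using p that by (auto simp: set_pmf_iff)
  have "(\<Sum>S\<in>Pow V. g S * (pmf p S / g S)\<^sup>2) = chi_square p"
    unfolding chi_square_def by (intro sum.cong) (auto simp: power2_eq_square)
  moreover have "(\<Sum>S\<in>Pow V. g S * (pmf p S / g S)) = (\<Sum>S\<in>Pow V. pmf p S)"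
    by (intro sum.cong) (auto simp: z)
  moreover have "(\<Sum>S\<in>Pow V. pmf p S) = 1"
    using p fin by (intro sum_pmf_eq_1) auto
  ultimately show ?thesis by (simp add: pinned_variance_def)
qed

text \<open>A step averages over the ordered pairs \<open>u, v\<close>, and by convexity its
  chi-square is at most the average over the single moves. Each single move averages the density
  over pairs of sets and loses half the sum of the pair energies. In total this is half of
  \<open>4 * dirichlet_form\<close>, divided by the number of pairs.\<close>

lemma chi_square_step:
  assumes p: "set_pmf p \<subseteq> {S. S \<subseteq> V \<and> g S > 0}"
  shows "chi_square (bind_pmf p (walk_step g V)) \<le>
    chi_square p - 2 / (real (card V))\<^sup>2 * dirichlet_form g V {} (\<lambda>S. pmf p S / g S)"
proof -
  let ?f = "\<lambda>S. pmf p S / g S"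
  let ?n = "real (card V)"
  have n: "?n > 0" using fin ne by (simp add: card_gt_0_iff)
  have z: "pmf p S = 0" if "g S = 0" for S
    using p that by (auto simp: set_pmf_iff)
  define \<tau> where "\<tau> = (\<lambda>u v (S::'a set). toggle v (toggle u S))"
  define r where "r = (\<lambda>u v S. (pmf p S + pmf p (\<tau> u v S)) / (g S + g (\<tau> u v S)))"
  let ?p' = "bind_pmf p (walk_step g V)"
  have bound: "(pmf ?p' S)\<^sup>2 / g S \<le> (\<Sum>u\<in>V. \<Sum>v\<in>V. g S * (r u v S)\<^sup>2) / ?n\<^sup>2" if S: "S \<in> Pow V" for S
  proof (cases "g S = 0")
    case True
    then show ?thesis by simp
  next
    case False
    then have gS: "g S > 0" using g0[of S] by linarith
    have "pmf ?p' S = (\<Sum>u\<in>V. \<Sum>v\<in>V. g S * r u v S) / ?n\<^sup>2"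
      using pmf_walk_step[OF p _ gS] S by (simp add: r_def \<tau>_def mult_ac)
    also have "\<dots> = g S * (\<Sum>(u, v)\<in>V \<times> V. r u v S) / ?n\<^sup>2"
      by (simp add: sum_distrib_left sum.cartesian_product split_beta)
    finally have e: "pmf ?p' S = g S * (\<Sum>(u, v)\<in>V \<times> V. r u v S) / ?n\<^sup>2" .
    have "(pmf ?p' S)\<^sup>2 / g S = g S * (\<Sum>(u, v)\<in>V \<times> V. r u v S)\<^sup>2 / ?n ^ 4"
    proof -
      have "(x * y / k\<^sup>2)\<^sup>2 / x = x * y\<^sup>2 / k ^ 4" if "x > 0" for x y k :: real
        using that by (simp add: power2_eq_square power4_eq_xxxx mult_ac)
      then show ?thesis unfolding e using gS .
    qed
    \<comment> \<open>Convexity of the square over the pairs \<open>u, v\<close>, in the form of the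
      Cauchy-Schwarz inequality with unit weights.\<close>
    also have "\<dots> \<le> g S * (?n\<^sup>2 * (\<Sum>(u, v)\<in>V \<times> V. (r u v S)\<^sup>2)) / ?n ^ 4"
    proof (intro divide_right_mono mult_left_mono)
      show "(\<Sum>(u, v)\<in>V \<times> V. r u v S)\<^sup>2 \<le> ?n\<^sup>2 * (\<Sum>(u, v)\<in>V \<times> V. (r u v S)\<^sup>2)"
        using weighted_cauchy_schwarz[of "V \<times> V" "\<lambda>_. 1" "\<lambda>(u, v). r u v S"]
        by (simp add: split_beta power2_eq_square card_cartesian_product)
    qed (use gS in auto)
    also have "\<dots> = (\<Sum>u\<in>V. \<Sum>v\<in>V. g S * (r u v S)\<^sup>2) / ?n\<^sup>2"
    proof -
      have "(\<Sum>u\<in>V. \<Sum>v\<in>V. g S * (r u v S)\<^sup>2) = g S * (\<Sum>(u, v)\<in>V \<times> V. (r u v S)\<^sup>2)"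
        by (simp add: sum_distrib_left sum.cartesian_product split_beta)
      moreover have "x * (k\<^sup>2 * y) / k ^ 4 = x * y / k\<^sup>2" if "k > 0" for x y k :: real
        using that by (simp add: power2_eq_square power4_eq_xxxx)
      ultimately show ?thesis using n by presburger
    qed
    finally show ?thesis .
  qed
  \<comment> \<open>Adding the terms of \<open>S\<close> and of its partner visits each pair twice,
    which produces the factor 1/2 of the energy.\<close>
  have pair: "(\<Sum>S\<in>Pow V. g S * (r u v S)\<^sup>2) =
      chi_square p - (\<Sum>S\<in>Pow V. pair_energy g ?f S u v) / 2"
    if uv: "u \<in> V" "v \<in> V" for u v
  proof -
    have sw: "(\<Sum>S\<in>Pow V. h (\<tau> u v S)) = (\<Sum>S\<in>Pow V. h S)" for h :: "'a set \<Rightarrow> real"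
      unfolding \<tau>_def by (rule sum_toggle_pair[OF uv])
    have r\<tau>: "r u v (\<tau> u v S) = r u v S" for S
      by (simp add: r_def \<tau>_def toggle_pair_involution add.commute)
    \<comment> \<open>Pythagoras on a two-point space: second moment of the mean equals second
      moment minus variance.\<close>
    have id: "g S * (r u v S)\<^sup>2 + g (\<tau> u v S) * (r u v (\<tau> u v S))\<^sup>2 =
        (pmf p S)\<^sup>2 / g S + (pmf p (\<tau> u v S))\<^sup>2 / g (\<tau> u v S) -
        pair_energy g ?f S u v" for S
    proof -
      have "b * ((x + y) / (b + c))\<^sup>2 + c * ((x + y) / (b + c))\<^sup>2 =
          x\<^sup>2 / b + y\<^sup>2 / c - b * c / (b + c) * (x / b - y / c)\<^sup>2"
        if "b \<ge> 0" "c \<ge> 0" "b = 0 \<Longrightarrow> x = 0" "c = 0 \<Longrightarrow> y = 0" for b c x y :: real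
      proof (cases "b = 0 \<or> c = 0")
        case True
        then show ?thesis using that by (auto simp: power2_eq_square)
      next
        case False
        then have "b > 0" "c > 0" "b + c > 0" using that by auto
        have "b * ((x + y) / (b + c))\<^sup>2 + c * ((x + y) / (b + c))\<^sup>2 = (x + y)\<^sup>2 / (b + c)"
          using \<open>b + c > 0\<close> by (simp add: power_divide power2_eq_square flip: add_divide_distrib distrib_right)
        also have "\<dots> = x\<^sup>2 / b + y\<^sup>2 / c - b * c / (b + c) * (x / b - y / c)\<^sup>2"
          using \<open>b > 0\<close> \<open>c > 0\<close> \<open>b + c > 0\<close>
          by (simp add: divide_simps) (simp add: algebra_simps power2_eq_square)
        finally show ?thesis .
      qed
      from this[of "g S" "g (\<tau> u v S)" "pmf p S" "pmf p (\<tau> u v S)"] show ?thesis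
        unfolding r\<tau> using g0 z by (simp add: r_def pair_energy_def \<tau>_def)
    qed
    have "2 * (\<Sum>S\<in>Pow V. g S * (r u v S)\<^sup>2) =
        (\<Sum>S\<in>Pow V. g S * (r u v S)\<^sup>2 + g (\<tau> u v S) * (r u v (\<tau> u v S))\<^sup>2)"
      using sw[of "\<lambda>S. g S * (r u v S)\<^sup>2"] by (simp add: sum.distrib)
    also have "\<dots> = chi_square p + chi_square p - (\<Sum>S\<in>Pow V. pair_energy g ?f S u v)"
      unfolding id sum_subtractf sum.distrib chi_square_def
      using sw[of "\<lambda>S. (pmf p S)\<^sup>2 / g S"] by simp
    finally show ?thesis by simp
  qed
  have "chi_square ?p' \<le> (\<Sum>S\<in>Pow V. (\<Sum>u\<in>V. \<Sum>v\<in>V. g S * (r u v S)\<^sup>2) / ?n\<^sup>2)"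
    unfolding chi_square_def by (intro sum_mono bound)
  also have "\<dots> = (\<Sum>u\<in>V. \<Sum>v\<in>V. \<Sum>S\<in>Pow V. g S * (r u v S)\<^sup>2) / ?n\<^sup>2"
    unfolding sum_divide_distrib[symmetric]
    by (rule arg_cong[where f = "\<lambda>x. x / ?n\<^sup>2"], subst sum.swap, rule sum.cong[OF refl], rule sum.swap)
  also have "(\<Sum>u\<in>V. \<Sum>v\<in>V. \<Sum>S\<in>Pow V. g S * (r u v S)\<^sup>2) =
      (\<Sum>u\<in>V. \<Sum>v\<in>V. chi_square p - (\<Sum>S\<in>Pow V. pair_energy g ?f S u v) / 2)"
    by (intro sum.cong refl pair)
  also have "\<dots> = ?n\<^sup>2 * chi_square p - (\<Sum>u\<in>V. \<Sum>v\<in>V. \<Sum>S\<in>Pow V. pair_energy g ?f S u v) / 2"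
    by (simp add: sum_subtractf power2_eq_square sum_divide_distrib)
  also have "(\<Sum>u\<in>V. \<Sum>v\<in>V. \<Sum>S\<in>Pow V. pair_energy g ?f S u v) =
      4 * dirichlet_form g V {} ?f"
  proof -
    have "(\<Sum>u\<in>V. \<Sum>v\<in>V. \<Sum>S\<in>Pow V. pair_energy g ?f S u v) =
        (\<Sum>S\<in>Pow V. \<Sum>u\<in>V. \<Sum>v\<in>V. pair_energy g ?f S u v)"
      by (subst (2) sum.swap, subst sum.swap, rule refl)
    then show ?thesis by (simp add: dirichlet_form_def)
  qed
  finally show ?thesis using n by (simp add: diff_divide_distrib)
qed

text \<open>The constant 2 in the Poincare inequality cancels the 2 in the one-step decay, so each
  step shrinks the excess by \<open>1 - 1 / n\<^sup>2\<close>. The initial value is at most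
  \<open>1 / g {}\<close>, the chi-square of a point mass.\<close>

lemma walk_mixing:
  assumes poinc: "\<And>f. pinned_variance g V {} f \<le> 2 * dirichlet_form g V {} f" and pos: "g {} > 0"
  defines "Z \<equiv> \<Sum>S\<in>Pow V. g S"
  shows "set_pmf (walk V g N) \<subseteq> {S. S \<subseteq> V \<and> g S > 0}"
    and "chi_square (walk V g N) - 1 / Z \<le> (1 - 1 / (real (card V))\<^sup>2) ^ N / g {}"
proof -
  show supp: "set_pmf (walk V g N) \<subseteq> {S. S \<subseteq> V \<and> g S > 0}" for N
  proof (induction N)
    case 0
    then show ?case using pos by simp
  next
    case (Suc N)
    then show ?case unfolding walk.simps by (rule set_pmf_bind_walk_step)
  qed
  let ?n = "real (card V)"
  have n: "?n \<ge> 1" using fin ne by (simp add: Suc_leI card_gt_0_iff)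
  have Z0: "Z \<ge> 0" unfolding Z_def by (intro sum_nonneg g0)
  show "chi_square (walk V g N) - 1 / Z \<le> (1 - 1 / ?n\<^sup>2) ^ N / g {}"
  proof (induction N)
    case 0
    have "chi_square (walk V g 0) = (\<Sum>S\<in>Pow V. if S = {} then 1 / g S else 0)"
      unfolding chi_square_def by (intro sum.cong) (auto simp: indicator_def)
    also have "\<dots> = 1 / g {}" using fin by (simp add: sum.delta)
    finally show ?case using Z0 by simp
  next
    case (Suc N)
    let ?f = "\<lambda>S. pmf (walk V g N) S / g S"
    have "chi_square (walk V g (Suc N)) \<le> chi_square (walk V g N) - 2 / ?n\<^sup>2 * dirichlet_form g V {} ?f"
      using chi_square_step[OF supp] by simp
    also have "2 / ?n\<^sup>2 * dirichlet_form g V {} ?f = (2 * dirichlet_form g V {} ?f) / ?n\<^sup>2" by simp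
    also have "chi_square (walk V g N) - (2 * dirichlet_form g V {} ?f) / ?n\<^sup>2 \<le>
        chi_square (walk V g N) - pinned_variance g V {} ?f / ?n\<^sup>2"
      using poinc[of ?f] by (intro diff_left_mono divide_right_mono) auto
    also have "pinned_variance g V {} ?f = chi_square (walk V g N) - 1 / Z"
      unfolding Z_def by (rule chi_square_eq_variance[OF supp])
    finally have "chi_square (walk V g (Suc N)) - 1 / Z \<le> (1 - 1 / ?n\<^sup>2) * (chi_square (walk V g N) - 1 / Z)"
      by (simp add: algebra_simps diff_divide_distrib)
    also have "\<dots> \<le> (1 - 1 / ?n\<^sup>2) * ((1 - 1 / ?n\<^sup>2) ^ N / g {})"
      using Suc.IH n by (intro mult_left_mono) auto
    finally show ?case by simp
  qed
qed

text \<open>The deviation of the density from \<open>1 / Z\<close> has weighted square norm equal to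
  the chi-square excess. The Cauchy-Schwarz inequality turns this into an absolute sum, at the cost
  of the total mass \<open>Z\<close> under the root.\<close>

lemma walk_tv:
  assumes poinc: "\<And>f. pinned_variance g V {} f \<le> 2 * dirichlet_form g V {} f" and pos: "g {} > 0"
  defines "Z \<equiv> \<Sum>S\<in>Pow V. g S"
  shows "\<bar>measure_pmf.prob (walk V g N) X - (\<Sum>S\<in>Pow V. g S * indicator X S) / Z\<bar> \<le>
    sqrt (Z / g {} * exp (- (real N / (real (card V))\<^sup>2)))"
proof -
  let ?n = "real (card V)" and ?p = "walk V g N"
  have n: "?n \<ge> 1" using fin ne by (simp add: Suc_leI card_gt_0_iff)
  have finP: "finite (Pow V)" using fin by simp
  have supp: "set_pmf ?p \<subseteq> {S. S \<subseteq> V \<and> g S > 0}" by (rule walk_mixing(1)[OF poinc pos])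
  have z: "pmf ?p S = 0" if "g S = 0" for S
    using supp that by (auto simp: set_pmf_iff)
  have "g {} \<le> Z" unfolding Z_def by (rule member_le_sum) (use finP g0 in auto)
  then have Z0: "Z > 0" using pos by linarith
  define d where "d = (\<lambda>S. pmf ?p S / g S - 1 / Z)"
  have gd: "g S * d S = pmf ?p S - g S / Z" for S
    using z[of S] by (cases "g S = 0") (auto simp: d_def field_simps)
  have "measure_pmf.prob ?p X - (\<Sum>S\<in>Pow V. g S * indicator X S) / Z =
      (\<Sum>S\<in>Pow V. (g S * d S) * indicator X S)"
    unfolding gd left_diff_distrib sum_subtractf sum_divide_distrib times_divide_eq_left
    using supp by (subst prob_finite_support[OF finP]) auto
  also have "\<bar>\<dots>\<bar> \<le> (\<Sum>S\<in>Pow V. g S * \<bar>d S\<bar>)"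
    by (rule order_trans[OF sum_abs sum_mono]) (auto simp: abs_mult g0 indicator_def)
  also have "\<dots> \<le> sqrt (Z * (\<Sum>S\<in>Pow V. g S * (d S)\<^sup>2))"
    using weighted_cauchy_schwarz[of "Pow V" g "\<lambda>S. \<bar>d S\<bar>"] g0 Z_def by (intro real_le_rsqrt) auto
  also have "\<dots> \<le> sqrt (Z / g {} * exp (- (real N / ?n\<^sup>2)))"
  proof (rule real_sqrt_le_mono)
    have "(\<Sum>S\<in>Pow V. g S * (pmf ?p S / g S)) = (\<Sum>S\<in>Pow V. pmf ?p S)"
      by (intro sum.cong) (auto simp: z)
    also have "\<dots> = 1" using supp finP by (intro sum_pmf_eq_1) auto
    finally have 1: "(\<Sum>S\<in>Pow V. g S * (pmf ?p S / g S)) = 1" .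
    have "(\<Sum>S\<in>Pow V. g S * (d S)\<^sup>2) = chi_square ?p - 1 / Z"
      unfolding d_def Z_def
      using pinned_variance_le(2)[OF fin g0, where B = "{}" and f = "\<lambda>S. pmf ?p S / g S"] chi_square_eq_variance[OF supp] 1
      by simp
    also have "\<dots> \<le> (1 - 1 / ?n\<^sup>2) ^ N / g {}"
      unfolding Z_def by (rule walk_mixing(2)[OF poinc pos])
    also have "\<dots> \<le> exp (- (real N / ?n\<^sup>2)) / g {}"
    proof (intro divide_right_mono)
      have "(1 - 1 / ?n\<^sup>2) ^ N \<le> exp (- (1 / ?n\<^sup>2)) ^ N"
        using exp_ge_add_one_self[of "- (1 / ?n\<^sup>2)"] n by (intro power_mono) auto
      also have "\<dots> = exp (- (real N / ?n\<^sup>2))" by (simp flip: exp_of_nat_mult)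
      finally show "(1 - 1 / ?n\<^sup>2) ^ N \<le> exp (- (real N / ?n\<^sup>2))" .
    qed (use pos in simp)
    finally have "Z * (\<Sum>S\<in>Pow V. g S * (d S)\<^sup>2) \<le> Z * (exp (- (real N / ?n\<^sup>2)) / g {})"
      using Z0 by (intro mult_left_mono) auto
    then show "Z * (\<Sum>S\<in>Pow V. g S * (d S)\<^sup>2) \<le> Z / g {} * exp (- (real N / ?n\<^sup>2))" by simp
  qed
  finally show ?thesis .
qed

end

section \<open>Sampling a perfect matching edge by edge\<close>

definition induced_graph :: "nat set \<Rightarrow> nat set set \<Rightarrow> graph" where
  "induced_graph W D = (W, {e \<in> D. e \<subseteq> W})"

lemma num_perfect_matchings_induced_graph:
  "num_perfect_matchings (induced_graph W D) = card (cover_matchings D W)"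
proof -
  have "{M. perfect_matching (induced_graph W D) M} = cover_matchings D W"
    by (auto simp: perfect_matching_def matching_def induced_graph_def cover_matchings_def)
  then show ?thesis by (simp add: num_perfect_matchings_def)
qed

text \<open>All matchings covering \<open>S\<close> have \<open>card S / 2\<close> edges. The square
  root stands in for this half-integral exponent, so the formula also makes sense for sets of odd
  size, where the count is zero.\<close>

lemma cover_weight_eq_card:
  assumes "finite E" "\<And>e. e \<in> E \<Longrightarrow> card e = 2" "lam \<ge> 0"
  shows "cover_weight lam E S = real (card (cover_matchings E S)) * sqrt lam ^ card S"
proof -
  have "lam ^ card M = sqrt lam ^ card S" if "M \<in> cover_matchings E S" for M
  proof -
    have "card S = 2 * card M"
      using card_Union_matching[of M] that assms finite_subset[of M E]
      by (auto simp: cover_matchings_def)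
    then show ?thesis using assms(3) by (simp add: power_mult)
  qed
  then show ?thesis by (simp add: cover_weight_def)
qed

text \<open>\<open>W\<close> is still to be covered, and \<open>D\<close> are the edges decided
  after \<open>e\<close>. With exact counts the coin has the probability that a uniform perfect
  matching of \<open>W\<close> from \<open>insert e D\<close> contains \<open>e\<close>. Only one of
  the two counts is asked of \<open>qa\<close>, so that oracle is called at most once per
  edge.\<close>

definition edge_choice :: "(graph \<Rightarrow> real) \<Rightarrow> (graph \<Rightarrow> real) \<Rightarrow> nat set \<Rightarrow> nat set set \<Rightarrow>
    nat set \<times> nat set set \<Rightarrow> (nat set \<times> nat set set) pmf" where
  "edge_choice qa qb e D = (\<lambda>(W, M).
     if e \<subseteq> W then map_pmf (\<lambda>b. if b then (W - e, insert e M) else (W, M))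
       (bernoulli_pmf (qa (induced_graph (W - e) D) /
         (qa (induced_graph (W - e) D) + qb (induced_graph W D))))
     else return_pmf (W, M))"

primrec sample_edges :: "(graph \<Rightarrow> real) \<Rightarrow> (graph \<Rightarrow> real) \<Rightarrow> nat set list \<Rightarrow>
    nat set \<times> nat set set \<Rightarrow> (nat set \<times> nat set set) pmf" where
  "sample_edges qa qb [] s = return_pmf s"
| "sample_edges qa qb (e # es) s = bind_pmf (edge_choice qa qb e (set es) s) (sample_edges qa qb es)"

text \<open>Deletion and contraction: a matching either avoids \<open>e\<close> or is
  \<open>e\<close> together with a matching of the remaining vertices.\<close>

lemma cover_matchings_insert:
  assumes "e \<notin> D" "e \<subseteq> W"
  shows "cover_matchings (insert e D) W = cover_matchings D W \<union> insert e ` cover_matchings D (W - e)"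
proof (intro equalityI subsetI)
  fix M assume M: "M \<in> cover_matchings (insert e D) W"
  show "M \<in> cover_matchings D W \<union> insert e ` cover_matchings D (W - e)"
  proof (cases "e \<in> M")
    case False
    then show ?thesis using M by (auto simp: cover_matchings_def)
  next
    case True
    have dj: "d \<inter> e = {}" if "d \<in> M - {e}" for d
      using M True that by (auto simp: cover_matchings_def disjoint_def)
    have "\<Union>M = e \<union> \<Union>(M - {e})" using True by blast
    then have "\<Union>(M - {e}) = W - e" using M dj by (auto simp: cover_matchings_def)
    moreover have "disjoint (M - {e})" "M - {e} \<subseteq> D"
      using M by (auto simp: cover_matchings_def disjoint_def)
    ultimately have "M - {e} \<in> cover_matchings D (W - e)" by (simp add: cover_matchings_def)
    moreover have "M = insert e (M - {e})" using True by blast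
    ultimately show ?thesis by blast
  qed
next
  fix M assume "M \<in> cover_matchings D W \<union> insert e ` cover_matchings D (W - e)"
  then consider "M \<in> cover_matchings D W" | N where "N \<in> cover_matchings D (W - e)" "M = insert e N"
    by blast
  then show "M \<in> cover_matchings (insert e D) W"
  proof cases
    case 1
    then show ?thesis by (auto simp: cover_matchings_def)
  next
    case 2
    then have N: "N \<subseteq> D" "disjoint N" "\<Union>N = W - e" by (auto simp: cover_matchings_def)
    have "d \<inter> e = {}" if "d \<in> N" for d using N(3) that by blast
    then have "disjoint (insert e N)" using N(2) unfolding disjoint_def by blast
    moreover have "\<Union>(insert e N) = W" using N(3) assms by auto
    ultimately show ?thesis using N 2 by (auto simp: cover_matchings_def)
  qed
qed

lemma cover_matchings_insert_outside:
  assumes "\<not> e \<subseteq> W"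
  shows "cover_matchings (insert e D) W = cover_matchings D W"
  using assms by (auto simp: cover_matchings_def)

lemma sum_cover_matchings_insert:
  fixes h :: "'a set set \<Rightarrow> real"
  assumes "e \<notin> D" "e \<subseteq> W" "finite D"
  shows "sum h (cover_matchings (insert e D) W) =
    sum h (cover_matchings D W) + (\<Sum>M\<in>cover_matchings D (W - e). h (insert e M))"
proof -
  have nd: "e \<notin> M" if "M \<in> cover_matchings D U" for M U using that assms by (auto simp: cover_matchings_def)
  have "sum h (cover_matchings (insert e D) W) =
      sum h (cover_matchings D W) + sum h (insert e ` cover_matchings D (W - e))"
    unfolding cover_matchings_insert[OF assms(1,2)]
    using assms(3) nd by (intro sum.union_disjoint) (auto simp: finite_cover_matchings)
  also have "sum h (insert e ` cover_matchings D (W - e)) = (\<Sum>M\<in>cover_matchings D (W - e). h (insert e M))"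
  proof (subst sum.reindex)
    show "inj_on (insert e) (cover_matchings D (W - e))"
      by (rule inj_onI) (metis nd insert_ident)
  qed simp
  finally show ?thesis .
qed

text \<open>The bounds on the two branches are assumed only where the exact process enters them with
  positive probability, because the uniform law on an empty set of matchings has no meaning
  there.\<close>

lemma convex_combination_diff:
  fixes \<alpha> \<beta> p1 p2 u1 u2 \<epsilon> c :: real
  assumes "\<bar>\<alpha> - \<beta>\<bar> \<le> \<epsilon>" "0 \<le> \<beta>" "\<beta> \<le> 1" "0 \<le> p1" "p1 \<le> 1" "0 \<le> p2" "p2 \<le> 1"
    and "\<beta> > 0 \<Longrightarrow> \<bar>p1 - u1\<bar> \<le> c" "\<beta> < 1 \<Longrightarrow> \<bar>p2 - u2\<bar> \<le> c"
  shows "\<bar>(\<alpha> * p1 + (1 - \<alpha>) * p2) - (\<beta> * u1 + (1 - \<beta>) * u2)\<bar> \<le> c + \<epsilon>"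
proof -
  have eq: "(\<alpha> * p1 + (1 - \<alpha>) * p2) - (\<beta> * u1 + (1 - \<beta>) * u2) =
      (\<alpha> - \<beta>) * (p1 - p2) + \<beta> * (p1 - u1) + (1 - \<beta>) * (p2 - u2)"
    by (simp add: algebra_simps)
  have "\<bar>(\<alpha> - \<beta>) * (p1 - p2)\<bar> \<le> \<epsilon> * 1"
    unfolding abs_mult using assms by (intro mult_mono) auto
  moreover have "\<bar>\<beta> * (p1 - u1)\<bar> \<le> \<beta> * c"
  proof (cases "\<beta> > 0")
    case True
    then show ?thesis using assms(8) by (simp add: abs_mult)
  qed (use assms in auto)
  moreover have "\<bar>(1 - \<beta>) * (p2 - u2)\<bar> \<le> (1 - \<beta>) * c"
  proof (cases "\<beta> < 1")
    case True
    then show ?thesis using assms(9) by (simp add: abs_mult)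
  next
    case False
    then have "\<beta> = 1" using assms by simp
    then show ?thesis by simp
  qed
  ultimately have "\<bar>(\<alpha> - \<beta>) * (p1 - p2) + \<beta> * (p1 - u1) + (1 - \<beta>) * (p2 - u2)\<bar> \<le> \<epsilon> * 1 + \<beta> * c + (1 - \<beta>) * c"
    by linarith
  then show ?thesis unfolding eq by (simp add: algebra_simps)
qed

lemma prob_map_bernoulli_bind:
  assumes "0 \<le> a" "a \<le> 1"
  shows "measure_pmf.prob (bind_pmf (map_pmf (\<lambda>b. if b then x else y) (bernoulli_pmf a)) f) X =
    a * measure_pmf.prob (f x) X + (1 - a) * measure_pmf.prob (f y) X"
  unfolding bind_map_pmf
  by (subst prob_bind_finite[of UNIV]) (use assms in \<open>auto simp: UNIV_bool\<close>)

text \<open>Oracle accuracy relative to one input graph, so that the analysis of a run need not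
  mention the class of graphs.\<close>

definition approximates :: "nat set \<Rightarrow> nat set set \<Rightarrow> real \<Rightarrow> (graph \<Rightarrow> real) \<Rightarrow> bool" where
  "approximates V E \<epsilon> q \<longleftrightarrow> (\<forall>W\<subseteq>V. \<forall>D\<subseteq>E.
     (1 - \<epsilon>) * card (cover_matchings D W) \<le> q (induced_graph W D) \<and>
     q (induced_graph W D) \<le> (1 + \<epsilon>) * card (cover_matchings D W))"

lemma approximatesD:
  assumes "approximates V E \<epsilon> q" "W \<subseteq> V" "D \<subseteq> E"
  shows "(1 - \<epsilon>) * card (cover_matchings D W) \<le> q (induced_graph W D) \<and>
    q (induced_graph W D) \<le> (1 + \<epsilon>) * card (cover_matchings D W)"
  using assms unfolding approximates_def by blast

text \<open>Each decision is off by at most \<open>\<epsilon>\<close>, and conditioning on it leaves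
  the same problem with one edge fewer, so the errors add up. The edges chosen earlier are carried
  along in \<open>M0\<close>.\<close>

lemma sample_edges_tv:
  fixes \<epsilon> :: real
  assumes "distinct es" "set es \<subseteq> E" "finite E" "W \<subseteq> V" "0 \<le> \<epsilon>" "\<epsilon> \<le> 1 / 2"
    and qa: "approximates V E \<epsilon> qa"
    and qb: "approximates V E \<epsilon> qb"
    and "cover_matchings (set es) W \<noteq> {}"
  shows "\<bar>measure_pmf.prob (map_pmf snd (sample_edges qa qb es (W, M0))) X -
    (\<Sum>M\<in>cover_matchings (set es) W. indicator X (M0 \<union> M)) / card (cover_matchings (set es) W)\<bar>
    \<le> real (length es) * \<epsilon>"
  using assms(1,2,4,9)
proof (induction es arbitrary: W M0)
  case Nil
  have "cover_matchings {} W = {{}}"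
    using Nil(4) by (auto simp: cover_matchings_def)
  then show ?case by (simp add: measure_return_pmf indicator_def)
next
  case (Cons e es)
  let ?D = "set es"
  have D: "?D \<subseteq> E" "finite ?D" "e \<notin> ?D" "distinct es" using Cons.prems by auto
  note IH = Cons.IH[OF D(4,1)]
  show ?case
  proof (cases "e \<subseteq> W")
    case False
    have pm: "cover_matchings (set (e # es)) W = cover_matchings ?D W"
      using cover_matchings_insert_outside[OF False] by simp
    have "sample_edges qa qb (e # es) (W, M0) = sample_edges qa qb es (W, M0)"
      using False by (simp add: edge_choice_def bind_return_pmf)
    then show ?thesis
      using IH[of W M0, OF Cons.prems(3)] Cons.prems(4) assms(5) unfolding pm
      by (auto simp: algebra_simps)
  next
    case True
    define a b where "a = real (card (cover_matchings ?D (W - e)))" and "b = real (card (cover_matchings ?D W))"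
    define a' b' where "a' = qa (induced_graph (W - e) ?D)" and "b' = qb (induced_graph W ?D)"
    define \<alpha> where "\<alpha> = a' / (a' + b')"
    define \<beta> where "\<beta> = a / (a + b)"
    have We: "W - e \<subseteq> V" using Cons.prems by auto
    have cnt: "real (card (cover_matchings (set (e # es)) W)) = a + b"
      using sum_cover_matchings_insert[OF D(3) True D(2), of "\<lambda>_. 1"] by (simp add: a_def b_def)
    have "cover_matchings (set (e # es)) W \<noteq> {}" by fact
    then have "real (card (cover_matchings (set (e # es)) W)) > 0"
      by (simp add: card_gt_0_iff finite_cover_matchings)
    then have ab: "a + b > 0" using cnt by simp
    have ab0: "a \<ge> 0" "b \<ge> 0" by (auto simp: a_def b_def)
    have qa': "(1 - \<epsilon>) * a \<le> a'" "a' \<le> (1 + \<epsilon>) * a"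
      using approximatesD[OF qa We D(1)] by (auto simp: a_def a'_def)
    have qb': "(1 - \<epsilon>) * b \<le> b'" "b' \<le> (1 + \<epsilon>) * b"
      using approximatesD[OF qb Cons.prems(3) D(1)] by (auto simp: b_def b'_def)
    have \<alpha>\<beta>: "\<bar>\<alpha> - \<beta>\<bar> \<le> \<epsilon>"
      unfolding \<alpha>_def \<beta>_def by (rule two_point_perturbation) (use ab ab0 assms qa' qb' in auto)
    have "0 \<le> (1 - \<epsilon>) * a" "0 \<le> (1 - \<epsilon>) * b" using assms ab0 by auto
    then have "a' \<ge> 0" "b' \<ge> 0" using qa' qb' by linarith+
    then have \<alpha>01: "0 \<le> \<alpha>" "\<alpha> \<le> 1" by (auto simp: \<alpha>_def divide_le_eq)
    have \<beta>01: "0 \<le> \<beta>" "\<beta> \<le> 1" using ab ab0 by (auto simp: \<beta>_def divide_le_eq)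
    let ?P1 = "measure_pmf.prob (map_pmf snd (sample_edges qa qb es (W - e, insert e M0))) X"
    let ?P2 = "measure_pmf.prob (map_pmf snd (sample_edges qa qb es (W, M0))) X"
    let ?U1 = "(\<Sum>M\<in>cover_matchings ?D (W - e). indicator X (insert e M0 \<union> M)) / a"
    let ?U2 = "(\<Sum>M\<in>cover_matchings ?D W. indicator X (M0 \<union> M)) / b"
    have P: "measure_pmf.prob (map_pmf snd (sample_edges qa qb (e # es) (W, M0))) X = \<alpha> * ?P1 + (1 - \<alpha>) * ?P2"
      using True prob_map_bernoulli_bind[OF \<alpha>01, of "(W - e, insert e M0)" "(W, M0)"
          "\<lambda>s. map_pmf snd (sample_edges qa qb es s)" X]
      by (simp add: edge_choice_def map_bind_pmf \<alpha>_def a'_def b'_def)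
    have U: "(\<Sum>M\<in>cover_matchings (set (e # es)) W. indicator X (M0 \<union> M)) / card (cover_matchings (set (e # es)) W)
        = \<beta> * ?U1 + (1 - \<beta>) * ?U2"
    proof -
      have "(\<Sum>M\<in>cover_matchings (set (e # es)) W. indicator X (M0 \<union> M)) =
          (\<Sum>M\<in>cover_matchings ?D W. indicator X (M0 \<union> M)) +
          (\<Sum>M\<in>cover_matchings ?D (W - e). indicator X (insert e M0 \<union> M) :: real)"
        using sum_cover_matchings_insert[OF D(3) True D(2), of "\<lambda>M. indicator X (M0 \<union> M)"] by simp
      moreover have "a * ?U1 = (\<Sum>M\<in>cover_matchings ?D (W - e). indicator X (insert e M0 \<union> M))"
      proof (cases "a = 0")
        \<comment> \<open>An empty branch has \<open>?U1 = 0\<close> by division by zero, which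
          agrees with its empty sum.\<close>
        case True
        then have "cover_matchings ?D (W - e) = {}"
          using D(2) by (simp add: a_def finite_cover_matchings)
        then show ?thesis by simp
      qed simp
      moreover have "b * ?U2 = (\<Sum>M\<in>cover_matchings ?D W. indicator X (M0 \<union> M))"
      proof (cases "b = 0")
        case True
        then have "cover_matchings ?D W = {}"
          using D(2) by (simp add: b_def finite_cover_matchings)
        then show ?thesis by simp
      qed simp
      moreover have "1 - \<beta> = b / (a + b)" using ab by (simp add: \<beta>_def field_simps)
      ultimately show ?thesis
        unfolding cnt \<beta>_def by (auto simp: add_divide_distrib split: if_splits)
    qed
    have "\<bar>\<alpha> * ?P1 + (1 - \<alpha>) * ?P2 - (\<beta> * ?U1 + (1 - \<beta>) * ?U2)\<bar> \<le> real (length es) * \<epsilon> + \<epsilon>"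
    proof (rule convex_combination_diff[OF \<alpha>\<beta> \<beta>01])
      assume "\<beta> > 0"
      then have "a \<noteq> 0" by (auto simp: \<beta>_def)
      then have "cover_matchings ?D (W - e) \<noteq> {}" by (auto simp: a_def)
      from IH[OF We this, of "insert e M0"] show "\<bar>?P1 - ?U1\<bar> \<le> real (length es) * \<epsilon>"
        by (simp only: a_def)
    next
      assume "\<beta> < 1"
      then have "b \<noteq> 0" using ab by (auto simp: \<beta>_def)
      then have "cover_matchings ?D W \<noteq> {}" by (auto simp: b_def)
      from IH[OF Cons.prems(3) this, of M0] show "\<bar>?P2 - ?U2\<bar> \<le> real (length es) * \<epsilon>"
        by (simp only: b_def)
    qed auto
    then show ?thesis unfolding P U by (simp add: algebra_simps)
  qed
qed

text \<open>A function with values between 0 and 1 pairs with a signed difference no more strongly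
  than the indicator of its positive or negative part. An event-wise bound \<open>d1\<close> thus
  passes to the mixture without a factor 2, and \<open>d2\<close> is added on the support of
  \<open>\<pi>\<close>.\<close>

lemma mixture_diff_le:
  fixes \<pi> h k :: "'b \<Rightarrow> real"
  assumes fin: "finite A" and p: "set_pmf p \<subseteq> A" and \<pi>: "\<And>x. x \<in> A \<Longrightarrow> \<pi> x \<ge> 0" "sum \<pi> A = 1"
    and d1: "\<And>X. \<bar>measure_pmf.prob p X - (\<Sum>x\<in>A. \<pi> x * indicator X x)\<bar> \<le> d1"
    and h: "\<And>x. x \<in> A \<Longrightarrow> 0 \<le> h x" "\<And>x. x \<in> A \<Longrightarrow> h x \<le> 1"
    and d2: "\<And>x. x \<in> A \<Longrightarrow> \<pi> x > 0 \<Longrightarrow> \<bar>h x - k x\<bar> \<le> d2"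
  shows "\<bar>(\<Sum>x\<in>A. pmf p x * h x) - (\<Sum>x\<in>A. \<pi> x * k x)\<bar> \<le> d1 + d2"
proof -
  define \<Delta> where "\<Delta> = (\<lambda>x. pmf p x - \<pi> x)"
  have \<Delta>X: "\<bar>\<Sum>x\<in>A. \<Delta> x * indicator X x\<bar> \<le> d1" for X
    using d1[of X] unfolding prob_finite_support[OF fin p] by (simp only: \<Delta>_def left_diff_distrib sum_subtractf)
  have "(\<Sum>x\<in>A. \<Delta> x * h x) \<le> (\<Sum>x\<in>A. \<Delta> x * indicator {x. \<Delta> x > 0} x)"
  proof (rule sum_mono)
    fix x assume x: "x \<in> A"
    show "\<Delta> x * h x \<le> \<Delta> x * indicator {x. \<Delta> x > 0} x"
      using h[OF x] by (cases "\<Delta> x > 0") (auto simp: mult_left_le mult_nonpos_nonneg)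
  qed
  moreover have "(\<Sum>x\<in>A. \<Delta> x * indicator {x. \<Delta> x < 0} x) \<le> (\<Sum>x\<in>A. \<Delta> x * h x)"
  proof (rule sum_mono)
    fix x assume x: "x \<in> A"
    show "\<Delta> x * indicator {x. \<Delta> x < 0} x \<le> \<Delta> x * h x"
      using h[OF x] mult_left_mono_neg[of "h x" 1 "\<Delta> x"] by (cases "\<Delta> x < 0") auto
  qed
  ultimately have 1: "\<bar>\<Sum>x\<in>A. \<Delta> x * h x\<bar> \<le> d1"
    using \<Delta>X[of "{x. \<Delta> x > 0}"] \<Delta>X[of "{x. \<Delta> x < 0}"] by linarith
  have "\<bar>\<Sum>x\<in>A. \<pi> x * (h x - k x)\<bar> \<le> (\<Sum>x\<in>A. \<pi> x * d2)"
  proof (rule order_trans[OF sum_abs sum_mono])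
    fix x assume x: "x \<in> A"
    show "\<bar>\<pi> x * (h x - k x)\<bar> \<le> \<pi> x * d2"
      using d2[OF x] \<pi>(1)[OF x] by (cases "\<pi> x = 0") (auto simp: abs_mult mult_left_mono)
  qed
  also have "\<dots> = d2" by (simp add: \<pi>(2) flip: sum_distrib_right)
  finally have 2: "\<bar>\<Sum>x\<in>A. \<pi> x * (h x - k x)\<bar> \<le> d2" .
  have "(\<Sum>x\<in>A. pmf p x * h x) - (\<Sum>x\<in>A. \<pi> x * k x) = (\<Sum>x\<in>A. \<Delta> x * h x) + (\<Sum>x\<in>A. \<pi> x * (h x - k x))"
    by (simp add: \<Delta>_def algebra_simps sum.distrib sum_subtractf)
  then show ?thesis using 1 2 by linarith
qed

section \<open>Comparison of the two-stage sampler with the Gibbs distribution\<close>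

lemma sum_power_card_Pow:
  fixes lam :: real
  assumes "finite E"
  shows "(\<Sum>M\<in>Pow E. lam ^ card M) = (1 + lam) ^ card E"
  using assms
proof (induction E)
  case (insert x E)
  have "(\<Sum>M\<in>Pow (insert x E). lam ^ card M) =
      (\<Sum>M\<in>Pow E. lam ^ card M) + (\<Sum>M\<in>Pow E. lam ^ card (insert x M))"
    using sum_Pow_insert[OF insert(1,2), of "\<lambda>M. lam ^ card M" "{}"] by simp
  also have "(\<Sum>M\<in>Pow E. lam ^ card (insert x M)) = (\<Sum>M\<in>Pow E. lam * lam ^ card M)"
  proof (rule sum.cong[OF refl])
    fix M assume "M \<in> Pow E"
    then have "finite M" "x \<notin> M" using insert finite_subset by auto
    then show "lam ^ card (insert x M) = lam * lam ^ card M" by simp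
  qed
  finally show ?case using insert by (simp add: algebra_simps flip: sum_distrib_left)
qed simp

lemma sum_matchings_by_cover:
  fixes h :: "nat set set \<Rightarrow> real"
  assumes "simple_graph G"
  shows "(\<Sum>M | matching G M. h M) = (\<Sum>S\<in>Pow (verts G). \<Sum>M\<in>cover_matchings (edges G) S. h M)"
proof -
  have "(\<Sum>M | matching G M. h M) = (\<Sum>S\<in>Pow (verts G). \<Sum>M\<in>{M \<in> {M. matching G M}. \<Union>M = S}. h M)"
  proof (rule sum.group[symmetric, OF finite_matchings[OF assms]])
    show "finite (Pow (verts G))" using assms by (simp add: simple_graph_def)
    show "Union ` {M. matching G M} \<subseteq> Pow (verts G)"
      using assms unfolding simple_graph_def matching_def by blast
  qed
  moreover have "{M \<in> {M. matching G M}. \<Union>M = S} = cover_matchings (edges G) S" for S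
    by (auto simp: matching_def cover_matchings_def)
  ultimately show ?thesis by (simp only:)
qed

text \<open>The three terms are the distance of the walk from its own stationary law
  \<open>g / Zg\<close>, the distance of that law from the exact law of the covered set, and the
  error of sampling a matching given that set. Given the covered set, the Gibbs distribution is
  uniform, since all its matchings have equal size.\<close>

theorem walk_then_sample_tv:
  fixes G :: graph and lam \<epsilon> \<epsilon>' :: real
  assumes G: "simple_graph G" and ne: "verts G \<noteq> {}" and lam: "lam > 0"
    and es: "distinct es" "set es = edges G"
    and \<epsilon>: "0 \<le> \<epsilon>" "\<epsilon> \<le> 1 / 3" "\<epsilon> \<le> \<epsilon>'" "\<epsilon>' \<le> 1 / 2"
    and qb: "approximates (verts G) (edges G) \<epsilon> qb"
    and qa: "approximates (verts G) (edges G) \<epsilon>' qa"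
  defines "g \<equiv> \<lambda>S. if S \<subseteq> verts G then qb (induced_graph S (edges G)) * sqrt lam ^ card S else 0"
  shows "\<bar>measure_pmf.prob (bind_pmf (walk (verts G) g N) (\<lambda>S. map_pmf snd (sample_edges qa qb es (S, {})))) X -
      measure_pmf.prob (gibbs lam G) X\<bar> \<le>
    sqrt (2 * (1 + lam) ^ card (edges G) * exp (- (real N / (real (card (verts G)))\<^sup>2))) + \<epsilon> +
      real (card (edges G)) * \<epsilon>'"
proof -
  let ?V = "verts G" and ?E = "edges G"
  let ?w = "cover_weight lam ?E"
  define Z where "Z = (\<Sum>S\<in>Pow ?V. ?w S)"
  define Zg where "Zg = (\<Sum>S\<in>Pow ?V. g S)"
  have fin: "finite ?V" "finite ?E" using G finite_edges by (auto simp: simple_graph_def)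
  have finP: "finite (Pow ?V)" using fin by simp
  have two: "card e = 2" if "e \<in> ?E" for e using G that by (auto simp: simple_graph_def)
  have w: "?w S = real (card (cover_matchings ?E S)) * sqrt lam ^ card S" for S
    using cover_weight_eq_card[OF fin(2) two] lam by simp
  have w0: "?w S \<ge> 0" for S using lam by (simp add: cover_weight_nonneg)
  have lo: "(1 - \<epsilon>) * ?w S \<le> g S" and hi: "g S \<le> (1 + \<epsilon>) * ?w S" if S: "S \<subseteq> ?V" for S
  proof -
    have "(1 - \<epsilon>) * card (cover_matchings ?E S) * sqrt lam ^ card S \<le> qb (induced_graph S ?E) * sqrt lam ^ card S"
      "qb (induced_graph S ?E) * sqrt lam ^ card S \<le> (1 + \<epsilon>) * card (cover_matchings ?E S) * sqrt lam ^ card S"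
      using approximatesD[OF qb S subset_refl] lam by (auto intro!: mult_right_mono)
    then show "(1 - \<epsilon>) * ?w S \<le> g S" "g S \<le> (1 + \<epsilon>) * ?w S"
      using S by (simp_all add: w g_def mult.assoc)
  qed
  have lo': "2 / 3 * ?w S \<le> g S" and hi': "g S \<le> 4 / 3 * ?w S" if S: "S \<subseteq> ?V" for S
  proof -
    have "2 / 3 * ?w S \<le> (1 - \<epsilon>) * ?w S" by (rule mult_right_mono) (use \<epsilon> w0 in auto)
    moreover have "(1 + \<epsilon>) * ?w S \<le> 4 / 3 * ?w S" by (rule mult_right_mono) (use \<epsilon> w0 in auto)
    ultimately show "2 / 3 * ?w S \<le> g S" "g S \<le> 4 / 3 * ?w S" using lo[OF S] hi[OF S] by linarith+
  qed
  have g0: "g S \<ge> 0" for S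
  proof (cases "S \<subseteq> ?V")
    case True
    then show ?thesis using lo'[OF True] w0[of S] by linarith
  qed (simp add: g_def)
  have poinc: "pinned_variance g ?V {} f \<le> 2 * dirichlet_form g ?V {} f" for f
    by (rule poincare_perturbed[OF fin two _ g0 lo' hi']) (use lam in auto)
  have "cover_matchings ?E {} = {{}}"
  proof -
    have "M = {}" if "M \<subseteq> ?E" "\<Union>M = {}" for M
    proof (rule ccontr)
      assume "M \<noteq> {}"
      then obtain e where "e \<in> M" by blast
      then have "e = {}" "e \<in> ?E" using that by auto
      then show False using two[of e] by simp
    qed
    then show ?thesis by (auto simp: cover_matchings_def)
  qed
  then have w1: "?w {} = 1" by (simp add: w)
  have pos: "g {} \<ge> 2 / 3" using lo'[of "{}"] w1 by simp
  have Zsum: "Z = (\<Sum>M | matching G M. lam ^ card M)"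
    unfolding sum_matchings_by_cover[OF G] Z_def cover_weight_def ..
  have Zpf: "Z = partition_function lam G" unfolding Zsum partition_function_def ..
  have Zpos: "Z > 0" unfolding Zpf by (rule partition_function_pos[OF G lam])
  have "Z \<le> (\<Sum>M\<in>Pow ?E. lam ^ card M)"
    unfolding Zsum by (rule sum_mono2) (use fin lam in \<open>auto simp: matching_def\<close>)
  then have Zle: "Z \<le> (1 + lam) ^ card ?E" by (simp add: sum_power_card_Pow[OF fin(2)])
  have Zgle: "Zg \<le> 4 / 3 * Z"
    unfolding Zg_def Z_def sum_distrib_left using hi' by (intro sum_mono) auto
  \<comment> \<open>Accuracy 1/3 loses 4/3 in the total mass and 2/3 at the start; the quotient is
    the 2 of the final bound.\<close>
  have "Zg / g {} \<le> (4 / 3 * (1 + lam) ^ card ?E) / (2 / 3)"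
    using Zgle Zle pos lam by (intro frac_le) auto
  then have ratio: "Zg / g {} \<le> 2 * (1 + lam) ^ card ?E" by simp
  define d0 where "d0 = sqrt (2 * (1 + lam) ^ card ?E * exp (- (real N / (real (card ?V))\<^sup>2)))"
  have t1: "\<bar>measure_pmf.prob (walk ?V g N) X - (\<Sum>S\<in>Pow ?V. g S * indicator X S) / Zg\<bar> \<le> d0" for X
  proof -
    have "\<bar>measure_pmf.prob (walk ?V g N) X - (\<Sum>S\<in>Pow ?V. g S * indicator X S) / Zg\<bar> \<le>
        sqrt (Zg / g {} * exp (- (real N / (real (card ?V))\<^sup>2)))"
      unfolding Zg_def by (rule walk_tv[OF fin(1) ne g0 poinc]) (use pos in auto)
    also have "\<dots> \<le> d0"
      unfolding d0_def using ratio by (intro real_sqrt_le_mono mult_right_mono) auto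
    finally show ?thesis .
  qed
  \<comment> \<open>An event and its complement are treated as two points: pointwise accuracy passes
    to sums, hence to normalised probabilities.\<close>
  have t2: "\<bar>(\<Sum>S\<in>Pow ?V. g S * indicator X S) / Zg - (\<Sum>S\<in>Pow ?V. ?w S * indicator X S) / Z\<bar> \<le> \<epsilon>" for X
  proof -
    have split: "sum h (Pow ?V) = (\<Sum>S\<in>Pow ?V. h S * indicator X S) + (\<Sum>S\<in>Pow ?V. h S * indicator (- X) S)"
      for h :: "nat set \<Rightarrow> real"
      unfolding sum.distrib[symmetric] by (intro sum.cong) (auto simp: indicator_def)
    have ineq: "(1 - \<epsilon>) * (\<Sum>S\<in>Pow ?V. ?w S * indicator Y S) \<le> (\<Sum>S\<in>Pow ?V. g S * indicator Y S)"
      "(\<Sum>S\<in>Pow ?V. g S * indicator Y S) \<le> (1 + \<epsilon>) * (\<Sum>S\<in>Pow ?V. ?w S * indicator Y S)" for Y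
      unfolding sum_distrib_left mult.assoc[symmetric] using lo hi
      by (intro sum_mono mult_right_mono; simp)+
    show ?thesis
      unfolding Zg_def Z_def split[of g] split[of ?w]
    proof (rule two_point_perturbation)
      show "0 < (\<Sum>S\<in>Pow ?V. ?w S * indicator X S) + (\<Sum>S\<in>Pow ?V. ?w S * indicator (- X) S)"
        using Zpos unfolding Z_def split[of ?w] .
    qed (use \<epsilon> ineq in \<open>auto intro!: sum_nonneg mult_nonneg_nonneg w0\<close>)
  qed
  define \<pi> where "\<pi> = (\<lambda>S. ?w S / Z)"
  define h where "h = (\<lambda>S. measure_pmf.prob (map_pmf snd (sample_edges qa qb es (S, {}))) X)"
  define k where "k = (\<lambda>S. (\<Sum>M\<in>cover_matchings ?E S. indicator X ({} \<union> M)) / real (card (cover_matchings ?E S)))"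
  have supp: "set_pmf (walk ?V g N) \<subseteq> Pow ?V"
    using walk_mixing(1)[OF fin(1) ne g0 poinc, of N] pos by auto
  have "\<bar>(\<Sum>S\<in>Pow ?V. pmf (walk ?V g N) S * h S) - (\<Sum>S\<in>Pow ?V. \<pi> S * k S)\<bar> \<le>
      (d0 + \<epsilon>) + real (card ?E) * \<epsilon>'"
  proof (rule mixture_diff_le[OF finP supp])
    show "\<pi> S \<ge> 0" for S using w0[of S] Zpos by (simp add: \<pi>_def)
    show "sum \<pi> (Pow ?V) = 1" using Zpos by (simp add: \<pi>_def Z_def flip: sum_divide_distrib)
    show "\<bar>measure_pmf.prob (walk ?V g N) Y - (\<Sum>S\<in>Pow ?V. \<pi> S * indicator Y S)\<bar> \<le> d0 + \<epsilon>" for Y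
    proof -
      have "(\<Sum>S\<in>Pow ?V. \<pi> S * indicator Y S) = (\<Sum>S\<in>Pow ?V. ?w S * indicator Y S) / Z"
        unfolding sum_divide_distrib by (simp only: \<pi>_def times_divide_eq_left)
      then show ?thesis using t1[of Y] t2[of Y] by linarith
    qed
    show "\<bar>h S - k S\<bar> \<le> real (card ?E) * \<epsilon>'" if S: "S \<in> Pow ?V" and p: "\<pi> S > 0" for S
    proof -
      have "cover_matchings ?E S \<noteq> {}" using p by (auto simp: \<pi>_def w)
      moreover have "length es = card ?E" using es distinct_card by fastforce
      moreover have "approximates ?V ?E \<epsilon>' qb"
        unfolding approximates_def
      proof (intro allI impI)
        fix W D assume "W \<subseteq> ?V" "D \<subseteq> ?E"
        moreover have "(1 - \<epsilon>') * card (cover_matchings D W) \<le> (1 - \<epsilon>) * card (cover_matchings D W)"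
          "(1 + \<epsilon>) * card (cover_matchings D W) \<le> (1 + \<epsilon>') * card (cover_matchings D W)"
          using \<epsilon> by (auto intro!: mult_right_mono)
        ultimately show "(1 - \<epsilon>') * card (cover_matchings D W) \<le> qb (induced_graph W D) \<and>
            qb (induced_graph W D) \<le> (1 + \<epsilon>') * card (cover_matchings D W)"
          using approximatesD[OF qb, of W D] by linarith
      qed
      ultimately show ?thesis
        using sample_edges_tv[of es ?E S ?V \<epsilon>' qa qb "{}" X] es fin S \<epsilon> qa
        by (simp add: h_def k_def)
    qed
  qed (auto simp: h_def)
  also have "(\<Sum>S\<in>Pow ?V. pmf (walk ?V g N) S * h S) =
      measure_pmf.prob (bind_pmf (walk ?V g N) (\<lambda>S. map_pmf snd (sample_edges qa qb es (S, {})))) X"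
    unfolding h_def by (rule prob_bind_finite[OF finP supp, symmetric])
  also have "(\<Sum>S\<in>Pow ?V. \<pi> S * k S) = measure_pmf.prob (gibbs lam G) X"
  proof -
    have "\<pi> S * k S = (\<Sum>M\<in>cover_matchings ?E S. pmf (gibbs lam G) M * indicator X M)" if "S \<in> Pow ?V" for S
    proof (cases "cover_matchings ?E S = {}")
      case True
      then show ?thesis by (simp add: k_def)
    next
      case False
      then have c: "real (card (cover_matchings ?E S)) > 0"
        by (simp add: card_gt_0_iff finite_cover_matchings fin)
      have pg: "pmf (gibbs lam G) M = sqrt lam ^ card S / Z" if M: "M \<in> cover_matchings ?E S" for M
      proof -
        have "card S = 2 * card M"
          using card_Union_matching[of M] M two fin(2) finite_subset[of M ?E]
          by (auto simp: cover_matchings_def)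
        then have "lam ^ card M = sqrt lam ^ card S" using lam by (simp add: power_mult)
        moreover have "matching G M" using M by (simp add: matching_def cover_matchings_def)
        ultimately show ?thesis unfolding pmf_gibbs[OF G lam] Zpf by simp
      qed
      have "(\<Sum>M\<in>cover_matchings ?E S. pmf (gibbs lam G) M * indicator X M) =
          (\<Sum>M\<in>cover_matchings ?E S. sqrt lam ^ card S / Z * indicator X M)"
        by (rule sum.cong[OF refl]) (simp only: pg)
      also have "\<dots> = sqrt lam ^ card S / Z * (\<Sum>M\<in>cover_matchings ?E S. indicator X M)"
        by (rule sum_distrib_left[symmetric])
      finally show ?thesis using c by (simp add: \<pi>_def k_def w)
    qed
    then have "(\<Sum>S\<in>Pow ?V. \<pi> S * k S) =
        (\<Sum>S\<in>Pow ?V. \<Sum>M\<in>cover_matchings ?E S. pmf (gibbs lam G) M * indicator X M)"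
      by (rule sum.cong[OF refl])
    also have "\<dots> = (\<Sum>M | matching G M. pmf (gibbs lam G) M * indicator X M)"
      by (rule sum_matchings_by_cover[OF G, symmetric])
    also have "\<dots> = measure_pmf.prob (gibbs lam G) X"
      by (rule prob_finite_support[symmetric, OF finite_matchings[OF G]])
        (auto simp: set_pmf_iff pmf_gibbs[OF G lam] split: if_splits)
    finally show ?thesis .
  qed
  finally show ?thesis by (simp add: d0_def)
qed

section \<open>The program\<close>

primrec kernel_iter :: "(nat \<Rightarrow> 'a \<Rightarrow> 'a pmf) \<Rightarrow> nat \<Rightarrow> 'a \<Rightarrow> 'a pmf" where
  "kernel_iter K 0 a = return_pmf a"
| "kernel_iter K (Suc N) a = bind_pmf (kernel_iter K N a) (K N)"

lemma kernel_iter_front: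
  "kernel_iter K (Suc N) a = bind_pmf (K 0 a) (kernel_iter (\<lambda>i. K (Suc i)) N)"
proof (induction N)
  case 0
  show ?case by (simp add: bind_return_pmf bind_return_pmf')
next
  case (Suc N)
  have "kernel_iter K (Suc (Suc N)) a = bind_pmf (kernel_iter K (Suc N) a) (K (Suc N))" by simp
  also have "\<dots> = bind_pmf (K 0 a) (kernel_iter (\<lambda>i. K (Suc i)) (Suc N))"
    unfolding Suc.IH bind_assoc_pmf by (rule bind_pmf_cong) simp_all
  finally show ?case .
qed

lemma kernel_iter_edge_choice:
  "kernel_iter (\<lambda>j. edge_choice qa qb (es ! j) (set (drop (Suc j) es))) (length es) s =
    sample_edges qa qb es s"
proof (induction es arbitrary: s)
  case (Cons e es)
  show ?case
    unfolding list.size(4) add_Suc_right add_0_right kernel_iter_front sample_edges.simps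
    by (rule bind_pmf_cong) (simp_all add: Cons.IH)
qed simp

text \<open>The loop rule of the refinement proof: \<open>R j\<close> relates machine states to
  abstract states after \<open>j\<close> rounds, and each round of the body simulates one abstract
  kernel.\<close>

lemma rel_pmf_funpow_bind:
  assumes "R 0 s a"
    and "\<And>j s a. j < N \<Longrightarrow> R j s a \<Longrightarrow> rel_pmf (R (Suc j)) (F s) (K j a)"
  shows "rel_pmf (R N) (((\<lambda>p. bind_pmf p F) ^^ N) (return_pmf s)) (kernel_iter K N a)"
  using assms
proof (induction N)
  case (Suc N)
  have "rel_pmf (R N) (((\<lambda>p. bind_pmf p F) ^^ N) (return_pmf s)) (kernel_iter K N a)"
    by (rule Suc.IH) (use Suc.prems in auto)
  then have "rel_pmf (R (Suc N)) (bind_pmf (((\<lambda>p. bind_pmf p F) ^^ N) (return_pmf s)) F)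
      (bind_pmf (kernel_iter K N a) (K N))"
    by (rule rel_pmf_bindI) (use Suc.prems in auto)
  then show ?case by simp
qed simp

lemma rel_pmf_bind_same:
  assumes "\<And>b. rel_pmf R (f b) (h b)"
  shows "rel_pmf R (bind_pmf B f) (bind_pmf B h)"
  by (rule rel_pmf_bindI[where R = "(=)"]) (use assms in \<open>auto simp: pmf.rel_eq\<close>)

lemma rel_pmf_map_eq:
  assumes "rel_pmf R p q" "\<And>x y. R x y \<Longrightarrow> f x = h y"
  shows "map_pmf f p = map_pmf h q"
proof -
  have "rel_pmf (\<lambda>x y. f x = h y) p q" using assms by (rule pmf.rel_mono_strong)
  then have "rel_pmf (=) (map_pmf f p) (map_pmf h q)" by (simp add: pmf.rel_map)
  then show ?thesis by (simp add: pmf.rel_eq)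
qed

text \<open>Reservoir sampling. The machine only tosses coins, so a uniform index is obtained by
  letting candidate \<open>j\<close> replace the current one with probability
  \<open>1 / (j + 1)\<close>.\<close>

definition reservoir_step :: "nat \<Rightarrow> nat \<Rightarrow> nat pmf" where
  "reservoir_step j i = bind_pmf (bernoulli_pmf (1 / (1 + real j))) (\<lambda>b. return_pmf (if b then j else i))"

text \<open>The first coin has bias 1 and overwrites the initial value. Later on, an old index
  survives with probability \<open>1 / (N + 1) * (1 - 1 / (N + 2)) = 1 / (N + 2)\<close>, the same
  as the new one.\<close>

lemma kernel_iter_reservoir: "kernel_iter reservoir_step (Suc N) i = pmf_of_set {..<Suc N}"
proof (induction N)
  case 0
  have "reservoir_step 0 i = return_pmf 0"
  proof (rule pmf_eqI)
    fix x show "pmf (reservoir_step 0 i) x = pmf (return_pmf 0) x"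
      unfolding reservoir_step_def pmf_bind by (simp add: indicator_def)
  qed
  then show ?case by (simp add: bind_return_pmf pmf_of_set_singleton lessThan_Suc)
next
  case (Suc N)
  let ?a = "1 / (1 + real (Suc N))"
  have a: "0 \<le> ?a" "?a \<le> 1" by simp_all
  show ?case
  proof (rule pmf_eqI)
    fix x
    have "pmf (kernel_iter reservoir_step (Suc (Suc N)) i) x =
        pmf (bind_pmf (pmf_of_set {..<Suc N}) (reservoir_step (Suc N))) x"
      using Suc.IH by simp
    also have "\<dots> = (\<Sum>y<Suc N. pmf (reservoir_step (Suc N) y) x) / real (Suc N)"
      by (subst pmf_bind_pmf_of_set) auto
    also have "\<dots> = (\<Sum>y<Suc N. ?a * of_bool (x = Suc N) + (1 - ?a) * of_bool (x = y)) / real (Suc N)"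
    proof -
      have "pmf (reservoir_step (Suc N) y) x = ?a * of_bool (x = Suc N) + (1 - ?a) * of_bool (x = y)" for y
        unfolding reservoir_step_def pmf_bind integral_bernoulli_pmf[OF a] by (auto simp: indicator_def)
      then show ?thesis by simp
    qed
    also have "\<dots> = ?a * of_bool (x = Suc N) + (1 - ?a) * of_bool (x < Suc N) / real (Suc N)"
    proof -
      have "(\<Sum>y<Suc N. of_bool (x = y)) = (of_bool (x < Suc N) :: real)"
        by (auto simp: of_bool_def sum.delta' cong: if_cong)
      then have "(\<Sum>y<Suc N. ?a * of_bool (x = Suc N) + (1 - ?a) * of_bool (x = y)) =
          real (Suc N) * (?a * of_bool (x = Suc N)) + (1 - ?a) * of_bool (x < Suc N)"
        by (simp only: sum.distrib sum_distrib_left[symmetric] sum_constant card_lessThan) (simp only: mult_ac)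
      then show ?thesis by (simp only: add_divide_distrib) simp
    qed
    also have "\<dots> = pmf (pmf_of_set {..<Suc (Suc N)}) x"
    proof -
      have "1 - ?a = real (Suc N) * ?a" by (simp add: diff_divide_eq_iff)
      then have "(1 - ?a) / real (Suc N) = ?a" by simp
      moreover have "pmf (pmf_of_set {..<Suc (Suc N)}) x = of_bool (x < Suc (Suc N)) * ?a"
        by (subst pmf_of_set) (auto simp: indicator_def)
      ultimately show ?thesis
        by (cases "x < Suc N"; cases "x = Suc N") auto
    qed
    finally show "pmf (kernel_iter reservoir_step (Suc (Suc N)) i) x = pmf (pmf_of_set {..<Suc (Suc N)}) x" .
  qed
qed

text \<open>
  Scratch cells, all at index 0: natural arrays 6 (loop counter), 7 (last coin), 8 and 9 (two vertex
  positions), and real arrays 1 and 2 (oracle answers).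
\<close>

abbreviation scalar :: "nat \<Rightarrow> nexp" where "scalar a \<equiv> NGet a (Num 0)"

text \<open>The counter is incremented before use: in round \<open>j\<close> it holds
  \<open>j + 1\<close>, whose reciprocal is the bias, and the stored candidate is the counter minus
  1.\<close>

definition pick_index :: "nat \<Rightarrow> program" where
  "pick_index a = Seq (NSet 6 (Num 0) (Num 0)) (Repeat (OfNat (scalar 0))
     (Seq (NSet 6 (Num 0) (NAdd (scalar 6) (Num 1)))
     (Seq (Flip 7 (Num 0) (RDiv (OfNat (Num 1)) (OfNat (scalar 6))))
     (Cond (NLe (Num 1) (scalar 7)) (NSet a (Num 0) (NSub (scalar 6) (Num 1))) Skip))))"

definition toggle_flag :: "nat \<Rightarrow> program" where
  "toggle_flag a = NSet 3 (scalar a) (NSub (Num 1) (NGet 3 (scalar a)))"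

definition both_flagged :: bexp where
  "both_flagged = BAnd (NLe (Num 1) (NGet 3 (scalar 8))) (NLe (Num 1) (NGet 3 (scalar 9)))"

text \<open>
  Only the ratio of the weights of \<open>S\<close> and of the proposed set matters, so the factor
  \<open>lam ^ (|S| / 2)\<close> may be replaced by \<open>lam\<close> if both chosen vertices lie in \<open>S\<close> and by 1 otherwise.
\<close>

definition query_weight :: "nat \<Rightarrow> program" where
  "query_weight r = Seq (Query True r (Num 0))
     (Cond both_flagged (RSet r (Num 0) (RMul (RGet 0 (Num 0)) (RGet r (Num 0)))) Skip)"

text \<open>The proposed set is written into the flags before it is queried, so a rejection has to
  toggle both flags back. Each step of the walk makes two queries.\<close>

definition walk_tail :: program where
  "walk_tail = Seq (query_weight 1) (Seq (toggle_flag 8) (Seq (toggle_flag 9) (Seq (query_weight 2)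
     (Seq (Flip 7 (Num 0) (RDiv (RGet 2 (Num 0)) (RAdd (RGet 1 (Num 0)) (RGet 2 (Num 0)))))
     (Cond (NLe (Num 1) (scalar 7)) Skip (Seq (toggle_flag 8) (toggle_flag 9)))))))"

definition walk_body :: program where
  "walk_body = Seq (pick_index 8) (Seq (pick_index 9) walk_tail)"

definition flag_edges :: program where
  "flag_edges = Seq (NSet 6 (Num 0) (Num 0)) (Repeat (OfNat (NGet 0 (Num 1)))
     (Seq (NSet 4 (scalar 6) (Num 1)) (NSet 6 (Num 0) (NAdd (scalar 6) (Num 1)))))"

text \<open>The flag of the current edge is cleared first, so that queries see exactly the later
  edges. If an end point is no longer available, the coarse oracle is still asked once, which keeps
  its number of calls at exactly \<open>m\<close>.\<close>

definition sample_body :: program where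
  "sample_body = Seq (NSet 8 (Num 0) (NGet 1 (scalar 6))) (Seq (NSet 9 (Num 0) (NGet 2 (scalar 6)))
     (Seq (NSet 4 (scalar 6) (Num 0)) (Seq (Query True 2 (Num 0))
     (Seq (Cond both_flagged
        (Seq (toggle_flag 8) (Seq (toggle_flag 9) (Seq (Query False 1 (Num 0))
        (Seq (Flip 7 (Num 0) (RDiv (RGet 1 (Num 0)) (RAdd (RGet 1 (Num 0)) (RGet 2 (Num 0)))))
        (Cond (NLe (Num 1) (scalar 7)) (NSet 5 (scalar 6) (Num 1)) (Seq (toggle_flag 8) (toggle_flag 9)))))))
        (Query False 1 (Num 0)))
     (NSet 6 (Num 0) (NAdd (scalar 6) (Num 1)))))))"

text \<open>Eight times \<open>walk_length\<close>, its factor 1/2 absorbed into the literal 4. The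
  8 makes the exponent \<open>N / n\<^sup>2\<close> at least
  \<open>4 * (m * ln (1 + lam) + ln (3 / \<delta>))\<close>.\<close>

definition walk_count :: rexp where
  "walk_count = RMul (RMul (RMul (OfNat (Num 4)) (OfNat (scalar 0))) (OfNat (scalar 0)))
     (RAdd (RMul (OfNat (NGet 0 (Num 1))) (RLn (RAdd (OfNat (Num 1)) (RGet 0 (Num 0)))))
       (RLn (RDiv (OfNat (Num 3)) (RGet 0 (Num 1)))))"

text \<open>The guard separates the trivial inputs: for \<open>\<delta> \<ge> 1\<close> every output
  is close enough, and without edges only the empty matching exists. There the program outputs the
  empty matching and just makes its \<open>m\<close> calls.\<close>

definition sampler :: program where
  "sampler = Cond (BAnd (BNot (RLe (OfNat (Num 1)) (RGet 0 (Num 1)))) (NLe (Num 1) (NGet 0 (Num 1))))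
     (Seq flag_edges (Seq (Repeat walk_count walk_body)
       (Seq (NSet 6 (Num 0) (Num 0)) (Repeat (OfNat (NGet 0 (Num 1))) sample_body))))
     (Repeat (OfNat (NGet 0 (Num 1))) (Query False 1 (Num 0)))"

section \<open>Correctness of the program\<close>

definition frame :: "nat set \<Rightarrow> state \<Rightarrow> state \<Rightarrow> bool" where
  "frame A s s' \<longleftrightarrow> (\<forall>a. a \<notin> A \<longrightarrow> nmem s' a = nmem s a) \<and> rmem s' = rmem s \<and> queries s' = queries s"

lemma exec_Repeat_nat:
  "exec P orc (Repeat (OfNat e) c) s =
    ((\<lambda>p. bind_pmf p (\<lambda>s. exec P orc c (tick s))) ^^ nval e s) (return_pmf (tick s))"
  by simp

text \<open>The cost is 5 per round (loop, increment, coin, branch test, branch) plus 2 for the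
  initial assignment and the loop entry. Both branches take one step, so it is exact.\<close>

lemma pick_index_correct:
  assumes "nmem s 0 0 = Suc N" "a \<notin> {0, 6, 7}"
  shows "rel_pmf (\<lambda>s' i. frame {6, 7, a} s s' \<and> nmem s' a 0 = i \<and> i < Suc N \<and> steps s' = steps s + 5 * Suc N + 2)
    (exec P orc (pick_index a) s) (pmf_of_set {..<Suc N})"
proof -
  define s0 where "s0 = tick (tick (nupd 6 0 0 s))"
  define R where "R = (\<lambda>j s' i. frame {6, 7, a} s s' \<and> nmem s' 6 0 = j \<and> nmem s' a 0 = i \<and>
    steps s' = steps s + 5 * j + 2)"
  define F where "F = (\<lambda>s. exec P orc (Seq (NSet 6 (Num 0) (NAdd (scalar 6) (Num 1)))
     (Seq (Flip 7 (Num 0) (RDiv (OfNat (Num 1)) (OfNat (scalar 6))))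
     (Cond (NLe (Num 1) (scalar 7)) (NSet a (Num 0) (NSub (scalar 6) (Num 1))) Skip))) (tick s))"
  have "exec P orc (pick_index a) s = ((\<lambda>p. bind_pmf p F) ^^ Suc N) (return_pmf s0)"
    unfolding pick_index_def exec.simps(2,4) bind_return_pmf exec_Repeat_nat F_def s0_def
    using assms by (simp add: tick_def nupd_def del: funpow.simps exec.simps)
  moreover have "rel_pmf (R (Suc N)) (((\<lambda>p. bind_pmf p F) ^^ Suc N) (return_pmf s0))
      (kernel_iter reservoir_step (Suc N) (nmem s a 0))"
  proof (rule rel_pmf_funpow_bind)
    show "R 0 s0 (nmem s a 0)"
      using assms by (simp add: R_def s0_def frame_def tick_def nupd_def)
  next
    fix j s' i assume R: "R j s' i"
    show "rel_pmf (R (Suc j)) (F s') (reservoir_step j i)"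
      unfolding F_def reservoir_step_def exec.simps bind_return_pmf map_pmf_def bind_assoc_pmf
    proof (simp add: bind_return_pmf tick_def nupd_def, goal_cases)
      case 1
      have e: "nmem s' 6 0 = j" using R by (simp add: R_def)
      show ?case
        unfolding e
        by (rule rel_pmf_bind_same) (use R assms in \<open>auto simp: R_def frame_def tick_def nupd_def\<close>)
    qed
  qed
  ultimately have "rel_pmf (R (Suc N)) (exec P orc (pick_index a) s) (pmf_of_set {..<Suc N})"
    by (simp only: kernel_iter_reservoir)
  moreover have "set_pmf (pmf_of_set {..<Suc N}) = {..<Suc N}" by (rule set_pmf_of_set) auto
  ultimately show ?thesis
    by (elim pmf.rel_mono_strong) (auto simp: R_def)
qed

section \<open>Effect of the elementary programs on the state\<close>

definition flip_flag :: "nat \<Rightarrow> state \<Rightarrow> state" where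
  "flip_flag i s = tick (nupd 3 i (1 - nmem s 3 i) s)"

lemma exec_toggle_flag: "exec P orc (toggle_flag a) s = return_pmf (flip_flag (nmem s a 0) s)"
  by (simp add: toggle_flag_def flip_flag_def)

lemma flip_flag_sel:
  "nmem (flip_flag i s) a = (if a = 3 then (nmem s 3)(i := 1 - nmem s 3 i) else nmem s a)"
  "rmem (flip_flag i s) = rmem s" "queries (flip_flag i s) = queries s"
  "steps (flip_flag i s) = Suc (steps s)"
  by (simp_all add: flip_flag_def tick_def nupd_def)

lemma tick_sel: "nmem (tick s) = nmem s" "rmem (tick s) = rmem s" "queries (tick s) = queries s"
  "steps (tick s) = Suc (steps s)"
  by (simp_all add: tick_def)

lemma nupd_sel: "nmem (nupd a i x s) = (nmem s)(a := (nmem s a)(i := x))" "rmem (nupd a i x s) = rmem s"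
  "queries (nupd a i x s) = queries s" "steps (nupd a i x s) = steps s"
  by (simp_all add: nupd_def)

lemma rupd_sel: "rmem (rupd a i x s) = (rmem s)(a := (rmem s a)(i := x))" "nmem (rupd a i x s) = nmem s"
  "queries (rupd a i x s) = queries s" "steps (rupd a i x s) = steps s"
  by (simp_all add: rupd_def)

lemmas state_sel = flip_flag_sel tick_sel nupd_sel rupd_sel

text \<open>A query merged with a rescaling of its answer by \<open>x\<close>, which is 1 for a
  plain query.\<close>

definition ask :: "presentation \<Rightarrow> (bool \<Rightarrow> graph \<Rightarrow> real) \<Rightarrow> bool \<Rightarrow> nat \<Rightarrow> real \<Rightarrow> state \<Rightarrow> state" where
  "ask P orc b r x s = (rupd r 0 (x * orc b (flagged_graph P s)) s)
     \<lparr>queries := queries s @ [(b, flagged_graph P s)], steps := steps s + 1\<rparr>"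

lemma ask_sel: "nmem (ask P orc b r x s) = nmem s"
  "rmem (ask P orc b r x s) = (rmem s)(r := (rmem s r)(0 := x * orc b (flagged_graph P s)))"
  "queries (ask P orc b r x s) = queries s @ [(b, flagged_graph P s)]"
  "steps (ask P orc b r x s) = Suc (steps s)"
  by (simp_all add: ask_def rupd_def)

lemma exec_Query: "exec P orc (Query b r (Num 0)) s = return_pmf (ask P orc b r 1 s)"
  by (simp add: ask_def tick_def rupd_def Let_def)

lemma exec_query_weight:
  assumes "r \<noteq> 0"
  shows "exec P orc (query_weight r) s = return_pmf (tick (tick (ask P orc True r
    (if nmem s 3 (nmem s 8 0) \<noteq> 0 \<and> nmem s 3 (nmem s 9 0) \<noteq> 0 then rmem s 0 0 else 1) s)))"
  using assms
  by (auto simp: query_weight_def both_flagged_def bind_return_pmf tick_def rupd_def Let_def ask_def)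

lemma calls_append: "queries s' = queries s @ [(b, K)] \<Longrightarrow> calls c s' = calls c s + of_bool (b = c)"
  by (auto simp: calls_def)

lemma calls_cong: "queries s' = queries s \<Longrightarrow> calls c s' = calls c s"
  by (simp add: calls_def)

text \<open>The common factor \<open>\<kappa>\<close> is determined by \<open>R\<close>, the part of
  \<open>W\<close> away from \<open>u\<close> and \<open>v\<close>. If both vertices switch the same
  way, one of the two sets has two extra vertices, worth \<open>lam\<close>; if they switch in
  opposite ways, the sizes agree.\<close>

lemma vertex_weight_ratio:
  fixes lam :: real and u v :: 'a
  assumes "finite W" "lam > 0"
  defines "c \<equiv> \<lambda>S. if u \<in> S \<and> v \<in> S then lam else 1"
  obtains \<kappa> where "\<kappa> > 0" "sqrt lam ^ card W = \<kappa> * c W"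
    "sqrt lam ^ card (toggle v (toggle u W)) = \<kappa> * c (toggle v (toggle u W))"
proof (cases "u = v")
  case True
  have "c W > 0" using assms by (simp add: c_def)
  then show ?thesis
    using that[of "sqrt lam ^ card W / c W"] assms(2) True by (simp add: toggle_toggle)
next
  case False
  define R where "R = W - {u, v}"
  have R: "finite R" "u \<notin> R" "v \<notin> R" using assms by (auto simp: R_def)
  have sq: "sqrt lam * (sqrt lam * x) = lam * x" for x
    using assms by (simp flip: mult.assoc)
  consider "u \<in> W" "v \<in> W" | "u \<in> W" "v \<notin> W" | "u \<notin> W" "v \<in> W" | "u \<notin> W" "v \<notin> W" by blast
  then show ?thesis
  proof cases
    case 1
    then have "W = insert u (insert v R)" "toggle v (toggle u W) = R"
      using False by (auto simp: R_def toggle_def)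
    then show ?thesis using that[of "sqrt lam ^ card R"] R False assms by (simp add: c_def sq)
  next
    case 2
    then have "W = insert u R" "toggle v (toggle u W) = insert v R"
      using False by (auto simp: R_def toggle_def)
    then show ?thesis using that[of "sqrt lam ^ Suc (card R)"] R False assms by (simp add: c_def)
  next
    case 3
    then have "W = insert v R" "toggle v (toggle u W) = insert u R"
      using False by (auto simp: R_def toggle_def)
    then show ?thesis using that[of "sqrt lam ^ Suc (card R)"] R False assms by (simp add: c_def)
  next
    case 4
    then have "W = R" "toggle v (toggle u W) = insert u (insert v R)"
      using False by (auto simp: R_def toggle_def)
    then show ?thesis using that[of "sqrt lam ^ card R"] R False assms by (simp add: c_def sq)
  qed
qed

lemma presents_length_edges:
  assumes "presents P G"
  shows "length (snd P) = card (edges G)"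
proof -
  have "card (nth_edge P ` {..<length (snd P)}) = length (snd P)"
    using assms by (subst card_image) (auto simp: presents_def)
  then show ?thesis using assms by (simp add: presents_def)
qed

text \<open>The oracles are arbitrary here: the locale only relates machine runs to the abstract
  process, and accuracy enters later.\<close>

locale sampler_run =
  fixes P :: presentation and G :: graph and lam \<delta> :: real and orc :: "bool \<Rightarrow> graph \<Rightarrow> real"
  assumes pres: "presents P G" and G: "simple_graph G" and lam: "lam > 0" and ne: "verts G \<noteq> {}"
begin

abbreviation (input) vtx :: "nat \<Rightarrow> nat" where "vtx i \<equiv> fst P ! i"

abbreviation (input) nV :: nat where "nV \<equiv> length (fst P)"

abbreviation (input) nE :: nat where "nE \<equiv> length (snd P)"

definition vflags :: "state \<Rightarrow> nat set" where
  "vflags s = {vtx i | i. i < nV \<and> nmem s 3 i \<noteq> 0}"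

definition eflags :: "state \<Rightarrow> nat set set" where
  "eflags s = {nth_edge P k | k. k < nE \<and> nmem s 4 k \<noteq> 0}"

definition input_ok :: "state \<Rightarrow> bool" where
  "input_ok s \<longleftrightarrow> nmem s 0 0 = nV \<and> nmem s 0 1 = nE \<and>
     (\<forall>k<nE. nmem s 1 k = fst (snd P ! k) \<and> nmem s 2 k = snd (snd P ! k)) \<and>
     rmem s 0 0 = lam \<and> rmem s 0 1 = \<delta>"

lemma flagged_graph_eq: "flagged_graph P s = induced_graph (vflags s) (eflags s)"
proof -
  have "{nth_edge P k | k. A k \<and> B k \<and> nth_edge P k \<subseteq> W} = {e \<in> {nth_edge P k | k. A k \<and> B k}. e \<subseteq> W}"
    for A B W by blast
  then show ?thesis by (simp only: flagged_graph_def induced_graph_def vflags_def eflags_def Let_def)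
qed

lemma vflags_cong: "nmem s' 3 = nmem s 3 \<Longrightarrow> vflags s' = vflags s"
  by (simp add: vflags_def)

lemma eflags_cong: "nmem s' 4 = nmem s 4 \<Longrightarrow> eflags s' = eflags s"
  by (simp add: eflags_def)

lemma output_edges_cong: "nmem s' 5 = nmem s 5 \<Longrightarrow> output_edges P s' = output_edges P s"
  by (simp add: output_edges_def)

lemma input_ok_cong:
  "nmem s' 0 = nmem s 0 \<Longrightarrow> nmem s' 1 = nmem s 1 \<Longrightarrow> nmem s' 2 = nmem s 2 \<Longrightarrow> rmem s' 0 = rmem s 0 \<Longrightarrow>
    input_ok s' = input_ok s"
  by (simp add: input_ok_def)

lemma verts_eq: "verts G = set (fst P)" and dist: "distinct (fst P)"
  using pres unfolding presents_def by simp_all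

lemma length_verts: "nV = card (verts G)"
  unfolding verts_eq by (rule distinct_card[OF dist, symmetric])

lemma length_edges: "nE = card (edges G)"
  by (rule presents_length_edges[OF pres])

lemma vtx_mem_vflags: "i < nV \<Longrightarrow> vtx i \<in> vflags s \<longleftrightarrow> nmem s 3 i \<noteq> 0"
  unfolding vflags_def mem_Collect_eq using nth_eq_iff_index_eq[OF dist] by blast

lemma vflags_subset: "vflags s \<subseteq> verts G"
  unfolding verts_eq vflags_def by auto

lemma vflags_flip_flag:
  assumes i: "i < nV"
  shows "vflags (flip_flag i s) = toggle (vtx i) (vflags s)"
proof (rule set_eqI)
  fix x
  show "x \<in> vflags (flip_flag i s) \<longleftrightarrow> x \<in> toggle (vtx i) (vflags s)"
  proof (cases "\<exists>k<nV. x = vtx k")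
    case True
    then obtain k where k: "k < nV" "x = vtx k" by blast
    have "x = vtx i \<longleftrightarrow> k = i" using k i dist by (simp add: nth_eq_iff_index_eq)
    then show ?thesis
      unfolding toggle_iff k(2) vtx_mem_vflags[OF k(1)] by (auto simp: flip_flag_sel)
  next
    case False
    then show ?thesis using i by (auto simp: vflags_def toggle_iff)
  qed
qed

lemma edge_endpoints:
  assumes "k < nE"
  shows "fst (snd P ! k) < nV" "snd (snd P ! k) < nV"
    "nth_edge P k = {vtx (fst (snd P ! k)), vtx (snd (snd P ! k))}"
    "vtx (fst (snd P ! k)) \<noteq> vtx (snd (snd P ! k))" "nth_edge P k \<in> edges G"
proof -
  have "snd P ! k \<in> set (snd P)" using assms by simp
  moreover have "\<forall>(i, j)\<in>set (snd P). i < nV \<and> j < nV"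
    using pres by (simp add: presents_def)
  ultimately show "fst (snd P ! k) < nV" "snd (snd P ! k) < nV"
    by (auto simp: split_beta)
  show e: "nth_edge P k = {vtx (fst (snd P ! k)), vtx (snd (snd P ! k))}"
    by (simp add: nth_edge_def split_beta)
  show mem: "nth_edge P k \<in> edges G" using pres assms by (auto simp: presents_def)
  then have "card (nth_edge P k) = 2" using G by (auto simp: simple_graph_def)
  then show "vtx (fst (snd P ! k)) \<noteq> vtx (snd (snd P ! k))" unfolding e by auto
qed

lemma pmf_of_set_verts: "pmf_of_set (verts G) = map_pmf ((!) (fst P)) (pmf_of_set {..<nV})"
proof -
  have "bij_betw ((!) (fst P)) {..<nV} (verts G)"
    using dist verts_eq by (simp add: bij_betw_nth)
  moreover have "nV > 0" using ne verts_eq by auto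
  ultimately show ?thesis
    by (subst map_pmf_of_set_bij_betw) auto
qed

definition oracle_weight :: "nat set \<Rightarrow> real" where
  "oracle_weight S = (if S \<subseteq> verts G then orc True (induced_graph S (edges G)) * sqrt lam ^ card S else 0)"

text \<open>Steps are only bounded by \<open>c\<close>, because accepting and rejecting a move take
  different numbers of steps; calls are counted exactly.\<close>

definition walk_inv :: "nat \<Rightarrow> nat \<Rightarrow> state \<Rightarrow> nat set \<Rightarrow> bool" where
  "walk_inv q c s W \<longleftrightarrow> input_ok s \<and> vflags s = W \<and> eflags s = edges G \<and> output_edges P s = {} \<and>
     calls True s = q \<and> calls False s = 0 \<and> steps s \<le> c"

lemma walk_inv_frame:
  assumes "frame {6, 7, a} s s'" "a \<in> {8, 9}" "walk_inv q c s W" "steps s' \<le> c'"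
  shows "walk_inv q c' s' W"
proof -
  have n: "nmem s' b = nmem s b" if "b \<in> {0, 1, 2, 3, 4, 5}" for b
    using assms(1,2) that by (auto simp: frame_def)
  have r: "rmem s' = rmem s" "queries s' = queries s" using assms(1) by (auto simp: frame_def)
  show ?thesis
    using assms(3,4) n r input_ok_cong[of s' s] vflags_cong[of s' s] eflags_cong[of s' s]
      output_edges_cong[of s' s] calls_cong[of s' s] by (simp add: walk_inv_def)
qed

text \<open>The machine's weights differ from \<open>oracle_weight\<close> by a common factor, which
  cancels in the bias of the coin. The 12 steps are 3 for each weighted query, 2 toggles, the coin,
  the branch test and at most 2 more toggles, for a rejection.\<close>

lemma walk_tail_correct:
  assumes inv: "walk_inv q c s W" and i: "nmem s 8 0 = i" "i < nV"
    and j: "nmem s 9 0 = j" "j < nV"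
  shows "rel_pmf (walk_inv (q + 2) (c + 12))
    (exec P orc walk_tail s)
    (walk_move oracle_weight (vtx i) (vtx j) W)"
proof -
  let ?u = "vtx i" and ?v = "vtx j"
  let ?W = "toggle ?v (toggle ?u W)"
  define cf where "cf = (\<lambda>S. if ?u \<in> S \<and> ?v \<in> S then lam else 1)"
  define s1 where "s1 = tick (tick (ask P orc True 1 (cf W) s))"
  define s2 where "s2 = flip_flag j (flip_flag i s1)"
  define s3 where "s3 = tick (tick (ask P orc True 2 (cf ?W) s2))"
  define x1 where "x1 = cf W * orc True (induced_graph W (edges G))"
  define x2 where "x2 = cf ?W * orc True (induced_graph ?W (edges G))"
  have ok: "rmem s 0 0 = lam" "vflags s = W" "eflags s = edges G"
    using inv by (auto simp: walk_inv_def input_ok_def)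
  have cfs: "(if nmem s 3 i \<noteq> 0 \<and> nmem s 3 j \<noteq> 0 then lam else 1) = cf W"
    using vtx_mem_vflags[OF i(2), of s] vtx_mem_vflags[OF j(2), of s] ok by (simp add: cf_def)
  have e1: "exec P orc (query_weight 1) s = return_pmf s1"
    unfolding exec_query_weight[OF one_neq_zero] i(1) j(1) ok(1) cfs s1_def ..
  have s1: "nmem s1 = nmem s" "rmem s1 = (rmem s)(1 := (rmem s 1)(0 := x1))"
    "queries s1 = queries s @ [(True, induced_graph W (edges G))]" "steps s1 = steps s + 3"
    by (simp_all add: s1_def tick_sel ask_sel flagged_graph_eq ok x1_def)
  have v2: "vflags s2 = ?W"
    unfolding s2_def vflags_flip_flag[OF i(2)] vflags_flip_flag[OF j(2)]
    using vflags_cong[of s1 s] s1 ok by simp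
  have n2: "nmem s2 a = nmem s a" if "a \<noteq> 3" for a using that s1 by (simp add: s2_def state_sel)
  have r2: "rmem s2 = rmem s1" "queries s2 = queries s1" "steps s2 = steps s + 5"
    using s1 by (simp_all add: s2_def state_sel)
  have g2: "flagged_graph P s2 = induced_graph ?W (edges G)"
    unfolding flagged_graph_eq v2 using eflags_cong[of s2 s] n2 ok by simp
  have cfs2: "(if nmem s2 3 i \<noteq> 0 \<and> nmem s2 3 j \<noteq> 0 then lam else 1) = cf ?W"
    using vtx_mem_vflags[OF i(2), of s2] vtx_mem_vflags[OF j(2), of s2] v2 by (simp add: cf_def)
  have e3: "exec P orc (query_weight 2) s2 = return_pmf s3"
  proof -
    have "nmem s2 8 0 = i" "nmem s2 9 0 = j" "rmem s2 0 0 = lam"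
      using n2 i j r2 s1 ok by simp_all
    then show ?thesis using exec_query_weight[OF zero_neq_numeral[symmetric], of P orc _ s2] by (simp only: cfs2 s3_def)
  qed
  have s3: "nmem s3 = nmem s2" "rmem s3 = (rmem s1)(2 := (rmem s1 2)(0 := x2))"
    "queries s3 = queries s1 @ [(True, induced_graph ?W (edges G))]" "steps s3 = steps s + 8"
    by (simp_all add: s3_def state_sel ask_sel g2 x2_def r2)
  define s4 where "s4 = (\<lambda>b. tick (nupd 7 0 (of_bool b) s3))"
  define s5 where "s5 = (\<lambda>b. if b then tick (tick (s4 b)) else flip_flag j (flip_flag i (tick (s4 b))))"
  have n4: "nmem (s4 b) 8 0 = i" "nmem (s4 b) 9 0 = j" "nmem (s4 b) 7 0 = of_bool b" for b
    using i j by (simp_all add: s4_def state_sel s3 n2)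
  have "exec P orc walk_tail s =
    bind_pmf (bernoulli_pmf (x2 / (x1 + x2))) (\<lambda>b. return_pmf (s5 b))"
  proof -
    have "exec P orc (Seq (toggle_flag 8) (toggle_flag 9)) (tick (s4 b)) =
        return_pmf (flip_flag j (flip_flag i (tick (s4 b))))" for b
      by (simp add: exec_toggle_flag bind_return_pmf state_sel n4)
    then have fin: "exec P orc (Cond (NLe (Num 1) (scalar 7)) Skip (Seq (toggle_flag 8) (toggle_flag 9))) (s4 b) =
        return_pmf (s5 b)" for b
      using n4(3)[of b] by (cases b) (simp_all add: s5_def del: exec.simps(4))
    have fl: "exec P orc (Flip 7 (Num 0) (RDiv (RGet 2 (Num 0)) (RAdd (RGet 1 (Num 0)) (RGet 2 (Num 0))))) s3 =
        bind_pmf (bernoulli_pmf (x2 / (x1 + x2))) (\<lambda>b. return_pmf (s4 b))"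
      by (simp add: map_pmf_def s4_def s3 s1)
    have "exec P orc (toggle_flag 8) s1 = return_pmf (flip_flag i s1)"
      "exec P orc (toggle_flag 9) (flip_flag i s1) = return_pmf s2"
      using i j by (simp_all add: exec_toggle_flag s1 s2_def state_sel)
    then show ?thesis
      by (simp only: walk_tail_def exec.simps(4) e1 e3 fl bind_return_pmf bind_assoc_pmf fin)
  qed
  moreover have "rel_pmf (walk_inv (q + 2) (c + 12)) (bind_pmf (bernoulli_pmf (x2 / (x1 + x2))) (\<lambda>b. return_pmf (s5 b)))
      (walk_move oracle_weight ?u ?v W)"
  proof -
    have "finite W" using finite_subset[OF vflags_subset[of s]] ok(2) G by (simp add: simple_graph_def)
    then obtain \<kappa> where \<kappa>: "\<kappa> > 0" "sqrt lam ^ card W = \<kappa> * cf W" "sqrt lam ^ card ?W = \<kappa> * cf ?W"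
      using vertex_weight_ratio[of W lam ?u ?v] lam unfolding cf_def by blast
    have "W \<subseteq> verts G" "?W \<subseteq> verts G" using vflags_subset[of s] vflags_subset[of s2] ok v2 by auto
    then have "oracle_weight W = \<kappa> * x1" "oracle_weight ?W = \<kappa> * x2"
      using \<kappa> by (simp_all add: oracle_weight_def x1_def x2_def)
    then have ratio: "oracle_weight ?W / (oracle_weight W + oracle_weight ?W) = x2 / (x1 + x2)"
      using \<kappa>(1) by (simp flip: distrib_left)
    have n5: "nmem (s5 b) a = nmem s a" if "a \<notin> {3, 7}" for a b
      using that by (simp add: s5_def s4_def state_sel s3 n2)
    have v4: "vflags (s4 b) = ?W" "vflags (tick (s4 b)) = ?W" "vflags (tick (tick (s4 b))) = ?W" for b
      using vflags_cong[of _ s2] v2 by (simp_all add: s4_def state_sel s3)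
    have v5: "vflags (s5 b) = (if b then ?W else W)" for b
      by (simp add: s5_def v4 vflags_flip_flag[OF i(2)] vflags_flip_flag[OF j(2)] toggle_pair_involution)
    have r5: "rmem (s5 b) 0 = rmem s 0" "queries (s5 b) = queries s3" "steps (s5 b) \<le> steps s + 12" for b
      by (simp_all add: s5_def s4_def state_sel s3 s1)
    have "walk_inv (q + 2) (c + 12) (s5 b) (if b then ?W else W)" for b
      using inv input_ok_cong[of "s5 b" s] eflags_cong[of "s5 b" s] output_edges_cong[of "s5 b" s]
        r5[of b] n5[of _ b] calls_append[of s3 s1] calls_append[of s1 s] calls_cong[of "s5 b" s3]
      by (simp add: walk_inv_def v5 s3 s1)
    then show ?thesis
      unfolding walk_move_def ratio map_pmf_def by (intro rel_pmf_bind_same) simp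
  qed
  ultimately show ?thesis by simp
qed

lemma walk_body_correct:
  assumes inv: "walk_inv q c s W"
  shows "rel_pmf (walk_inv (q + 2) (c + 10 * nV + 16)) (exec P orc walk_body s)
    (walk_step oracle_weight (verts G) W)"
proof -
  have "nV > 0" using ne verts_eq by auto
  then obtain N where N: "nV = Suc N" using gr0_implies_Suc by blast
  have step: "walk_step oracle_weight (verts G) W = bind_pmf (pmf_of_set {..<Suc N}) (\<lambda>i.
      bind_pmf (pmf_of_set {..<Suc N}) (\<lambda>j. walk_move oracle_weight (vtx i) (vtx j) W))"
    unfolding walk_step_def pmf_of_set_verts bind_map_pmf N ..
  have n0: "nmem s 0 0 = Suc N" if "walk_inv q c s W" for q c s
    using that N by (simp add: walk_inv_def input_ok_def)
  show ?thesis
    unfolding step walk_body_def exec.simps(4)[of _ _ "pick_index a" for a]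
  proof (rule rel_pmf_bindI[OF pick_index_correct[OF n0[OF inv], of 8]], simp, elim conjE)
    fix s1 i assume s1: "frame {6, 7, 8} s s1" "nmem s1 8 0 = i" "i < Suc N" "steps s1 = steps s + 5 * Suc N + 2"
    have inv1: "walk_inv q (c + 5 * Suc N + 2) s1 W"
      by (rule walk_inv_frame[OF s1(1) _ inv]) (use s1 inv in \<open>auto simp: walk_inv_def\<close>)
    show "rel_pmf (walk_inv (q + 2) (c + 10 * nV + 16))
        (bind_pmf (exec P orc (pick_index 9) s1) (exec P orc walk_tail))
        (bind_pmf (pmf_of_set {..<Suc N}) (\<lambda>j. walk_move oracle_weight (vtx i) (vtx j) W))"
    proof (rule rel_pmf_bindI[OF pick_index_correct[OF n0[OF inv1], of 9]], simp, elim conjE)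
      fix s2 j assume s2: "frame {6, 7, 9} s1 s2" "nmem s2 9 0 = j" "j < Suc N" "steps s2 = steps s1 + 5 * Suc N + 2"
      have inv2: "walk_inv q (c + 10 * Suc N + 4) s2 W"
        by (rule walk_inv_frame[OF s2(1) _ inv1]) (use s2 inv1 in \<open>auto simp: walk_inv_def\<close>)
      have "nmem s2 8 0 = i" using s2(1) s1(2) by (simp add: frame_def)
      from walk_tail_correct[OF inv2 this _ s2(2)] s1(3) s2(3) N
      show "rel_pmf (walk_inv (q + 2) (c + 10 * nV + 16)) (exec P orc walk_tail s2)
        (walk_move oracle_weight (vtx i) (vtx j) W)"
        by (simp add: add.assoc del: exec.simps)
    qed
  qed
qed

end

lemma kernel_iter_return: "kernel_iter (\<lambda>_. return_pmf) N a = return_pmf a"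
  by (induction N) (simp_all add: bind_return_pmf)

lemma kernel_iter_walk: "kernel_iter (\<lambda>_. walk_step g V) N {} = walk V g N"
  by (induction N) simp_all

lemma walk_count_val:
  "rval walk_count s = 8 * walk_length (nmem s 0 0) (nmem s 0 1) (rmem s 0 0) (rmem s 0 1)"
  by (simp add: walk_count_def walk_length_def power2_eq_square)

context sampler_run
begin

lemma edges_eq: "edges G = nth_edge P ` {..<nE}"
  using pres by (simp add: presents_def)

lemma flag_edges_correct:
  assumes ok: "input_ok s" and v: "vflags s = {}" and o: "output_edges P s = {}" and q: "queries s = []"
  shows "rel_pmf (walk_inv 0 (steps s + 3 * nE + 2)) (exec P orc flag_edges s) (return_pmf {})"
proof -
  let ?m = "nE"
  define s0 where "s0 = tick (tick (nupd 6 0 0 s))"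
  define R where "R = (\<lambda>j s' (S :: nat set). S = {} \<and> frame {4, 6} s s' \<and> nmem s' 6 0 = j \<and> (\<forall>k<j. nmem s' 4 k = 1) \<and>
    steps s' = steps s + 3 * j + 2)"
  define F where "F = (\<lambda>s. exec P orc (Seq (NSet 4 (scalar 6) (Num 1)) (NSet 6 (Num 0) (NAdd (scalar 6) (Num 1)))) (tick s))"
  have "exec P orc flag_edges s = ((\<lambda>p. bind_pmf p F) ^^ ?m) (return_pmf s0)"
    unfolding flag_edges_def exec.simps(2,4) bind_return_pmf exec_Repeat_nat F_def s0_def
    using ok by (simp add: tick_def nupd_def input_ok_def del: funpow.simps exec.simps)
  moreover have "rel_pmf (R ?m) (((\<lambda>p. bind_pmf p F) ^^ ?m) (return_pmf s0)) (kernel_iter (\<lambda>_. return_pmf) ?m {})"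
  proof (rule rel_pmf_funpow_bind)
    show "R 0 s0 {}" by (simp add: R_def s0_def frame_def state_sel)
  next
    fix j s' S assume R: "R j s' S"
    have "F s' = return_pmf (tick (nupd 6 0 (Suc j) (tick (nupd 4 j 1 (tick s')))))"
      using R by (simp add: F_def R_def bind_return_pmf state_sel)
    moreover have "R (Suc j) (tick (nupd 6 0 (Suc j) (tick (nupd 4 j 1 (tick s'))))) S"
      using R by (auto simp: R_def frame_def state_sel)
    ultimately show "rel_pmf (R (Suc j)) (F s') (return_pmf S)" by simp
  qed
  ultimately have "rel_pmf (R ?m) (exec P orc flag_edges s) (return_pmf {})"
    by (simp only: kernel_iter_return)
  then show ?thesis
  proof (rule pmf.rel_mono_strong)
    fix s' S assume R: "R ?m s' S"
    have n: "nmem s' b = nmem s b" if "b \<in> {0, 1, 2, 3, 5}" for b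
      using R that by (auto simp: R_def frame_def)
    have r: "rmem s' = rmem s" "queries s' = queries s" using R by (auto simp: R_def frame_def)
    have "eflags s' = edges G"
      unfolding eflags_def edges_eq using R by (auto simp: R_def)
    then show "walk_inv 0 (steps s + 3 * ?m + 2) s' S"
      using R n r ok v o q input_ok_cong[of s' s] vflags_cong[of s' s] output_edges_cong[of s' s]
      by (simp add: walk_inv_def calls_def R_def)
  qed
qed

lemma walk_inv_tick: "walk_inv q c s W \<Longrightarrow> walk_inv q (Suc c) (tick s) W"
  using input_ok_cong[of "tick s" s] vflags_cong[of "tick s" s] eflags_cong[of "tick s" s]
    output_edges_cong[of "tick s" s] calls_cong[of "tick s" s]
  by (simp add: walk_inv_def state_sel)

lemma walk_loop_correct:
  assumes inv: "walk_inv 0 c s {}"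
  defines "N \<equiv> nat \<lceil>8 * walk_length (nV) (nE) lam \<delta>\<rceil>"
  shows "rel_pmf (walk_inv (2 * N) (c + 1 + N * (10 * nV + 17))) (exec P orc (Repeat walk_count walk_body) s)
    (walk (verts G) oracle_weight N)"
proof -
  let ?n = "nV"
  have "rval walk_count s = 8 * walk_length (nV) (nE) lam \<delta>"
    using inv unfolding walk_count_val by (simp add: walk_inv_def input_ok_def)
  then have "exec P orc (Repeat walk_count walk_body) s =
      ((\<lambda>p. bind_pmf p (\<lambda>s. exec P orc walk_body (tick s))) ^^ N) (return_pmf (tick s))"
    by (simp add: N_def)
  moreover have "rel_pmf (walk_inv (2 * N) (c + 1 + N * (10 * ?n + 17)))
      (((\<lambda>p. bind_pmf p (\<lambda>s. exec P orc walk_body (tick s))) ^^ N) (return_pmf (tick s)))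
      (kernel_iter (\<lambda>_. walk_step oracle_weight (verts G)) N {})"
  proof (rule rel_pmf_funpow_bind[where R = "\<lambda>j. walk_inv (2 * j) (c + 1 + j * (10 * ?n + 17))"])
    show "walk_inv (2 * 0) (c + 1 + 0 * (10 * ?n + 17)) (tick s) {}" using walk_inv_tick[OF inv] by simp
  next
    fix j s' W assume "walk_inv (2 * j) (c + 1 + j * (10 * ?n + 17)) s' W"
    from walk_body_correct[OF walk_inv_tick[OF this]]
    show "rel_pmf (walk_inv (2 * Suc j) (c + 1 + Suc j * (10 * ?n + 17))) (exec P orc walk_body (tick s'))
        (walk_step oracle_weight (verts G) W)"
      by (simp add: algebra_simps)
  qed
  ultimately show ?thesis by (simp only: kernel_iter_walk)
qed

text \<open>The first \<open>j\<close> edges are decided: their flags are cleared, \<open>M\<close>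
  is the output so far and \<open>W\<close> what remains to be covered. Each round makes one call of
  either oracle and takes at most 14 steps.\<close>

definition sample_inv :: "nat \<Rightarrow> nat \<Rightarrow> nat \<Rightarrow> state \<Rightarrow> nat set \<times> nat set set \<Rightarrow> bool" where
  "sample_inv q c j s = (\<lambda>(W, M). input_ok s \<and> vflags s = W \<and>
     (\<forall>k<nE. nmem s 4 k \<noteq> 0 \<longleftrightarrow> j \<le> k) \<and> nmem s 6 0 = j \<and> output_edges P s = M \<and>
     calls True s = q + j \<and> calls False s = j \<and> steps s \<le> c + 14 * j \<and> matching G M \<and> \<Union>M \<inter> W = {})"

lemma sample_body_correct:
  assumes j: "j < nE" and inv: "sample_inv q c j s (W, M)"
  shows "rel_pmf (sample_inv q c (Suc j)) (exec P orc sample_body (tick s))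
    (edge_choice (orc False) (orc True) (nth_edge P j) (nth_edge P ` {Suc j..<nE}) (W, M))"
proof -
  let ?m = "nE"
  define a where "a = fst (snd P ! j)"
  define b where "b = snd (snd P ! j)"
  define e where "e = nth_edge P j"
  define D where "D = nth_edge P ` {Suc j..<?m}"
  have ab: "a < nV" "b < nV" "e = {vtx a, vtx b}" "vtx a \<noteq> vtx b" "e \<in> edges G"
    using edge_endpoints[OF j] by (simp_all add: a_def b_def e_def)
  have I: "input_ok s" "vflags s = W" "\<And>k. k < ?m \<Longrightarrow> nmem s 4 k \<noteq> 0 \<longleftrightarrow> j \<le> k" "nmem s 6 0 = j"
    "output_edges P s = M" "calls True s = q + j" "calls False s = j" "steps s \<le> c + 14 * j"
    "matching G M" "\<Union>M \<inter> W = {}"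
    using inv by (auto simp: sample_inv_def)
  have I2: "nmem s 1 j = a" "nmem s 2 j = b" using I(1) j by (auto simp: input_ok_def a_def b_def)
  define s1 where "s1 = tick (nupd 4 j 0 (tick (nupd 9 0 b (tick (nupd 8 0 a (tick s))))))"
  define s2 where "s2 = ask P orc True 2 1 s1"
  have s1: "nmem s1 = (nmem s)(8 := (nmem s 8)(0 := a), 9 := (nmem s 9)(0 := b), 4 := (nmem s 4)(j := 0))"
    "rmem s1 = rmem s" "queries s1 = queries s" "steps s1 = steps s + 4"
    by (simp_all add: s1_def state_sel fun_upd_twist)
  have D1: "eflags s1 = D"
  proof -
    have "nmem s1 4 k \<noteq> 0 \<longleftrightarrow> Suc j \<le> k" if "k < ?m" for k
      using I(3)[OF that] by (auto simp: s1)
    then show ?thesis unfolding eflags_def D_def by auto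
  qed
  have V1: "vflags s1 = W" using vflags_cong[of s1 s] I(2) s1 by simp
  have g1: "flagged_graph P s1 = induced_graph W D" by (simp only: flagged_graph_eq D1 V1)
  have s2: "nmem s2 = nmem s1" "rmem s2 = (rmem s)(2 := (rmem s 2)(0 := orc True (induced_graph W D)))"
    "queries s2 = queries s @ [(True, induced_graph W D)]" "steps s2 = steps s + 5"
    by (simp_all add: s2_def ask_sel s1 g1)
  let ?s = "tick (nupd 8 0 a (tick s))"
  have e1: "exec P orc (NSet 8 (Num 0) (NGet 1 (scalar 6))) (tick s) = return_pmf ?s"
    using I2 by (simp add: state_sel I)
  have e2: "exec P orc (NSet 9 (Num 0) (NGet 2 (scalar 6))) ?s =
      return_pmf (tick (nupd 9 0 b ?s))"
    by (simp add: state_sel I I2)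
  have e3: "exec P orc (NSet 4 (scalar 6) (Num 0)) (tick (nupd 9 0 b ?s)) = return_pmf s1"
    by (simp add: state_sel I I2 s1_def)
  have e4: "exec P orc (Query True 2 (Num 0)) s1 = return_pmf s2"
    unfolding exec_Query s2_def ..
  define T where "T = Seq (toggle_flag 8) (Seq (toggle_flag 9) (Seq (Query False 1 (Num 0))
        (Seq (Flip 7 (Num 0) (RDiv (RGet 1 (Num 0)) (RAdd (RGet 1 (Num 0)) (RGet 2 (Num 0)))))
        (Cond (NLe (Num 1) (scalar 7)) (NSet 5 (scalar 6) (Num 1)) (Seq (toggle_flag 8) (toggle_flag 9))))))"
  have red: "exec P orc sample_body (tick s) =
      bind_pmf (exec P orc (Cond both_flagged T (Query False 1 (Num 0))) s2)
        (exec P orc (NSet 6 (Num 0) (NAdd (scalar 6) (Num 1))))"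
    unfolding sample_body_def T_def[symmetric] exec.simps(4) e1 e2 e3 e4 bind_return_pmf ..
  have bf: "bval both_flagged s2 \<longleftrightarrow> e \<subseteq> W"
    using vtx_mem_vflags[OF ab(1), of s1] vtx_mem_vflags[OF ab(2), of s1] V1 ab(3)
    by (auto simp: both_flagged_def s2 s1)
  have inv': "sample_inv q c (Suc j) t (W', M')"
    if "\<And>k. k \<notin> {3, 4, 5, 6, 7, 8, 9} \<Longrightarrow> nmem t k = nmem s k" "nmem t 4 = nmem s1 4" "rmem t 0 = rmem s 0"
      "nmem t 6 0 = Suc j" "vflags t = W'" "output_edges P t = M'" "queries t = queries s2 @ [(False, K)]"
      "steps t \<le> steps s + 14" "matching G M'" "\<Union>M' \<inter> W' = {}" for t W' M' K
  proof -
    have "input_ok t" using input_ok_cong[of t s] that(1,3) I(1) by simp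
    moreover have "nmem t 4 k \<noteq> 0 \<longleftrightarrow> Suc j \<le> k" if "k < ?m" for k
      using I(3)[OF that] \<open>nmem t 4 = nmem s1 4\<close> by (auto simp: s1)
    moreover have "calls True t = q + Suc j" "calls False t = Suc j"
      using calls_append[OF that(7)] calls_append[of s2 s] s2(3) I(6,7) by simp_all
    ultimately show ?thesis using that(4-10) I(8) by (simp add: sample_inv_def)
  qed
  show ?thesis
  proof (cases "e \<subseteq> W")
    case False
    define t where "t = tick (nupd 6 0 (Suc j) (ask P orc False 1 1 (tick s2)))"
    have "exec P orc sample_body (tick s) = return_pmf t"
      using False bf unfolding red exec.simps(5)
      by (simp add: exec_Query bind_return_pmf t_def state_sel ask_sel s2 s1 I del: exec.simps(8))
    moreover have "sample_inv q c (Suc j) t (W, M)"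
    proof (rule inv')
      show "vflags t = W" using vflags_cong[of t s1] V1 by (simp add: t_def state_sel ask_sel s2)
      show "output_edges P t = M" using output_edges_cong[of t s] I(5) by (simp add: t_def state_sel ask_sel s2 s1)
      show "queries t = queries s2 @ [(False, flagged_graph P (tick s2))]" by (simp add: t_def state_sel ask_sel)
    qed (use I in \<open>simp_all add: t_def state_sel ask_sel s2 s1\<close>)
    ultimately show ?thesis using False by (simp add: edge_choice_def e_def)
  next
    case True
    define t1 where "t1 = flip_flag b (flip_flag a (tick s2))"
    define t2 where "t2 = ask P orc False 1 1 t1"
    define t3 where "t3 = (\<lambda>x. tick (nupd 7 0 (of_bool x) t2))"
    define t4 where "t4 = (\<lambda>x. if x then tick (nupd 5 j 1 (tick (t3 x))) else flip_flag b (flip_flag a (tick (t3 x))))"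
    define t5 where "t5 = (\<lambda>x. tick (nupd 6 0 (Suc j) (t4 x)))"
    \<comment> \<open>The end points are distinct, so two toggles remove \<open>e\<close> from
      \<open>W\<close> and two more put it back.\<close>
    have tog: "toggle (vtx b) (toggle (vtx a) W) = W - e" "toggle (vtx b) (toggle (vtx a) (W - e)) = W"
      using True ab(3,4) by (auto simp: toggle_def)
    have v1: "vflags t1 = W - e"
      unfolding t1_def vflags_flip_flag[OF ab(1)] vflags_flip_flag[OF ab(2)]
      using vflags_cong[of "tick s2" s1] V1 tog by (simp add: state_sel s2)
    have n1: "nmem t1 k = nmem s1 k" if "k \<noteq> 3" for k using that by (simp add: t1_def state_sel s2)
    have r1: "rmem t1 = rmem s2" "queries t1 = queries s2" "steps t1 = steps s + 8"
      by (simp_all add: t1_def state_sel s2)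
    have g1': "flagged_graph P t1 = induced_graph (W - e) D"
      unfolding flagged_graph_eq v1 using eflags_cong[of t1 s1] n1 D1 by simp
    have t2: "nmem t2 = nmem t1" "rmem t2 = (rmem s2)(1 := (rmem s2 1)(0 := orc False (induced_graph (W - e) D)))"
      "queries t2 = queries s2 @ [(False, induced_graph (W - e) D)]" "steps t2 = steps s + 9"
      by (simp_all add: t2_def ask_sel r1 g1')
    have n3: "nmem (t3 x) 8 0 = a" "nmem (t3 x) 9 0 = b" "nmem (t3 x) 7 0 = of_bool x" "nmem (t3 x) 6 0 = j" for x
      by (simp_all add: t3_def state_sel t2 n1 s1 I)
    let ?x = "orc False (induced_graph (W - e) D) / (orc False (induced_graph (W - e) D) + orc True (induced_graph W D))"
    have "exec P orc sample_body (tick s) = bind_pmf (bernoulli_pmf ?x) (\<lambda>x. return_pmf (t5 x))"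
    proof -
      have f1: "exec P orc (toggle_flag 8) (tick s2) = return_pmf (flip_flag a (tick s2))"
        "exec P orc (toggle_flag 9) (flip_flag a (tick s2)) = return_pmf t1"
        by (simp_all add: exec_toggle_flag state_sel s2 s1 t1_def)
      have f2: "exec P orc (Query False 1 (Num 0)) t1 = return_pmf t2" unfolding exec_Query t2_def ..
      have f3: "exec P orc (Flip 7 (Num 0) (RDiv (RGet 1 (Num 0)) (RAdd (RGet 1 (Num 0)) (RGet 2 (Num 0))))) t2 =
          bind_pmf (bernoulli_pmf ?x) (\<lambda>x. return_pmf (t3 x))"
        by (simp add: map_pmf_def t3_def t2 s2)
      have "exec P orc (Seq (toggle_flag 8) (toggle_flag 9)) (tick (t3 x)) =
          return_pmf (flip_flag b (flip_flag a (tick (t3 x))))" for x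
        by (simp add: exec_toggle_flag bind_return_pmf state_sel n3)
      moreover have "exec P orc (NSet 5 (scalar 6) (Num 1)) (tick (t3 x)) = return_pmf (tick (nupd 5 j 1 (tick (t3 x))))" for x
        by (simp add: state_sel n3)
      ultimately have f4: "exec P orc (Cond (NLe (Num 1) (scalar 7)) (NSet 5 (scalar 6) (Num 1)) (Seq (toggle_flag 8) (toggle_flag 9))) (t3 x) =
          return_pmf (t4 x)" for x
        using n3(3)[of x] by (cases x) (simp_all add: t4_def del: exec.simps(2,4))
      have f5: "exec P orc (NSet 6 (Num 0) (NAdd (scalar 6) (Num 1))) (t4 x) = return_pmf (t5 x)" for x
        by (simp add: t5_def t4_def state_sel n3)
      have "exec P orc T (tick s2) = bind_pmf (bernoulli_pmf ?x) (\<lambda>x. return_pmf (t4 x))"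
        unfolding T_def exec.simps(4) f1 f2 f3 f4 bind_return_pmf bind_assoc_pmf ..
      then show ?thesis
        unfolding red exec.simps(5) using True bf
        by (simp add: bind_assoc_pmf bind_return_pmf f5 del: exec.simps One_nat_def)
    qed
    moreover have "sample_inv q c (Suc j) (t5 x) (if x then (W - e, insert e M) else (W, M))" for x
    proof -
      have v3: "vflags (tick (t3 y)) = W - e" for y
        using vflags_cong[of "tick (t3 y)" t1] v1 by (simp add: t3_def state_sel t2)
      have v5: "vflags (t5 x) = (if x then W - e else W)"
      proof (cases x)
        case True
        then show ?thesis using vflags_cong[of "t5 x" "tick (t3 x)"] v3 by (simp add: t5_def t4_def state_sel)
      next
        case False
        then have "vflags (t5 x) = vflags (flip_flag b (flip_flag a (tick (t3 x))))"
          by (intro vflags_cong) (simp add: t5_def t4_def state_sel)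
        then show ?thesis
          using False by (simp add: vflags_flip_flag[OF ab(1)] vflags_flip_flag[OF ab(2)] v3 tog)
      qed
      have o5: "output_edges P (t5 x) = (if x then insert e M else M)"
      proof (cases x)
        case True
        have "nmem (t5 x) 5 = (nmem s 5)(j := 1)"
          using True by (simp add: t5_def t4_def t3_def state_sel t2 n1 s1)
        then have "output_edges P (t5 x) = insert e (output_edges P s)"
          unfolding output_edges_def e_def using j by auto
        then show ?thesis using True I(5) by simp
      next
        case False
        then show ?thesis
          using output_edges_cong[of "t5 x" s] I(5) by (simp add: t5_def t4_def t3_def state_sel t2 n1 s1)
      qed
      have M: "matching G (insert e M)"
      proof -
        have "d \<inter> e = {}" if "d \<in> M" for d using that True I(10) by blast
        then have "disjoint (insert e M)" using I(9) unfolding matching_def disjoint_def by blast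
        then show ?thesis using I(9) ab(5) by (simp add: matching_def)
      qed
      have "sample_inv q c (Suc j) (t5 x) (if x then W - e else W, if x then insert e M else M)"
      proof (rule inv'[OF _ _ _ _ v5 o5])
        show "queries (t5 x) = queries s2 @ [(False, induced_graph (W - e) D)]"
          by (simp add: t5_def t4_def t3_def state_sel t2)
        show "matching G (if x then insert e M else M)" using M I(9) by simp
        show "\<Union>(if x then insert e M else M) \<inter> (if x then W - e else W) = {}" using I(10) by auto
      qed (simp_all add: t5_def t4_def t3_def state_sel t2 n1 s1 s2)
      then show ?thesis by (cases x) simp_all
    qed
    ultimately show ?thesis
      using True unfolding edge_choice_def e_def[symmetric] D_def[symmetric] map_pmf_def
      by (simp add: rel_pmf_bind_same)
  qed
qed

end

section \<open>Complete runs and the graphs that they query\<close>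

lemma init_state_sel:
  "nmem (init_state P lam \<delta>) 0 0 = length (fst P)" "nmem (init_state P lam \<delta>) 0 1 = length (snd P)"
  "a \<ge> 3 \<Longrightarrow> nmem (init_state P lam \<delta>) a i = 0"
  "k < length (snd P) \<Longrightarrow> nmem (init_state P lam \<delta>) 1 k = fst (snd P ! k)"
  "k < length (snd P) \<Longrightarrow> nmem (init_state P lam \<delta>) 2 k = snd (snd P ! k)"
  "rmem (init_state P lam \<delta>) 0 0 = lam" "rmem (init_state P lam \<delta>) 0 1 = \<delta>"
  "queries (init_state P lam \<delta>) = []" "steps (init_state P lam \<delta>) = 0"
  by (simp_all add: init_state_def)

lemma bval_sampler_guard:
  "bval (BAnd (BNot (RLe (OfNat (Num 1)) (RGet 0 (Num 1)))) (NLe (Num 1) (NGet 0 (Num 1)))) (init_state P lam \<delta>)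
    \<longleftrightarrow> \<delta> < 1 \<and> length (snd P) > 0"
  using init_state_sel(2,7)[of P lam \<delta>] by (simp add: Suc_le_eq not_le)

text \<open>Relating the run to the one-point distribution on \<open>unit\<close> is a way of
  stating a property of all reachable final states.\<close>

lemma sampler_idle:
  assumes "\<not> (\<delta> < 1 \<and> length (snd P) > 0)"
  shows "rel_pmf (\<lambda>s (_::unit). output_edges P s = {} \<and> calls True s = 0 \<and> calls False s = length (snd P) \<and>
      steps s = 2 * length (snd P) + 2)
    (exec P orc sampler (init_state P lam \<delta>)) (return_pmf ())"
proof -
  let ?m = "length (snd P)"
  define s where "s = tick (init_state P lam \<delta>)"
  define R where "R = (\<lambda>j s' (_::unit). nmem s' = nmem s \<and> calls True s' = 0 \<and> calls False s' = j \<and> steps s' = 2 * j + 2)"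
  define F where "F = (\<lambda>s. exec P orc (Query False 1 (Num 0)) (tick s))"
  have m: "nval (NGet 0 (Num 1)) s = ?m"
    using init_state_sel(2)[of P lam \<delta>] by (simp add: s_def state_sel del: One_nat_def)
  have "exec P orc sampler (init_state P lam \<delta>) = ((\<lambda>p. bind_pmf p F) ^^ ?m) (return_pmf (tick s))"
    unfolding sampler_def exec.simps(5) bval_sampler_guard if_not_P[OF assms] s_def[symmetric] exec_Repeat_nat m F_def ..
  moreover have "rel_pmf (R ?m) (((\<lambda>p. bind_pmf p F) ^^ ?m) (return_pmf (tick s))) (kernel_iter (\<lambda>_. return_pmf) ?m ())"
  proof (rule rel_pmf_funpow_bind)
    show "R 0 (tick s) ()" by (simp add: R_def s_def state_sel calls_def init_state_sel)
  next
    fix j s' and x :: unit assume R: "R j s' x"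
    have "F s' = return_pmf (ask P orc False 1 1 (tick s'))" unfolding F_def exec_Query ..
    moreover have "R (Suc j) (ask P orc False 1 1 (tick s')) x"
      using R calls_append[of "ask P orc False 1 1 (tick s')" s' False "flagged_graph P (tick s')"]
      by (simp add: R_def ask_sel state_sel)
    ultimately show "rel_pmf (R (Suc j)) (F s') (return_pmf x)" by simp
  qed
  ultimately have "rel_pmf (R ?m) (exec P orc sampler (init_state P lam \<delta>)) (return_pmf ())"
    by (simp only: kernel_iter_return)
  then show ?thesis
  proof (rule pmf.rel_mono_strong)
    fix s' x assume "R ?m s' x"
    moreover have "nmem s 5 k = 0" for k by (simp add: s_def state_sel init_state_sel)
    ultimately show "output_edges P s' = {} \<and> calls True s' = 0 \<and> calls False s' = ?m \<and> steps s' = 2 * ?m + 2"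
      by (simp add: R_def output_edges_def)
  qed
qed

lemma subgraph_induced_graph:
  assumes "simple_graph G" "W \<subseteq> verts G" "D \<subseteq> edges G"
  shows "subgraph (induced_graph W D) G"
  using assms finite_subset[OF assms(2)] by (auto simp: subgraph_def simple_graph_def induced_graph_def)

lemma subgraph_flagged_graph:
  assumes "presents P G" "simple_graph G"
  shows "subgraph (flagged_graph P s) G"
proof -
  define W where "W = {fst P ! i | i. i < length (fst P) \<and> nmem s 3 i \<noteq> 0}"
  define D where "D = {nth_edge P k | k. k < length (snd P) \<and> nmem s 4 k \<noteq> 0}"
  have V: "set (fst P) = verts G" and E: "nth_edge P ` {..<length (snd P)} = edges G"
    using assms(1) unfolding presents_def by simp_all
  have "W \<subseteq> verts G" unfolding W_def V[symmetric] by auto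
  moreover have "D \<subseteq> edges G" unfolding D_def E[symmetric] by auto
  moreover have "flagged_graph P s = induced_graph W D"
    unfolding flagged_graph_def Let_def induced_graph_def W_def[symmetric] unfolding D_def by blast
  ultimately show ?thesis using subgraph_induced_graph[OF assms(2)] by simp
qed

text \<open>The restriction is built into the machine rather than into \<open>sampler\<close>:
  \<open>flagged_graph\<close> always yields a subgraph of the input, so an induction over arbitrary
  programs suffices.\<close>

lemma queries_subgraph:
  assumes "presents P G" "simple_graph G"
    and "\<forall>(b, K)\<in>set (queries s). subgraph K G" "s' \<in> set_pmf (exec P orc c s)"
  shows "\<forall>(b, K)\<in>set (queries s'). subgraph K G"
proof -
  define okq where "okq = (\<lambda>s::state. \<forall>(b, K)\<in>set (queries s). subgraph K G)"
  have tk: "okq (tick s) = okq s" for s by (simp add: okq_def tick_sel)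
  have up: "okq (nupd a i x s) = okq s" "okq (rupd a i y s) = okq s" for a i x y s
    by (simp_all add: okq_def nupd_sel rupd_sel)
  have "okq s \<Longrightarrow> s' \<in> set_pmf (exec P orc c s) \<Longrightarrow> okq s'" for s s'
  proof (induction c arbitrary: s s')
    case (Seq c d)
    from Seq.prems(2) obtain r where "r \<in> set_pmf (exec P orc c s)" "s' \<in> set_pmf (exec P orc d r)" by auto
    then show ?case using Seq.IH(2)[OF Seq.IH(1)[OF Seq.prems(1)]] by blast
  next
    case (Cond b c d)
    have "okq (tick s)" using Cond.prems(1) tk by simp
    then show ?case using Cond.IH(1)[of "tick s" s'] Cond.IH(2)[of "tick s" s'] Cond.prems(2)
      by (simp split: if_splits)
  next
    case (Repeat x c)
    have "okq s'"
      if "s' \<in> set_pmf (((\<lambda>p. bind_pmf p (\<lambda>s'. exec P orc c (tick s'))) ^^ N) (return_pmf (tick s)))" for N s'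
      using that
    proof (induction N arbitrary: s')
      case 0
      then show ?case using Repeat.prems(1) tk by simp
    next
      case (Suc N)
      from Suc.prems obtain r where r: "r \<in> set_pmf (((\<lambda>p. bind_pmf p (\<lambda>s'. exec P orc c (tick s'))) ^^ N) (return_pmf (tick s)))"
        "s' \<in> set_pmf (exec P orc c (tick r))"
        unfolding funpow.simps o_apply set_bind_pmf by blast
      show ?case by (rule Repeat.IH[OF _ r(2)]) (use Suc.IH[OF r(1)] tk in simp)
    qed
    from this[OF Repeat.prems(2)[unfolded exec.simps]] show ?case .
  next
    case (Query b a i)
    then show ?case using subgraph_flagged_graph[OF assms(1,2), of s]
      by (simp add: Let_def tk up) (simp add: okq_def)
  qed (auto simp: tk up)
  then show ?thesis using assms(3,4) unfolding okq_def by blast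
qed

context sampler_run
begin

lemma sample_loop_correct:
  assumes inv: "walk_inv q c s W"
  shows "rel_pmf (sample_inv q (c + 2) (nE))
    (exec P orc (Seq (NSet 6 (Num 0) (Num 0)) (Repeat (OfNat (NGet 0 (Num 1))) sample_body)) s)
    (sample_edges (orc False) (orc True) (map (nth_edge P) [0..<nE]) (W, {}))"
proof -
  let ?m = "nE"
  let ?es = "map (nth_edge P) [0..<?m]"
  define s0 where "s0 = tick (tick (nupd 6 0 0 s))"
  have m: "nval (NGet 0 (Num 1)) (tick (nupd 6 0 0 s)) = ?m"
    using inv by (simp add: walk_inv_def input_ok_def state_sel)
  have "exec P orc (Seq (NSet 6 (Num 0) (Num 0)) (Repeat (OfNat (NGet 0 (Num 1))) sample_body)) s =
      ((\<lambda>p. bind_pmf p (\<lambda>s. exec P orc sample_body (tick s))) ^^ ?m) (return_pmf s0)"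
    unfolding exec.simps(2,4) bind_return_pmf nval.simps(1) exec_Repeat_nat m s0_def ..
  moreover have "rel_pmf (sample_inv q (c + 2) ?m)
      (((\<lambda>p. bind_pmf p (\<lambda>s. exec P orc sample_body (tick s))) ^^ ?m) (return_pmf s0))
      (kernel_iter (\<lambda>j. edge_choice (orc False) (orc True) (?es ! j) (set (drop (Suc j) ?es))) ?m (W, {}))"
  proof (rule rel_pmf_funpow_bind)
    have "inj_on (nth_edge P) {..<?m}" using pres by (simp add: presents_def)
    \<comment> \<open>\<open>walk_inv\<close> speaks of flagged edges as a set; injectivity of
      \<open>nth_edge\<close> recovers the individual flags.\<close>
    then have "nmem s 4 k \<noteq> 0" if k: "k < ?m" for k
    proof -
      have "nth_edge P k \<in> eflags s" using inv k by (simp add: walk_inv_def edges_eq)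
      then obtain l where "l < ?m" "nmem s 4 l \<noteq> 0" "nth_edge P k = nth_edge P l"
        by (auto simp: eflags_def)
      then show ?thesis using \<open>inj_on (nth_edge P) {..<?m}\<close> k by (auto dest: inj_onD)
    qed
    moreover have "matching G {}" by (simp add: matching_def)
    ultimately show "sample_inv q (c + 2) 0 s0 (W, {})"
      using inv input_ok_cong[of s0 s] vflags_cong[of s0 s] output_edges_cong[of s0 s] calls_cong[of s0 s]
      by (simp add: walk_inv_def sample_inv_def s0_def state_sel)
  next
    fix j s' a assume j: "j < ?m" and a: "sample_inv q (c + 2) j s' a"
    have "?es ! j = nth_edge P j" using j by simp
    moreover have "set (drop (Suc j) ?es) = nth_edge P ` {Suc j..<?m}" by (simp add: drop_map drop_upt)
    ultimately show "rel_pmf (sample_inv q (c + 2) (Suc j)) (exec P orc sample_body (tick s'))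
        (edge_choice (orc False) (orc True) (?es ! j) (set (drop (Suc j) ?es)) a)"
      using sample_body_correct[OF j, of q "c + 2" s' "fst a" "snd a"] a by simp
  qed
  moreover have "kernel_iter (\<lambda>j. edge_choice (orc False) (orc True) (?es ! j) (set (drop (Suc j) ?es))) ?m (W, {}) =
      sample_edges (orc False) (orc True) ?es (W, {})"
    using kernel_iter_edge_choice[of "orc False" "orc True" ?es "(W, {})"] by simp
  ultimately show ?thesis by simp
qed

lemma sampler_correct:
  assumes "\<delta> < 1 \<and> nE > 0"
  defines "N \<equiv> nat \<lceil>8 * walk_length (nV) (nE) lam \<delta>\<rceil>"
  shows "rel_pmf (sample_inv (2 * N) (3 * nE + N * (10 * nV + 17) + 6) (nE))
    (exec P orc sampler (init_state P lam \<delta>))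
    (bind_pmf (walk (verts G) oracle_weight N)
      (\<lambda>S. sample_edges (orc False) (orc True) (map (nth_edge P) [0..<nE]) (S, {})))"
proof -
  let ?m = "nE"
  let ?R = "sample_inv (2 * N) (3 * ?m + N * (10 * nV + 17) + 6) ?m"
  let ?D = "Seq (NSet 6 (Num 0) (Num 0)) (Repeat (OfNat (NGet 0 (Num 1))) sample_body)"
  let ?K = "\<lambda>S. sample_edges (orc False) (orc True) (map (nth_edge P) [0..<?m]) (S, {})"
  define s where "s = tick (init_state P lam \<delta>)"
  have s: "input_ok s"
    unfolding input_ok_def s_def tick_sel init_state_sel(1,2,6,7)
    using init_state_sel(4,5)[where P = P and lam = lam and \<delta> = \<delta>] by simp
  have s': "vflags s = {}" "output_edges P s = {}" "queries s = []" "steps s = 1"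
    by (simp_all add: vflags_def output_edges_def s_def tick_sel init_state_sel)
  have flag: "rel_pmf (walk_inv 0 (3 * ?m + 3)) (exec P orc flag_edges s) (return_pmf {})"
    using flag_edges_correct[OF s s'(1-3)] s'(4) by (simp add: numeral_3_eq_3)
  have flag': "rel_pmf (\<lambda>s' (S :: nat set). walk_inv 0 (3 * ?m + 3) s' {}) (exec P orc flag_edges s) (return_pmf {})"
    by (rule pmf.rel_mono_strong[OF flag]) auto
  have "rel_pmf ?R
    (exec P orc (Seq flag_edges (Seq (Repeat walk_count walk_body)
       ?D)) s)
    (bind_pmf (return_pmf {}) (\<lambda>S0 :: nat set. bind_pmf (walk (verts G) oracle_weight N)
      ?K))"
    unfolding exec.simps(4)[of _ _ flag_edges] exec.simps(4)[of _ _ "Repeat walk_count walk_body"]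
  proof (rule rel_pmf_bindI[OF flag'])
    fix s1 S assume "walk_inv 0 (3 * ?m + 3) s1 {}"
    note walk = walk_loop_correct[OF this, folded N_def]
    show "rel_pmf ?R
        (bind_pmf (exec P orc (Repeat walk_count walk_body) s1)
          (exec P orc ?D))
        (bind_pmf (walk (verts G) oracle_weight N)
          ?K)"
    proof (rule rel_pmf_bindI[OF walk])
      fix s2 S assume "walk_inv (2 * N) (3 * ?m + 3 + 1 + N * (10 * nV + 17)) s2 S"
      from sample_loop_correct[OF this]
      show "rel_pmf ?R
          (exec P orc ?D s2)
          (?K S)"
        by (simp add: ac_simps del: exec.simps)
    qed
  qed
  then show ?thesis
    unfolding sampler_def exec.simps(5) bval_sampler_guard if_P[OF assms(1)] s_def bind_return_pmf .
qed

end

section \<open>Parameters\<close>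

text \<open>Together with \<open>walk_length_ge\<close> this gives \<open>m \<le> t\<close>: the
  walk's oracle is then at least as accurate as the other one, and its \<open>m\<close> extra calls
  fit into the budget.\<close>

lemma card_edges_le:
  assumes "simple_graph G"
  shows "2 * real (card (edges G)) \<le> (real (card (verts G)))\<^sup>2"
proof -
  let ?n = "card (verts G)"
  have fin: "finite (verts G)" using assms by (simp add: simple_graph_def)
  have "card (edges G) \<le> card {e. e \<subseteq> verts G \<and> card e = 2}"
    by (rule card_mono) (use assms fin in \<open>auto simp: simple_graph_def\<close>)
  also have "\<dots> = ?n * (?n - 1) div 2" using n_subsets[OF fin] by (simp add: choose_two)
  finally have "2 * card (edges G) \<le> ?n * (?n - 1)" by linarith
  also have "\<dots> \<le> ?n\<^sup>2" by (simp add: power2_eq_square)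
  finally have "real (2 * card (edges G)) \<le> real (?n\<^sup>2)" by (rule of_nat_mono)
  then show ?thesis by simp
qed

text \<open>For \<open>\<delta> < 1\<close> the logarithm of \<open>3 / \<delta>\<close> is at least
  1, since \<open>exp 1 \<le> 3\<close>.\<close>

lemma walk_length_ge:
  assumes "0 < \<delta>" "\<delta> < 1" "lam > 0"
  shows "(real n)\<^sup>2 / 2 \<le> walk_length n m lam \<delta>"
proof -
  have "3 \<le> 3 / \<delta>" using assms by (simp add: le_divide_eq)
  then have "exp 1 \<le> 3 / \<delta>" using exp_le by linarith
  then have "1 \<le> ln (3 / \<delta>)" using assms by (subst ln_ge_iff) auto
  moreover have "0 \<le> real m * ln (1 + lam)" using assms by simp
  ultimately have "(real n)\<^sup>2 / 2 * 1 \<le> walk_length n m lam \<delta>"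
    unfolding walk_length_def by (intro mult_left_mono) auto
  then show ?thesis by simp
qed

text \<open>In this range \<open>1 + lam \<le> lam\<^sup>2\<close> and
  \<open>3 \<le> (1 / \<delta>)\<^sup>2\<close>. A restriction is needed because
  \<open>m * ln lam + ln (1 / \<delta>)\<close> can vanish or be negative for small
  \<open>lam\<close> or large \<open>\<delta>\<close> while \<open>t\<close> is positive.\<close>

lemma walk_length_le:
  assumes "0 < \<delta>" "\<delta> \<le> 1 / 2" "lam \<ge> 2"
  shows "walk_length n m lam \<delta> \<le> 3 / 2 * ((real n)\<^sup>2 * (real m * ln lam + ln (1 / \<delta>)))"
    and "0 \<le> real m * ln lam + ln (1 / \<delta>)" and "0 < ln (1 / \<delta>)"
proof -
  have mult_3_half: "3 / 2 * (x * y) = x / 2 * (3 * y)" for x y :: real by simp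
  have "ln (1 + lam) \<le> ln (lam ^ 2)"
  proof -
    have "lam * 2 \<le> lam * lam" using assms by (intro mult_left_mono) auto
    then have "1 + lam \<le> lam ^ 2" using assms unfolding power2_eq_square by linarith
    then show ?thesis using assms by (subst ln_le_cancel_iff) auto
  qed
  also have "\<dots> = 2 * ln lam" using assms by (simp add: ln_realpow)
  finally have 1: "ln (1 + lam) \<le> 2 * ln lam" .
  have l0: "0 \<le> ln lam" using assms by simp
  have "ln 3 \<le> ln ((1 / \<delta>) ^ 2)"
  proof -
    have "2 \<le> 1 / \<delta>" using assms by (simp add: le_divide_eq)
    then have "2 ^ 2 \<le> (1 / \<delta>) ^ 2" by (intro power_mono) auto
    then show ?thesis using assms by (subst ln_le_cancel_iff) auto
  qed
  also have "\<dots> = 2 * ln (1 / \<delta>)" using assms by (subst ln_realpow) auto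
  finally have "ln 3 \<le> 2 * ln (1 / \<delta>)" .
  moreover have "ln (3 / \<delta>) = ln 3 + ln (1 / \<delta>)" using assms by (simp add: ln_div)
  ultimately have 2: "ln (3 / \<delta>) \<le> 3 * ln (1 / \<delta>)" by simp
  show "0 < ln (1 / \<delta>)" using assms by simp
  then show nn: "0 \<le> real m * ln lam + ln (1 / \<delta>)" using l0 by (intro add_nonneg_nonneg) auto
  have "real m * ln (1 + lam) \<le> real m * (3 * ln lam)"
    using 1 l0 by (intro mult_left_mono) auto
  then have "real m * ln (1 + lam) + ln (3 / \<delta>) \<le> 3 * (real m * ln lam + ln (1 / \<delta>))"
    using 2 by (simp add: algebra_simps)
  then have "(real n)\<^sup>2 / 2 * (real m * ln (1 + lam) + ln (3 / \<delta>)) \<le>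
      (real n)\<^sup>2 / 2 * (3 * (real m * ln lam + ln (1 / \<delta>)))"
    by (rule mult_left_mono) simp
  then show "walk_length n m lam \<delta> \<le> 3 / 2 * ((real n)\<^sup>2 * (real m * ln lam + ln (1 / \<delta>)))"
    unfolding walk_length_def by (simp only: mult_3_half)
qed

text \<open>The constant 6 comes from \<open>t \<le> 3 / 2 * B\<close> and
  \<open>ln (1 + \<delta> / 3) \<ge> \<delta> / 4\<close>.\<close>

lemma walk_accuracy_ge:
  assumes "0 < \<delta>" "\<delta> \<le> 1 / 2" "lam \<ge> 2" "C \<ge> 6"
  shows "\<delta> / (C * ((real n)\<^sup>2 * (real m * ln lam + ln (1 / \<delta>)))) \<le> walk_accuracy n m lam \<delta>"
proof (cases "n = 0")
  \<comment> \<open>Without vertices both sides are quotients by zero, hence 0.\<close>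
  case True
  then show ?thesis by (simp add: walk_accuracy_def walk_length_def)
next
  case False
  define B where "B = (real n)\<^sup>2 * (real m * ln lam + ln (1 / \<delta>))"
  define t where "t = walk_length n m lam \<delta>"
  have "(real n)\<^sup>2 / 2 \<le> t" unfolding t_def using assms by (intro walk_length_ge) auto
  then have t: "t > 0" using False by (smt (verit) of_nat_0_less_iff gr0I zero_less_power half_gt_zero)
  have tB: "t \<le> 3 / 2 * B" unfolding t_def B_def by (rule walk_length_le(1)[OF assms(1-3)])
  have l: "\<delta> / 4 \<le> ln (1 + \<delta> / 3)"
  proof -
    have "\<delta> / 3 - (\<delta> / 3)\<^sup>2 \<le> ln (1 + \<delta> / 3)" using assms by (intro ln_one_plus_pos_lower_bound) auto
    moreover have "\<delta> * \<delta> \<le> \<delta> * (1 / 2)" using assms by (intro mult_left_mono) auto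
    moreover have "(\<delta> / 3)\<^sup>2 = \<delta> * \<delta> / 9" by (simp add: power2_eq_square)
    ultimately show ?thesis using assms(1) by linarith
  qed
  have "\<delta> / (C * B) \<le> \<delta> / (4 * t)"
  proof (rule divide_left_mono)
    have "0 < B" using t tB by linarith
    then have "6 * B \<le> C * B" using assms by (intro mult_right_mono) auto
    then show "4 * t \<le> C * B" using tB by linarith
    show "0 < C * B * (4 * t)" using t \<open>0 < B\<close> assms by simp
  qed (use assms in simp)
  also have "\<dots> = \<delta> / 4 / t" by simp
  also have "\<dots> \<le> walk_accuracy n m lam \<delta>"
    unfolding walk_accuracy_def t_def[symmetric] using l t by (intro divide_right_mono) auto
  finally show ?thesis unfolding B_def .
qed

text \<open>Of the exponent \<open>4 * (a + l)\<close>, the part \<open>a\<close> cancels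
  \<open>(1 + lam) ^ m\<close> and the remaining decay is at least
  \<open>exp (- (4 * l)) = (\<delta> / 3) ^ 4\<close>. Half of this power is lost to the root and
  the rest outweighs the factor 2.\<close>

lemma mixing_bound:
  assumes "0 < \<delta>" "\<delta> < 1" "lam > 0" "n > 0" "8 * walk_length n m lam \<delta> \<le> real N"
  shows "sqrt (2 * (1 + lam) ^ m * exp (- (real N / (real n)\<^sup>2))) \<le> \<delta> / 3"
proof -
  define a where "a = real m * ln (1 + lam)"
  define l where "l = ln (3 / \<delta>)"
  have a: "a \<ge> 0" using assms by (simp add: a_def)
  have "4 * (a + l) = 8 * walk_length n m lam \<delta> / (real n)\<^sup>2"
    using assms(4) by (simp add: walk_length_def a_def l_def)
  also have "\<dots> \<le> real N / (real n)\<^sup>2" using assms(5) by (intro divide_right_mono) auto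
  finally have N: "4 * (a + l) \<le> real N / (real n)\<^sup>2" .
  have "(1 + lam) ^ m = exp a" unfolding a_def using assms by (simp add: exp_of_nat_mult)
  then have "2 * (1 + lam) ^ m * exp (- (real N / (real n)\<^sup>2)) = 2 * exp (a - real N / (real n)\<^sup>2)"
    by (simp add: exp_diff exp_minus field_simps)
  also have "\<dots> \<le> 2 * exp (- (4 * l))" using N a by simp
  also have "exp (- (4 * l)) = (\<delta> / 3) ^ 4"
  proof -
    have "exp (- (4 * l)) = exp (- l) ^ 4" by (simp flip: exp_of_nat_mult)
    also have "exp (- l) = \<delta> / 3" using assms by (simp add: l_def exp_minus)
    finally show ?thesis .
  qed
  also have "2 * (\<delta> / 3) ^ 4 \<le> (\<delta> / 3)\<^sup>2"
  proof -
    have "(\<delta> / 3)\<^sup>2 \<le> (1 / 3)\<^sup>2" using assms by (intro power_mono) auto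
    then have "2 * (\<delta> / 3)\<^sup>2 * (\<delta> / 3)\<^sup>2 \<le> 1 * (\<delta> / 3)\<^sup>2"
      by (intro mult_right_mono) (auto simp: power2_eq_square)
    then show ?thesis by (simp add: power2_eq_square power4_eq_xxxx)
  qed
  finally show ?thesis using assms by (intro real_le_lsqrt) auto
qed

section \<open>Error and cost budget\<close>

lemma tv_distance_le:
  assumes "\<And>X. \<bar>measure_pmf.prob p X - measure_pmf.prob q X\<bar> \<le> d"
  shows "tv_distance p q \<le> d"
  unfolding tv_distance_def by (rule cSUP_least) (use assms in auto)

text \<open>Closure of the class under subgraphs enters here: it extends the guarantee to every
  graph that a run on \<open>G\<close> may query.\<close>

lemma approximates_oracle:
  assumes "\<forall>G\<in>\<H>. simple_graph G" "subgraph_closed \<H>" "approx_pm_counter \<H> \<epsilon> q" "G \<in> \<H>"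
  shows "approximates (verts G) (edges G) \<epsilon> q"
  unfolding approximates_def
proof (intro allI impI)
  fix W D assume "W \<subseteq> verts G" "D \<subseteq> edges G"
  then have "subgraph (induced_graph W D) G" using assms by (intro subgraph_induced_graph) auto
  then have "induced_graph W D \<in> \<H>" using assms unfolding subgraph_closed_def by blast
  then show "(1 - \<epsilon>) * card (cover_matchings D W) \<le> q (induced_graph W D) \<and>
      q (induced_graph W D) \<le> (1 + \<epsilon>) * card (cover_matchings D W)"
    using assms(3) unfolding approx_pm_counter_def num_perfect_matchings_induced_graph[symmetric] by blast
qed

lemma gibbs_no_edges:
  assumes "simple_graph G" "lam > 0" "edges G = {}"
  shows "gibbs lam G = return_pmf {}"
proof -
  have "set_pmf (gibbs lam G) \<subseteq> {{}}"
    using assms(3) by (auto simp: set_pmf_iff pmf_gibbs[OF assms(1,2)] matching_def split: if_splits)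
  then show ?thesis by (simp add: set_pmf_subset_singleton)
qed

text \<open>\<open>max 0 t\<close> is written because \<open>t\<close> is negative when
  \<open>\<delta>\<close> is large enough. The constant 19 bounds the calls of the walk and of the
  edge stage together.\<close>

definition sampler_meets :: "graph \<Rightarrow> real \<Rightarrow> real \<Rightarrow> presentation \<Rightarrow> (bool \<Rightarrow> graph \<Rightarrow> real) \<Rightarrow> bool" where
  "sampler_meets G lam \<delta> P orc \<longleftrightarrow>
     (let t = walk_length (card (verts G)) (card (edges G)) lam \<delta>;
          runs = exec P orc sampler (init_state P lam \<delta>)
      in tv_distance (map_pmf (output_edges P) runs) (gibbs lam G) \<le> \<delta> \<and>
         (\<forall>s\<in>set_pmf runs. matching G (output_edges P s) \<and> real (calls True s) \<le> 19 * max 0 t \<and>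
            calls False s = card (edges G) \<and>
            real (steps s) \<le> 200 * (real (card (verts G)) + 1)\<^sup>2 * (1 + max 0 t)))"

lemma sampler_meets_idle:
  assumes pres: "presents P G" and G: "simple_graph G" and lam: "lam > 0"
    and idle: "\<not> (\<delta> < 1 \<and> card (edges G) > 0)"
    and \<delta>: "\<delta> > 0"
  shows "sampler_meets G lam \<delta> P orc"
proof -
  define t where "t = walk_length (card (verts G)) (card (edges G)) lam \<delta>"
  define runs where "runs = exec P orc sampler (init_state P lam \<delta>)"
  let ?p = "measure_pmf.prob (map_pmf (output_edges P) runs)" and ?q = "measure_pmf.prob (gibbs lam G)"
  let ?n = "real (card (verts G))" and ?m = "card (edges G)"
  note m = presents_length_edges[OF pres]
  have rel: "rel_pmf (\<lambda>s (_::unit). output_edges P s = {} \<and> calls True s = 0 \<and> calls False s = ?m \<and>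
      steps s = 2 * ?m + 2) runs (return_pmf ())"
    using sampler_idle[of \<delta> P orc lam] idle unfolding runs_def m by blast
  have "map_pmf (output_edges P) runs = map_pmf (\<lambda>_. {}) (return_pmf ())"
    by (rule rel_pmf_map_eq[OF rel]) auto
  then have out: "map_pmf (output_edges P) runs = return_pmf {}" by simp
  have "tv_distance (map_pmf (output_edges P) runs) (gibbs lam G) \<le> \<delta>"
  proof (rule tv_distance_le)
    fix X
    show "\<bar>?p X - ?q X\<bar> \<le> \<delta>"
    proof (cases "\<delta> < 1")
      case True
      then have "edges G = {}" using idle finite_edges[OF G] by simp
      then show ?thesis using out gibbs_no_edges[OF G lam] \<delta> by simp
    next
      case False
      have "\<bar>a - b\<bar> \<le> 1" if "0 \<le> a" "a \<le> 1" "0 \<le> b" "b \<le> 1" for a b :: real using that by linarith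
      from this[of "?p X" "?q X"]
      have "\<bar>?p X - ?q X\<bar> \<le> 1"
        by simp
      then show ?thesis using False by linarith
    qed
  qed
  moreover have "matching G (output_edges P s) \<and> real (calls True s) \<le> 19 * max 0 t \<and> calls False s = ?m \<and>
      real (steps s) \<le> 200 * (?n + 1)\<^sup>2 * (1 + max 0 t)" if s: "s \<in> set_pmf runs" for s
  proof -
    have s: "output_edges P s = {}" "calls True s = 0" "calls False s = ?m" "steps s = 2 * ?m + 2"
      using rel_setD1[OF rel_pmf_imp_rel_set[OF rel] s] by auto
    have "real (steps s) \<le> 200 * (?n + 1)\<^sup>2 * 1"
      using card_edges_le[OF G] s(4) by (simp add: power2_sum)
    also have "\<dots> \<le> 200 * (?n + 1)\<^sup>2 * (1 + max 0 t)" by (intro mult_left_mono) auto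
    finally show ?thesis using s by (simp add: matching_def)
  qed
  ultimately show ?thesis unfolding sampler_meets_def Let_def runs_def t_def by blast
qed

lemma sampler_meets_main:
  assumes H: "\<forall>G\<in>\<H>. simple_graph G" "subgraph_closed \<H>" "\<forall>\<epsilon>>0. approx_pm_counter \<H> \<epsilon> (Q \<epsilon>)" "G \<in> \<H>"
    and pres: "presents P G" and lam: "lam > 0" and \<delta>: "0 < \<delta>" "\<delta> < 1" and m: "card (edges G) > 0"
  defines "orc \<equiv> \<lambda>b. if b then Q (walk_accuracy (card (verts G)) (card (edges G)) lam \<delta>)
    else Q (\<delta> / (3 * real (card (edges G))))"
  shows "sampler_meets G lam \<delta> P orc"
proof -
  let ?n = "real (card (verts G))" and ?m = "card (edges G)"
  define t where "t = walk_length (card (verts G)) ?m lam \<delta>"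
  define \<epsilon> where "\<epsilon> = walk_accuracy (card (verts G)) ?m lam \<delta>"
  define \<epsilon>' where "\<epsilon>' = \<delta> / (3 * real ?m)"
  define N where "N = nat \<lceil>8 * t\<rceil>"
  have G: "simple_graph G" using H by blast
  have "verts G \<noteq> {}"
  proof
    assume "verts G = {}"
    then have "edges G \<subseteq> {{}}" "{} \<notin> edges G" using G by (auto simp: simple_graph_def)
    then show False using m by (metis card.empty less_irrefl subset_singletonD insertI1)
  qed
  then interpret sampler_run P G lam \<delta> orc using pres G lam by unfold_locales
  have n0: "card (verts G) > 0" using \<open>verts G \<noteq> {}\<close> G by (auto simp: simple_graph_def card_gt_0_iff)
  \<comment> \<open>The comparison behind the choice of oracles: \<open>\<epsilon> \<le> \<delta> /
    (3 * t) \<le> \<delta> / (3 * m) = \<epsilon>'\<close>.\<close>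
  have mt: "real ?m \<le> t"
    using card_edges_le[OF G] walk_length_ge[OF \<delta> lam, of "card (verts G)" ?m] unfolding t_def by linarith
  have t1: "t \<ge> 1" using mt m by linarith
  have \<epsilon>le: "\<epsilon> \<le> \<delta> / 3 / t"
    unfolding \<epsilon>_def walk_accuracy_def t_def[symmetric] using t1 \<delta> by (intro divide_right_mono ln_add_one_self_le_self) auto
  have \<epsilon>0: "\<epsilon> > 0" unfolding \<epsilon>_def walk_accuracy_def t_def[symmetric] using t1 \<delta> by simp
  have "\<delta> / 3 / t \<le> \<delta> / 3 / 1" using t1 \<delta> by (intro divide_left_mono) auto
  then have \<epsilon>13: "\<epsilon> \<le> \<delta> / 3" using \<epsilon>le by simp
  have "\<delta> / 3 / t \<le> \<delta> / 3 / real ?m" using mt m \<delta> t1 by (intro divide_left_mono) auto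
  then have \<epsilon>\<epsilon>': "\<epsilon> \<le> \<epsilon>'" using \<epsilon>le by (simp add: \<epsilon>'_def)
  have \<epsilon>'0: "\<epsilon>' > 0" using \<delta> m by (simp add: \<epsilon>'_def)
  have "\<delta> / (3 * real ?m) \<le> \<delta> / 3" using \<delta> m by (intro divide_left_mono) auto
  then have \<epsilon>'2: "\<epsilon>' \<le> 1 / 2" using \<delta> unfolding \<epsilon>'_def by linarith
  have m\<epsilon>': "real ?m * \<epsilon>' = \<delta> / 3" using m by (simp add: \<epsilon>'_def)
  have N: "8 * t \<le> real N" "real N \<le> 8 * t + 1"
    unfolding N_def using t1 by (simp_all add: of_nat_ceiling)
  define runs where "runs = exec P orc sampler (init_state P lam \<delta>)"
  let ?p = "measure_pmf.prob (map_pmf (output_edges P) runs)" and ?q = "measure_pmf.prob (gibbs lam G)"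
  define es where "es = map (nth_edge P) [0..<?m]"
  define c where "c = 3 * ?m + N * (10 * card (verts G) + 17) + 6"
  have rel: "rel_pmf (sample_inv (2 * N) c ?m) runs (bind_pmf (walk (verts G) oracle_weight N)
      (\<lambda>S. sample_edges (orc False) (orc True) es (S, {})))"
    using sampler_correct \<delta> m
    unfolding length_edges length_verts runs_def es_def c_def N_def t_def by blast
  have out: "map_pmf (output_edges P) runs = bind_pmf (walk (verts G) oracle_weight N)
      (\<lambda>S. map_pmf snd (sample_edges (orc False) (orc True) es (S, {})))"
    using rel_pmf_map_eq[OF rel, of "output_edges P" snd] by (auto simp: sample_inv_def map_bind_pmf)
  have "tv_distance (map_pmf (output_edges P) runs) (gibbs lam G) \<le> \<delta>"
  proof (rule tv_distance_le)
    fix X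
    have g: "oracle_weight = (\<lambda>S. if S \<subseteq> verts G then orc True (induced_graph S (edges G)) * sqrt lam ^ card S else 0)"
      by (rule ext) (simp add: oracle_weight_def)
    have es: "distinct es" "set es = edges G"
    proof -
      have "inj_on (nth_edge P) {..<?m}" using pres unfolding length_edges[symmetric] by (simp add: presents_def)
      then show "distinct es" by (simp add: es_def distinct_map atLeast0LessThan)
      show "set es = edges G" using edges_eq unfolding length_edges by (simp add: es_def atLeast0LessThan)
    qed
    have "\<bar>?p X - ?q X\<bar> \<le>
        sqrt (2 * (1 + lam) ^ ?m * exp (- (real N / ?n\<^sup>2))) + \<epsilon> + real ?m * \<epsilon>'"
      unfolding out g
    proof (rule walk_then_sample_tv[OF G \<open>verts G \<noteq> {}\<close> lam es])
      show "0 \<le> \<epsilon>" "\<epsilon> \<le> 1 / 3" "\<epsilon> \<le> \<epsilon>'" "\<epsilon>' \<le> 1 / 2" using \<epsilon>0 \<epsilon>13 \<epsilon>\<epsilon>' \<epsilon>'2 \<delta> by auto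
      have "orc True = Q \<epsilon>" "orc False = Q \<epsilon>'" by (simp_all add: orc_def \<epsilon>_def \<epsilon>'_def)
      moreover have "approx_pm_counter \<H> \<epsilon> (Q \<epsilon>)" "approx_pm_counter \<H> \<epsilon>' (Q \<epsilon>')" using H(3) \<epsilon>0 \<epsilon>'0 by auto
      ultimately show "approximates (verts G) (edges G) \<epsilon> (orc True)" "approximates (verts G) (edges G) \<epsilon>' (orc False)"
        using approximates_oracle[OF H(1,2) _ H(4)] by auto
    qed
    \<comment> \<open>One share each for mixing, for the stationary law and for the \<open>m\<close>
      edge decisions.\<close>
    also have "\<dots> \<le> \<delta> / 3 + \<delta> / 3 + \<delta> / 3"
      using mixing_bound[OF \<delta> lam n0] N(1) \<epsilon>13 m\<epsilon>' unfolding t_def by (intro add_mono) auto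
    finally show "\<bar>?p X - ?q X\<bar> \<le> \<delta>"
      by simp
  qed
  moreover have "matching G (output_edges P s) \<and> real (calls True s) \<le> 19 * max 0 t \<and> calls False s = ?m \<and>
      real (steps s) \<le> 200 * (?n + 1)\<^sup>2 * (1 + max 0 t)" if s: "s \<in> set_pmf runs" for s
  proof -
    obtain a where "sample_inv (2 * N) c ?m s a" using rel_setD1[OF rel_pmf_imp_rel_set[OF rel] s] by blast
    then have s: "matching G (output_edges P s)" "calls True s = 2 * N + ?m" "calls False s = ?m"
      "steps s \<le> c + 14 * ?m"
      by (auto simp: sample_inv_def)
    have "real (calls True s) = 2 * real N + real ?m" using s(2) by simp
    \<comment> \<open>\<open>2 * N \<le> 16 * t + 2\<close>, where the 2 is due to rounding up,
      together with \<open>m \<le> t\<close> and \<open>1 \<le> t\<close>.\<close>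
    also have "\<dots> \<le> 19 * t" using N mt t1 by linarith
    finally have calls: "real (calls True s) \<le> 19 * max 0 t" using t1 by simp
    have "real (steps s) \<le> real (c + 14 * ?m)" using s(4) by (rule of_nat_mono)
    also have "\<dots> = 17 * real ?m + real N * (10 * ?n + 17) + 6" by (simp add: c_def algebra_simps)
    also have "\<dots> \<le> 17 * (?n + 1)\<^sup>2 + (9 * (1 + t)) * (17 * (?n + 1)\<^sup>2) + 6 * (?n + 1)\<^sup>2"
    proof -
      have n: "?n \<ge> 1" using n0 by simp
      have sq: "(?n + 1)\<^sup>2 = ?n\<^sup>2 + 2 * ?n + 1" by (simp add: power2_sum)
      have "10 * ?n + 17 \<le> 17 * (?n + 1)\<^sup>2" using n sq zero_le_power2[of ?n] by linarith
      then have "real N * (10 * ?n + 17) \<le> (9 * (1 + t)) * (17 * (?n + 1)\<^sup>2)"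
        using N t1 by (intro mult_mono) auto
      moreover have "17 * real ?m \<le> 17 * (?n + 1)\<^sup>2" using card_edges_le[OF G] n sq by simp
      moreover have "6 \<le> 6 * (?n + 1)\<^sup>2" using n sq zero_le_power2[of ?n] by linarith
      ultimately show ?thesis by linarith
    qed
    also have "\<dots> = (23 + 153 * (1 + t)) * (?n + 1)\<^sup>2" by (simp add: algebra_simps)
    also have "\<dots> \<le> (200 * (1 + t)) * (?n + 1)\<^sup>2" using t1 by (intro mult_right_mono) auto
    finally have "real (steps s) \<le> (200 * (1 + t)) * (?n + 1)\<^sup>2" .
    moreover have "max 0 t = t" using t1 by simp
    ultimately have "real (steps s) \<le> 200 * (?n + 1)\<^sup>2 * (1 + max 0 t)" by (simp only: mult_ac)
    then show ?thesis using s calls by blast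
  qed
  ultimately show ?thesis unfolding sampler_meets_def Let_def runs_def t_def by blast
qed

text \<open>The single text \<open>sampler\<close> serves for all classes, oracles and parameters,
  since \<open>lam\<close> and \<open>\<delta>\<close> are read from memory. The witness 200 is
  dictated by the step bound; the other estimates need less.\<close>

theorem theorem4p1:
  shows "\<exists>(C::real) (k::nat). C > 0 \<and>
    (\<forall>(\<H> :: graph set) (Q :: real \<Rightarrow> graph \<Rightarrow> real) (\<delta>::real) (lam::real).
      (\<forall>G\<in>\<H>. simple_graph G) \<and> subgraph_closed \<H> \<and>
      (\<forall>\<epsilon>>0. approx_pm_counter \<H> \<epsilon> (Q \<epsilon>)) \<and> \<delta> > 0 \<and> lam > 0 \<longrightarrow>
      (\<exists>A::program. \<forall>G\<in>\<H>. \<forall>P. presents P G \<longrightarrow>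
        (let n = card (verts G);
             m = card (edges G);
             t = walk_length n m lam \<delta>;
             \<delta>' = walk_accuracy n m lam \<delta>;
             B = (real n)\<^sup>2 * (real m * ln lam + ln (1 / \<delta>));
             orc = (\<lambda>b. if b then Q \<delta>' else Q (\<delta> / (3 * real m)));
             runs = exec P orc A (init_state P lam \<delta>)
         in tv_distance (map_pmf (output_edges P) runs) (gibbs lam G) \<le> \<delta> \<and>
            (\<forall>s\<in>set_pmf runs.
               matching G (output_edges P s) \<and>
               real (calls True s) \<le> C * max 0 t \<and>
               (lam \<ge> 2 \<and> \<delta> \<le> 1 / 2 \<longrightarrow> real (calls True s) \<le> C * B) \<and>
               calls False s = m \<and>
               (\<forall>(b, K)\<in>set (queries s). subgraph K G) \<and>
               real (steps s) \<le> C * (real n + 1) ^ k * (1 + max 0 t)) \<and>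
            (lam \<ge> 2 \<and> \<delta> \<le> 1 / 2 \<longrightarrow> \<delta>' \<ge> \<delta> / (C * B)))))"
proof (intro exI[of _ "200::real"] exI[of _ "2::nat"] exI[of _ sampler] conjI allI impI ballI, goal_cases)
  case (2 \<H> Q \<delta> lam G P)
  then have A: "\<forall>G\<in>\<H>. simple_graph G" "subgraph_closed \<H>" "\<forall>\<epsilon>>0. approx_pm_counter \<H> \<epsilon> (Q \<epsilon>)"
    "\<delta> > 0" "lam > 0" and GH: "G \<in> \<H>" and pres: "presents P G" by blast+
  define n m t \<epsilon> B orc runs where "n = card (verts G)" and "m = card (edges G)"
    and "t = walk_length n m lam \<delta>" and "\<epsilon> = walk_accuracy n m lam \<delta>"
    and "B = (real n)\<^sup>2 * (real m * ln lam + ln (1 / \<delta>))"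
    and "orc = (\<lambda>b. if b then Q \<epsilon> else Q (\<delta> / (3 * real m)))"
    and "runs = exec P orc sampler (init_state P lam \<delta>)"
  have G: "simple_graph G" using A GH by blast
  have "sampler_meets G lam \<delta> P orc"
  proof (cases "\<delta> < 1 \<and> card (edges G) > 0")
    case True
    then show ?thesis
      unfolding orc_def \<epsilon>_def n_def m_def using A GH pres by (intro sampler_meets_main[of \<H>]) auto
  next
    case False
    then show ?thesis using A pres G by (intro sampler_meets_idle) auto
  qed
  then have meets: "tv_distance (map_pmf (output_edges P) runs) (gibbs lam G) \<le> \<delta>"
    "\<And>s. s \<in> set_pmf runs \<Longrightarrow> matching G (output_edges P s) \<and> real (calls True s) \<le> 19 * max 0 t \<and>
      calls False s = m \<and> real (steps s) \<le> 200 * (real n + 1)\<^sup>2 * (1 + max 0 t)"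
    unfolding sampler_meets_def Let_def runs_def t_def n_def m_def by blast+
  have c1: "real (calls True s) \<le> 200 * max 0 t" if "s \<in> set_pmf runs" for s
    using meets(2)[OF that] by linarith
  have c2: "real (calls True s) \<le> 200 * B" if "s \<in> set_pmf runs" "lam \<ge> 2 \<and> \<delta> \<le> 1 / 2" for s
  proof -
    have "t \<le> 3 / 2 * B" unfolding t_def B_def using walk_length_le(1) A that(2) by blast
    moreover have "B \<ge> 0"
      unfolding B_def by (rule mult_nonneg_nonneg) (use walk_length_le(2) A that(2) in auto)
    ultimately show ?thesis using meets(2)[OF that(1)] by (auto simp: max_def split: if_splits)
  qed
  have q: "\<forall>(b, K)\<in>set (queries s). subgraph K G" if "s \<in> set_pmf runs" for s
    by (rule queries_subgraph[OF pres G _ that[unfolded runs_def]]) (simp add: init_state_sel)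
  have acc: "\<epsilon> \<ge> \<delta> / (200 * B)" if "lam \<ge> 2 \<and> \<delta> \<le> 1 / 2"
    unfolding \<epsilon>_def B_def using A that by (intro walk_accuracy_ge) auto
  show ?case
    unfolding Let_def n_def[symmetric] m_def[symmetric] t_def[symmetric] \<epsilon>_def[symmetric] B_def[symmetric]
      orc_def[symmetric] runs_def[symmetric]
    using meets c1 c2 q acc by blast
qed simp

end
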